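(* Let $d\ge1$, $2<p<\infty$, $1<q<\infty$, let $q'=\frac{q}{q-1}$, and let $\beta>\frac{q'}{2}$. Then there exist a compact set $S\subset\mathbb{R}^d$ and a probability measure $\mu$ on $\mathbb{R}^d$ such that $\operatorname{supp}\mu\subset S$, $\hat{\mu}\in L_{p,q}(\mathbb{R}^d)$ and $\mathcal{H}_{\frac{2d}{p},\beta}(S)=0$.
   Context: Lorentz spaces: for $p,q\in(0,\infty)$, $\|f\|^q_{L_{p,q}}=q\int_0^\infty (m_f(t)t^p)^{q/p}\frac{dt}{t}$, where $m_f(t)$ is the Lebesgue measure of $\{x: |f(x)|\geqslant t\}$. Netrusov--Hausdorff capacity: let $\Delta_k=[2^{-k-1},2^{-k})$ for $k\in\mathbb{Z}$. For $F\subset\mathbb{R}^d$, $\alpha>0$, $\delta>0$ and $0<\beta<\infty$ set $\mathcal{H}_{\alpha,\beta}(F,\delta)=\inf\big\{\sum_{k}\big(\sum_{j:\,\operatorname{diam}B_j\in\Delta_k}(\operatorname{diam}B_j)^\alpha\big)^\beta : F\subset\bigcup_j B_j,\ \operatorname{diam}B_j<\delta\big\}$ (countable covers) and $\mathcal{H}_{\alpha,\beta}(F)=\lim_{\delta\to0}\mathcal{H}_{\alpha,\beta}(F,\delta)$. *)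

theory Defs
  imports "HOL-Probability.Probability"
begin

definition enn_powr :: "ennreal \<Rightarrow> real \<Rightarrow> ennreal" where
  "enn_powr x b = (if x = top then top else ennreal (enn2real x powr b))"

definition distrib_fun :: "('a::euclidean_space \<Rightarrow> complex) \<Rightarrow> real \<Rightarrow> ennreal" where
  "distrib_fun f t = emeasure lebesgue {x. cmod (f x) \<ge> t}"

definition lorentz_norm_pow :: "real \<Rightarrow> real \<Rightarrow> ('a::euclidean_space \<Rightarrow> complex) \<Rightarrow> ennreal" where
  "lorentz_norm_pow p q f =
     ennreal q * (\<integral>\<^sup>+ t. indicator {0<..} t *
        enn_powr (distrib_fun f t * ennreal (t powr p)) (q / p) / ennreal t \<partial>lborel)"

definition in_lorentz :: "real \<Rightarrow> real \<Rightarrow> ('a::euclidean_space \<Rightarrow> complex) \<Rightarrow> bool" where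
  "in_lorentz p q f \<longleftrightarrow> f \<in> borel_measurable lebesgue \<and> lorentz_norm_pow p q f < top"

definition fourier_measure :: "'a::euclidean_space measure \<Rightarrow> 'a \<Rightarrow> complex" where
  "fourier_measure M \<xi> = (\<integral>x. cis (- 2 * pi * (x \<bullet> \<xi>)) \<partial>M)"

definition measure_support :: "'a::euclidean_space measure \<Rightarrow> 'a set" where
  "measure_support M = {x. \<forall>e>0. emeasure M (ball x e) > 0}"

definition dyadic :: "int \<Rightarrow> real set" where
  "dyadic k = {2 powr (- real_of_int k - 1) ..< 2 powr (- real_of_int k)}"

text \<open>Countable covers of F by balls of diameter < delta (indexed by nat; finite covers
  are included by padding with empty balls, which contribute nothing).\<close>
definition ball_cover :: "'a::euclidean_space set \<Rightarrow> real \<Rightarrow> (nat \<Rightarrow> 'a set) \<Rightarrow> bool" where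
  "ball_cover F \<delta> B \<longleftrightarrow> (\<forall>j. \<exists>c r. B j = ball c r) \<and> (\<forall>j. diameter (B j) < \<delta>) \<and>
     F \<subseteq> (\<Union>j. B j)"

definition cover_cost :: "real \<Rightarrow> real \<Rightarrow> (nat \<Rightarrow> 'a::euclidean_space set) \<Rightarrow> ennreal" where
  "cover_cost \<alpha> \<beta> B = (\<Sum>\<^sub>\<infinity> k::int.
      enn_powr (\<Sum>\<^sub>\<infinity> j::nat. if diameter (B j) \<in> dyadic k
                               then ennreal (diameter (B j) powr \<alpha>) else 0) \<beta>)"

definition NH_cap_delta :: "real \<Rightarrow> real \<Rightarrow> 'a::euclidean_space set \<Rightarrow> real \<Rightarrow> ennreal" where
  "NH_cap_delta \<alpha> \<beta> F \<delta> = (INF B \<in> {B. ball_cover F \<delta> B}. cover_cost \<alpha> \<beta> B)"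

definition NH_cap :: "real \<Rightarrow> real \<Rightarrow> 'a::euclidean_space set \<Rightarrow> ennreal" where
  "NH_cap \<alpha> \<beta> F = Lim (at_right 0) (\<lambda>\<delta>. NH_cap_delta \<alpha> \<beta> F \<delta>)"

end

theory Submission
  imports Defs
begin

text \<open>
  The measure is a limit of stages. A stage replaces a probability measure \<open>\<nu>\<close> by the average, over
  \<open>n\<close> consecutive dyadic scales \<open>2^(-k)\<close>, of \<open>N k\<close> cubes of side comparable to \<open>2^(-k)\<close> whose positions
  are sampled from \<open>\<nu>\<close>. Sampling perturbs the Fourier transform at scale \<open>k\<close> by about \<open>N k^(-1/2)\<close> on
  frequencies up to \<open>2^k\<close>; controlling this in moments rather than uniformly avoids a logarithmic loss.
  If \<open>1 / (n * sqrt (N k)) = c * 2^(-k * d / p)\<close>, then the error has Lorentz norm to the power \<open>q\<close> of order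
  \<open>n * c^q\<close>, while covering the cubes scale by scale costs about \<open>n * (n * c)^(-2 * \<beta>)\<close>. Taking \<open>c\<close> to be a
  small multiple of \<open>n^(-1 / q)\<close> keeps the error small, and the cost then tends to \<open>0\<close> as \<open>n\<close> grows
  precisely because \<open>\<beta> > q' / 2\<close>.
\<close>

section \<open>Lorentz quasi-norms\<close>

text \<open>The sampling errors decouple because different scales live at different heights. At
  scale k the error has size about c * 2^(-k*d/p) on a frequency region of measure about 2^(k*d), so
  the distribution function times t^p is about c^p for t near that height, and the heights of the n
  scales form a geometric progression. With n * c^q fixed, n * c grows like n^(1/q') and the cost
  like n^(1 - 2*\<beta>/q').

  Sampling is not the only error: spreading points into cubes multiplies the old transform by a
  factor that is close to 1 only at low frequencies. That second error is controlled in L2, which is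
  why every stage carries a square-integrable transform, and it is made small by starting the n
  scales at a large k0. The choice of k0 comes after that of n and is harmless, since neither the
  sampling bound nor the cost bound depends on k0.

  The Lorentz expression is not a norm in general. Sums are handled through inclusions of level sets
  with geometric weights, which forces the errors of successive stages to decrease geometrically.
  The carriers sit in nested compact sets, each in the interior of its container, so that the limit
  inherits every cover.\<close>

lemma enn_powr_ennreal: "0 \<le> x \<Longrightarrow> enn_powr (ennreal x) b = ennreal (x powr b)"
  by (simp add: enn_powr_def)

lemma enn_powr_0 [simp]: "enn_powr 0 b = 0"
  by (simp add: enn_powr_def)

lemma enn_powr_mono:
  assumes "x \<le> y" "0 \<le> b"
  shows "enn_powr x b \<le> enn_powr y b"
  using assms
  by (cases x; cases y)
     (auto simp: enn_powr_def ennreal_le_iff intro!: ennreal_leI powr_mono2 simp: top_unique)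

lemma measurable_enn_powr [measurable]:
  assumes [measurable]: "f \<in> borel_measurable M"
  shows "(\<lambda>x. enn_powr (f x) b) \<in> borel_measurable M"
  unfolding enn_powr_def by measurable

lemma enn_powr_cmult:
  assumes "0 < a" "0 < b"
  shows "enn_powr (ennreal a * x) b = ennreal (a powr b) * enn_powr x b"
proof (cases x)
  case (real r)
  then show ?thesis using assms
    by (simp add: enn_powr_ennreal ennreal_mult[symmetric] powr_mult)
next
  case top
  then show ?thesis using assms by (simp add: enn_powr_def ennreal_mult_top)
qed

lemma enn_powr_powr_inverse:
  assumes "0 < b"
  shows "enn_powr (enn_powr x b) (1 / b) = x" "enn_powr (enn_powr x (1 / b)) b = x"
  using assms by (cases x; simp add: enn_powr_def powr_powr)+

text \<open>The weights 1/2^(s+1) add up to 1, so the sum is at most the supremum of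
  \<open>2 ^ Suc s * a s\<close>, and the power of a supremum is at most the sum of the powers. The
  argument is the same for \<open>b\<close> below and above 1, so later no case distinction between
  q < p and q > p arises.\<close>

lemma enn_powr_suminf_le:
  fixes a :: "nat \<Rightarrow> ennreal"
  assumes b: "0 < b"
  shows "enn_powr (\<Sum>s. a s) b \<le> (\<Sum>s. enn_powr (ennreal (2 ^ Suc s) * a s) b)"
proof -
  define y where "y = (\<Sum>s. enn_powr (ennreal (2 ^ Suc s) * a s) b)"
  \<comment> \<open>A common bound for all \<open>2 ^ Suc s * a s\<close> whose power
    \<open>b\<close> is exactly the right-hand side.\<close>
  define z where "z = enn_powr y (1 / b)"
  have "enn_powr (ennreal (2 ^ Suc s) * a s) b \<le> y" for s
    unfolding y_def using sum_le_suminf[of "\<lambda>s. enn_powr (ennreal (2 ^ Suc s) * a s) b" "{s}"]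
    by simp
  from enn_powr_mono[OF this, of "1 / b"] have le: "ennreal (2 ^ Suc s) * a s \<le> z" for s
    using b by (simp add: enn_powr_powr_inverse z_def)
  have "a s \<le> ennreal ((1 / 2) ^ Suc s) * z" for s
  proof -
    have "ennreal ((1 / 2) ^ Suc s) * (ennreal (2 ^ Suc s) * a s) = a s"
      by (simp add: mult.assoc[symmetric] ennreal_mult[symmetric] power_mult_distrib[symmetric]
               del: power_Suc)
    with mult_left_mono[OF le, of "ennreal ((1 / 2) ^ Suc s)" s] show ?thesis by simp
  qed
  then have "(\<Sum>s. a s) \<le> (\<Sum>s. ennreal ((1 / 2) ^ Suc s) * z)"
    by (intro suminf_le) auto
  also have "\<dots> = (\<Sum>s. ennreal ((1 / 2) ^ Suc s)) * z"
    by (rule ennreal_suminf_multc)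
  also have "(\<Sum>s. ennreal ((1 / 2) ^ Suc s)) = 1"
    using suminf_ennreal_eq[OF _ power_half_series] by (simp only: zero_le_power zero_le_divide_1_iff zero_le_numeral ennreal_1 simp_thms)
  finally have "(\<Sum>s. a s) \<le> z" by simp
  from enn_powr_mono[OF this, of b] show ?thesis
    using b by (simp add: enn_powr_powr_inverse z_def y_def)
qed

text \<open>Superlevel sets are closed downwards, hence empty, the whole line or a ray. Applied to
  distribution functions, which decrease in the height.\<close>

lemma antimono_borel_measurable_ennreal:
  fixes f :: "real \<Rightarrow> ennreal"
  assumes "antimono f"
  shows "f \<in> borel_measurable borel"
proof (rule borel_measurableI_ge)
  fix y :: ennreal
  let ?A = "{x \<in> space borel. y \<le> f x}"
  have down: "u \<in> ?A" if "v \<in> ?A" "u \<le> v" for u v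
    using that antimonoD[OF assms, of u v] by auto
  show "?A \<in> sets borel"
  proof (cases "?A \<noteq> {} \<and> bdd_above ?A")
    case True
    have "x \<in> ?A" if "x < Sup ?A" for x
      using that less_cSup_iff[of ?A x] True down by (meson less_imp_le)
    moreover have "x \<le> Sup ?A" if "x \<in> ?A" for x
      using that True by (intro cSup_upper) auto
    ultimately have "?A = {..<Sup ?A} \<or> ?A = {..Sup ?A}"
      by (auto simp: set_eq_iff) (metis less_eq_real_def)+
    then show ?thesis
      by (metis (no_types, lifting) borel_closed borel_open closed_atMost open_lessThan)
  next
    case False
    have "?A = UNIV" if "?A \<noteq> {}" "\<not> bdd_above ?A"
    proof -
      have "x \<in> ?A" for x
      proof -
        have "\<exists>v\<in>?A. x < v"
          using that(2) by (meson bdd_above.I not_le)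
        then show ?thesis using down by (meson less_imp_le)
      qed
      then show ?thesis by auto
    qed
    then show ?thesis using False by (cases "?A = {}") auto
  qed
qed

lemma measurable_distrib_fun [measurable]:
  assumes [measurable]: "f \<in> borel_measurable lebesgue"
  shows "distrib_fun f \<in> borel_measurable borel"
proof (rule antimono_borel_measurable_ennreal, rule antimonoI)
  fix x y :: real assume "x \<le> y"
  then show "distrib_fun f y \<le> distrib_fun f x"
    unfolding distrib_fun_def
    using measurable_sets[of "\<lambda>x. cmod (f x)" lebesgue borel "{x..}"]
    by (intro emeasure_mono) (auto simp: vimage_def)
qed

text \<open>The substitute for the triangle inequality. Where \<open>g\<close> reaches height
  \<open>t\<close>, some \<open>f s\<close> does too, so the distribution function of
  \<open>g\<close> is at most the sum of the others. Only level sets are compared, so the lemma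
  serves finite sums and pointwise limits alike.\<close>

lemma lorentz_norm_pow_countable:
  fixes f :: "nat \<Rightarrow> 'a::euclidean_space \<Rightarrow> complex"
  assumes p: "0 < p" and q: "0 < q"
    and f [measurable]: "\<And>s. f s \<in> borel_measurable lebesgue"
    and g: "\<And>t x. 0 < t \<Longrightarrow> t \<le> cmod (g x) \<Longrightarrow> \<exists>s. t \<le> cmod (f s x)"
  shows "lorentz_norm_pow p q g
    \<le> (\<Sum>s. ennreal ((2 ^ Suc s) powr (q / p)) * lorentz_norm_pow p q (f s))"
proof -
  let ?b = "q / p"
  have b: "0 < ?b" using p q by simp
  define I where "I s t = indicator {0<..} t *
        enn_powr (distrib_fun (f s) t * ennreal (t powr p)) ?b / ennreal t" for s and t :: real
  have [measurable]: "I s \<in> borel_measurable borel" for s unfolding I_def by measurable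
  have set: "{x. t \<le> cmod (f s x)} \<in> sets lebesgue" for s t
    using measurable_sets[of "\<lambda>x. cmod (f s x)" lebesgue borel "{t..}"] by (auto simp: vimage_def)
  have pt: "indicator {0<..} t * enn_powr (distrib_fun g t * ennreal (t powr p)) ?b / ennreal t
      \<le> (\<Sum>s. ennreal ((2 ^ Suc s) powr ?b) * I s t)" for t :: real
  proof (cases "0 < t")
    case True
    have "distrib_fun g t \<le> emeasure lebesgue (\<Union>s. {x. t \<le> cmod (f s x)})"
      unfolding distrib_fun_def using g[OF True] set by (intro emeasure_mono) auto
    also have "\<dots> \<le> (\<Sum>s. distrib_fun (f s) t)"
      unfolding distrib_fun_def using set by (intro emeasure_subadditive_countably) auto
    finally have "distrib_fun g t * ennreal (t powr p) \<le> (\<Sum>s. distrib_fun (f s) t) * ennreal (t powr p)"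
      by (rule mult_right_mono) simp
    also have "\<dots> = (\<Sum>s. distrib_fun (f s) t * ennreal (t powr p))"
      by (simp add: ennreal_suminf_multc)
    finally have "enn_powr (distrib_fun g t * ennreal (t powr p)) ?b
        \<le> (\<Sum>s. enn_powr (ennreal (2 ^ Suc s) * (distrib_fun (f s) t * ennreal (t powr p))) ?b)"
      using enn_powr_mono enn_powr_suminf_le[OF b] b by (meson less_imp_le order_trans)
    also have "\<dots> = (\<Sum>s. ennreal ((2 ^ Suc s) powr ?b) * enn_powr (distrib_fun (f s) t * ennreal (t powr p)) ?b)"
      using b by (intro arg_cong[where f=suminf] ext enn_powr_cmult) auto
    finally have "enn_powr (distrib_fun g t * ennreal (t powr p)) ?b / ennreal t
      \<le> (\<Sum>s. ennreal ((2 ^ Suc s) powr ?b) * enn_powr (distrib_fun (f s) t * ennreal (t powr p)) ?b) / ennreal t"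
      by (rule divide_right_mono_ennreal)
    then show ?thesis using True
      by (simp add: I_def divide_ennreal_def mult.assoc[symmetric] del: power_Suc)
  qed simp
  have "lorentz_norm_pow p q g \<le> ennreal q * (\<integral>\<^sup>+ t. (\<Sum>s. ennreal ((2 ^ Suc s) powr ?b) * I s t) \<partial>lborel)"
    unfolding lorentz_norm_pow_def by (intro mult_left_mono nn_integral_mono pt) auto
  also have "(\<integral>\<^sup>+ t. (\<Sum>s. ennreal ((2 ^ Suc s) powr ?b) * I s t) \<partial>lborel)
      = (\<Sum>s. ennreal ((2 ^ Suc s) powr ?b) * (\<integral>\<^sup>+ t. I s t \<partial>lborel))"
    by (subst nn_integral_suminf) (auto simp: nn_integral_cmult)
  also have "ennreal q * \<dots> = (\<Sum>s. ennreal ((2 ^ Suc s) powr (q / p)) * lorentz_norm_pow p q (f s))"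
    unfolding lorentz_norm_pow_def I_def by (subst ennreal_suminf_cmult[symmetric]) (simp only: mult.left_commute)
  finally show ?thesis .
qed

text \<open>Dilating the height by \<open>a\<close> preserves dt/t and turns t^p into a^p *
  t^p.\<close>

lemma lorentz_norm_pow_cmult:
  fixes f :: "'a::euclidean_space \<Rightarrow> complex"
  assumes a: "0 < a" and p: "0 < p" and q: "0 < q"
    and f [measurable]: "f \<in> borel_measurable lebesgue"
  shows "lorentz_norm_pow p q (\<lambda>x. of_real a * f x) = ennreal (a powr q) * lorentz_norm_pow p q f"
proof -
  define I where "I f t = indicator {0<..} t *
        enn_powr (distrib_fun f t * ennreal (t powr p)) (q / p) / ennreal t"
    for f :: "'a \<Rightarrow> complex" and t :: real
  have [measurable]: "I f \<in> borel_measurable borel" if [measurable]: "f \<in> borel_measurable lebesgue" for f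
    unfolding I_def by measurable
  have d: "distrib_fun (\<lambda>x. of_real a * f x) (a * t) = distrib_fun f t" for t
    using a by (simp add: distrib_fun_def norm_mult)
  have *: "ennreal a * I (\<lambda>x. of_real a * f x) (0 + a * t) = ennreal (a powr q) * I f t" for t
  proof (cases "0 < t")
    case True
    have "enn_powr (distrib_fun f t * ennreal ((a * t) powr p)) (q / p)
        = enn_powr (ennreal (a powr p) * (distrib_fun f t * ennreal (t powr p))) (q / p)"
      using a True by (simp add: powr_mult ennreal_mult mult_ac)
    also have "\<dots> = ennreal (a powr q) * enn_powr (distrib_fun f t * ennreal (t powr p)) (q / p)"
      using a p q by (subst enn_powr_cmult) (auto simp: powr_powr)
    finally have e: "enn_powr (distrib_fun f t * ennreal ((a * t) powr p)) (q / p) = \<dots>" .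
    have "ennreal a * (X / ennreal (a * t)) = X / ennreal t" for X
    proof -
      have "ennreal a * (X / ennreal (a * t)) = X * (ennreal a * inverse (ennreal (a * t)))"
        by (simp add: divide_ennreal_def mult_ac)
      also have "ennreal a * inverse (ennreal (a * t)) = inverse (ennreal t)"
        using a True by (simp add: inverse_ennreal ennreal_mult[symmetric])
      finally show ?thesis by (simp add: divide_ennreal_def)
    qed
    then show ?thesis using True a
      by (simp add: I_def d e zero_less_mult_iff ennreal_times_divide)
  next
    case False
    then have "\<not> 0 < a * t" using a by (simp add: zero_less_mult_iff)
    then show ?thesis using False by (simp add: I_def)
  qed
  have "(\<integral>\<^sup>+ t. I (\<lambda>x. of_real a * f x) t \<partial>lborel)
      = ennreal a * (\<integral>\<^sup>+ t. I (\<lambda>x. of_real a * f x) (0 + a * t) \<partial>lborel)"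
    using a by (subst nn_integral_real_affine[where c=a and t=0]) auto
  also have "\<dots> = (\<integral>\<^sup>+ t. ennreal (a powr q) * I f t \<partial>lborel)"
    by (subst nn_integral_cmult[symmetric]) (auto simp only: *, measurable)
  also have "\<dots> = ennreal (a powr q) * (\<integral>\<^sup>+ t. I f t \<partial>lborel)"
    by (rule nn_integral_cmult) simp
  finally show ?thesis
    by (simp add: lorentz_norm_pow_def I_def mult.left_commute)
qed

text \<open>For u > 0 this is exp(-|ln u|): it decays with the logarithmic distance of
  \<open>u\<close> from 1. Its powers are therefore summable along geometric progressions and
  integrable against dt/t, in both cases uniformly in the position of the peak.\<close>

definition psi :: "real \<Rightarrow> real" where
  "psi u = min u (1 / u)"

lemma psi_pos: "0 < u \<Longrightarrow> 0 < psi u"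
  by (simp add: psi_def)

lemma measurable_psi [measurable]: "psi \<in> borel_measurable borel"
  unfolding psi_def by measurable

lemma sum_power_inj_le:
  fixes b :: real
  assumes "0 \<le> b" "b < 1" "finite K" "inj_on f K"
  shows "(\<Sum>k\<in>K. b ^ f k) \<le> 1 / (1 - b)"
proof -
  have "(\<Sum>k\<in>K. b ^ f k) = (\<Sum>i\<in>f ` K. b ^ i)"
    using assms by (simp add: sum.reindex)
  also have "\<dots> \<le> (\<Sum>i. b ^ i)"
    using assms by (intro sum_le_suminf) (auto intro: summable_geometric)
  finally show ?thesis using assms by (simp add: suminf_geometric)
qed

text \<open>The terms decay geometrically on both sides of the index where \<open>a ^ k\<close>
  passes \<open>x\<close>. On each side the exponents are counted from the index nearest to that
  crossing, so they are distinct and the sum is dominated by a full geometric series.\<close>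

lemma sum_psi_geometric_le:
  fixes a s x :: real and K :: "nat set"
  assumes a: "0 < a" "a < 1" and s: "0 < s" and x: "0 < x" and K: "finite K"
  shows "(\<Sum>k\<in>K. psi (x / a ^ k) powr s) \<le> 2 / (1 - a powr s)"
proof -
  define b where "b = a powr s"
  have b: "0 \<le> b" "b < 1"
    using a s powr_less_mono2[of s a 1] by (auto simp: b_def)
  have pw: "(a ^ m) powr s = b ^ m" for m
    using a by (simp add: b_def powr_powr powr_realpow[symmetric] mult.commute)
  define K1 where "K1 = {k \<in> K. x \<le> a ^ k}"
  define K2 where "K2 = {k \<in> K. a ^ k < x}"
  have fin: "finite K1" "finite K2" using K by (auto simp: K1_def K2_def)
  have "(\<Sum>k\<in>K1. psi (x / a ^ k) powr s) \<le> (\<Sum>k\<in>K1. b ^ (Max K1 - k))"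
  proof (rule sum_mono)
    fix k assume k: "k \<in> K1"
    then have m: "Max K1 \<in> K1" "k \<le> Max K1" using fin by (auto intro: Max_in)
    have "psi (x / a ^ k) \<le> x / a ^ k" by (simp add: psi_def)
    also have "\<dots> \<le> a ^ Max K1 / a ^ k"
      using m a by (intro divide_right_mono) (auto simp: K1_def)
    also have "\<dots> = a ^ (Max K1 - k)" using a m by (simp add: power_diff)
    finally show "psi (x / a ^ k) powr s \<le> b ^ (Max K1 - k)"
      using pw s x a psi_pos[of "x / a ^ k"] by (metis powr_mono2 less_imp_le divide_pos_pos zero_less_power)
  qed
  also have "\<dots> \<le> 1 / (1 - b)"
  proof (intro sum_power_inj_le inj_onI b fin)
    fix x y assume "x \<in> K1" "y \<in> K1" "Max K1 - x = Max K1 - y"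
    with Max_ge[OF fin(1)] show "x = y" by (metis diff_diff_cancel)
  qed
  finally have 1: "(\<Sum>k\<in>K1. psi (x / a ^ k) powr s) \<le> 1 / (1 - b)" .
  have "(\<Sum>k\<in>K2. psi (x / a ^ k) powr s) \<le> (\<Sum>k\<in>K2. b ^ (k - Min K2))"
  proof (rule sum_mono)
    fix k assume k: "k \<in> K2"
    then have m: "Min K2 \<in> K2" "Min K2 \<le> k" using fin by (auto intro: Min_in)
    have "psi (x / a ^ k) \<le> a ^ k / x" by (simp add: psi_def)
    also have "\<dots> \<le> a ^ k / a ^ Min K2"
      using m a x by (intro divide_left_mono) (auto simp: K2_def)
    also have "\<dots> = a ^ (k - Min K2)" using a m by (simp add: power_diff)
    finally show "psi (x / a ^ k) powr s \<le> b ^ (k - Min K2)"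
      using pw s x a psi_pos[of "x / a ^ k"] by (metis powr_mono2 less_imp_le divide_pos_pos zero_less_power)
  qed
  also have "\<dots> \<le> 1 / (1 - b)"
    using b fin by (intro sum_power_inj_le inj_onI) (auto simp: eq_diff_iff)
  finally have 2: "(\<Sum>k\<in>K2. psi (x / a ^ k) powr s) \<le> 1 / (1 - b)" .
  have "K = K1 \<union> K2" "K1 \<inter> K2 = {}" by (auto simp: K1_def K2_def)
  then have "(\<Sum>k\<in>K. psi (x / a ^ k) powr s)
      = (\<Sum>k\<in>K1. psi (x / a ^ k) powr s) + (\<Sum>k\<in>K2. psi (x / a ^ k) powr s)"
    using fin by (simp add: sum.union_disjoint)
  also have "\<dots> \<le> 2 / (1 - b)" using 1 2 by simp
  finally show ?thesis by (simp add: b_def)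
qed

section \<open>Integrals against dt/t\<close>

lemma nn_integral_powr_from_0:
  assumes "0 < g" "0 \<le> T"
  shows "(\<integral>\<^sup>+ t. indicator {0..T} t * ennreal (t powr (g - 1)) \<partial>lborel) = ennreal (T powr g / g)"
proof -
  have "((\<lambda>t. t powr (g - 1)) has_integral (T powr g / g)) {0..T}"
    using has_integral_powr_from_0[of "g - 1" T] assms by simp
  from nn_integral_has_integral_lebesgue[OF _ this] show ?thesis
    by (simp add: ennreal_mult[symmetric] ennreal_indicator[symmetric])
qed

lemma nn_integral_powr_to_inf:
  assumes "0 < g" "0 < T"
  shows "(\<integral>\<^sup>+ t. indicator {T..} t * ennreal (t powr (- g - 1)) \<partial>lborel) = ennreal (T powr - g / g)"
proof -
  have "((\<lambda>t. t powr (- g - 1)) has_integral (T powr - g / g)) {T..}"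
    using has_integral_powr_to_inf[of "- g - 1" T] assms by simp
  from nn_integral_has_integral_lebesgue[OF _ this] show ?thesis
    by (simp add: ennreal_mult[symmetric] ennreal_indicator[symmetric])
qed

lemma nn_integral_psi_le:
  assumes r: "0 < r" and g: "0 < g"
  shows "(\<integral>\<^sup>+ t. indicator {0<..} t * ennreal (psi (t / r) powr g) / ennreal t \<partial>lborel) \<le> ennreal (2 / g)"
proof -
  have pt: "indicator {0<..} t * ennreal (psi (t / r) powr g) / ennreal t
      \<le> ennreal (r powr - g) * (indicator {0..r} t * ennreal (t powr (g - 1)))
        + ennreal (r powr g) * (indicator {r..} t * ennreal (t powr (- g - 1)))" for t :: real
  proof (cases "0 < t")
    case True
    have p: "0 < psi (t / r)" using True r by (simp add: psi_pos)
    have "psi (t / r) powr g / t \<le> r powr - g * t powr (g - 1)"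
    proof -
      have "psi (t / r) powr g \<le> (t / r) powr g"
        using p g by (intro powr_mono2) (auto simp: psi_def)
      then have "psi (t / r) powr g / t \<le> (t / r) powr g / t"
        using True by (simp add: divide_right_mono)
      also have "\<dots> = r powr - g * t powr (g - 1)"
        using True r by (simp add: powr_divide powr_diff powr_minus field_simps)
      finally show ?thesis .
    qed
    moreover have "psi (t / r) powr g / t \<le> r powr g * t powr (- g - 1)"
    proof -
      have "psi (t / r) powr g \<le> (r / t) powr g"
        using p g by (intro powr_mono2) (auto simp: psi_def)
      then have "psi (t / r) powr g / t \<le> (r / t) powr g / t"
        using True by (simp add: divide_right_mono)
      also have "\<dots> = r powr g * t powr (- g - 1)"
        using True r by (simp add: powr_divide powr_diff powr_minus field_simps)
      finally show ?thesis .
    qed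
    ultimately show ?thesis using True
      by (cases "t \<le> r")
         (auto simp: indicator_def divide_ennreal ennreal_mult[symmetric] ennreal_plus[symmetric]
               simp del: ennreal_plus intro!: ennreal_leI add_increasing2)
  qed simp
  have "(\<integral>\<^sup>+ t. indicator {0<..} t * ennreal (psi (t / r) powr g) / ennreal t \<partial>lborel)
      \<le> (\<integral>\<^sup>+ t. ennreal (r powr - g) * (indicator {0..r} t * ennreal (t powr (g - 1)))
        + ennreal (r powr g) * (indicator {r..} t * ennreal (t powr (- g - 1))) \<partial>lborel)"
    by (intro nn_integral_mono pt)
  also have "\<dots> = ennreal (r powr - g) * ennreal (r powr g / g) + ennreal (r powr g) * ennreal (r powr - g / g)"
    using r g by (simp add: nn_integral_add nn_integral_cmult nn_integral_powr_from_0 nn_integral_powr_to_inf)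
  also have "\<dots> = ennreal (2 / g)"
    using r g by (simp add: ennreal_mult[symmetric] ennreal_plus[symmetric] powr_minus field_simps del: ennreal_plus)
  finally show ?thesis .
qed

text \<open>Chebyshev gives m(t) * t^p <= E * t^(p-2). Since p > 2, its power q/p is integrable
  against dt/t near 0, and level sets above height 2 are empty. A uniformly bounded function that is
  small in L2 is thus small in the Lorentz sense.\<close>

lemma lorentz_norm_pow_bounded_L2:
  fixes f :: "'a::euclidean_space \<Rightarrow> complex"
  assumes p: "2 < p" and q: "0 < q"
    and [measurable]: "f \<in> borel_measurable lebesgue"
    and bd: "\<And>x. cmod (f x) \<le> 2"
    and E: "0 \<le> E" "(\<integral>\<^sup>+ x. ennreal ((cmod (f x))\<^sup>2) \<partial>lebesgue) \<le> ennreal E"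
  shows "lorentz_norm_pow p q f
    \<le> ennreal (q * (2 powr ((p - 2) * q / p) / ((p - 2) * q / p)) * E powr (q / p))"
proof -
  define g where "g = (p - 2) * q / p"
  have g: "0 < g" using p q by (simp add: g_def)
  have set: "{x. t \<le> cmod (f x)} \<in> sets lebesgue" for t
    using measurable_sets[of "\<lambda>x. cmod (f x)" lebesgue borel "{t..}"] by (auto simp: vimage_def)
  have m: "distrib_fun f t * ennreal (t powr p) \<le> ennreal (E * t powr (p - 2))" if t: "0 < t" for t
  proof -
    have "ennreal (t\<^sup>2) * distrib_fun f t = (\<integral>\<^sup>+ x. ennreal (t\<^sup>2) * indicator {x. t \<le> cmod (f x)} x \<partial>lebesgue)"
      using set by (simp add: distrib_fun_def nn_integral_cmult_indicator)
    also have "\<dots> \<le> (\<integral>\<^sup>+ x. ennreal ((cmod (f x))\<^sup>2) \<partial>lebesgue)"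
      using t by (intro nn_integral_mono) (auto simp: indicator_def intro!: ennreal_leI power_mono)
    also note E(2)
    finally have "ennreal (t powr (p - 2)) * (ennreal (t\<^sup>2) * distrib_fun f t)
        \<le> ennreal (t powr (p - 2)) * ennreal E"
      by (rule mult_left_mono) simp
    moreover have "ennreal (t powr (p - 2)) * (ennreal (t\<^sup>2) * X) = X * ennreal (t powr p)" for X
    proof -
      have "t powr p = t powr (p - 2) * t\<^sup>2"
        using t powr_add[of t "p - 2" 2] by simp
      then show ?thesis by (simp add: ennreal_mult mult_ac)
    qed
    ultimately show ?thesis using E(1) by (simp add: ennreal_mult[symmetric] mult.commute)
  qed
  have pt: "indicator {0<..} t * enn_powr (distrib_fun f t * ennreal (t powr p)) (q / p) / ennreal t
     \<le> ennreal (E powr (q / p)) * (indicator {0..2} t * ennreal (t powr (g - 1)))" for t :: real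
  proof -
    consider "t \<le> 0" | "0 < t" "t \<le> 2" | "2 < t" by linarith
    then show ?thesis
    proof cases
      case 2
      have "enn_powr (distrib_fun f t * ennreal (t powr p)) (q / p) \<le> enn_powr (ennreal (E * t powr (p - 2))) (q / p)"
        using p q by (intro enn_powr_mono m 2) simp
      also have "\<dots> = ennreal (E powr (q / p) * t powr g)"
        using E(1) 2 by (simp add: enn_powr_ennreal powr_mult powr_powr g_def)
      finally have "enn_powr (distrib_fun f t * ennreal (t powr p)) (q / p) / ennreal t
          \<le> ennreal (E powr (q / p) * t powr g) / ennreal t"
        by (rule divide_right_mono_ennreal)
      also have "\<dots> = ennreal (E powr (q / p) * t powr (g - 1))"
        using 2 by (simp add: divide_ennreal powr_diff)
      finally show ?thesis using 2 by (simp add: ennreal_mult)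
    next
      case 3
      then have "{x. t \<le> cmod (f x)} = {}"
        using bd by (auto simp: not_le intro: order.strict_trans1)
      then show ?thesis by (simp add: distrib_fun_def)
    qed simp
  qed
  have "lorentz_norm_pow p q f \<le> ennreal q *
      (\<integral>\<^sup>+ t. ennreal (E powr (q / p)) * (indicator {0..2} t * ennreal (t powr (g - 1))) \<partial>lborel)"
    unfolding lorentz_norm_pow_def by (intro mult_left_mono nn_integral_mono pt) simp
  also have "\<dots> = ennreal (q * (2 powr g / g) * E powr (q / p))"
    using g q by (simp add: nn_integral_cmult nn_integral_powr_from_0)
       (simp add: ennreal_mult[symmetric] mult_ac)
  finally show ?thesis by (simp add: g_def)
qed

text \<open>Half of the exponent \<open>e\<close> is summed and absorbed into \<open>S\<close>, the
  other half is estimated by its maximum. The power \<open>b\<close> then falls on a single term, so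
  it passes inside the sum for every positive \<open>b\<close>.\<close>

lemma sum_powr_le_sum:
  fixes x :: "'i \<Rightarrow> real"
  assumes K: "finite K" and x: "\<And>k. k \<in> K \<Longrightarrow> 0 < x k"
    and S: "(\<Sum>k\<in>K. x k powr (e / 2)) \<le> S" and b: "0 < b"
  shows "(\<Sum>k\<in>K. x k powr e) powr b \<le> S powr b * (\<Sum>k\<in>K. x k powr (e * b / 2))"
proof (cases "K = {}")
  case False
  define M where "M = Max ((\<lambda>k. x k powr (e / 2)) ` K)"
  have "M \<in> (\<lambda>k. x k powr (e / 2)) ` K"
    unfolding M_def using K False by (intro Max_in) auto
  then obtain k0 where k0: "k0 \<in> K" "M = x k0 powr (e / 2)" by auto
  have le: "x k powr (e / 2) \<le> M" if "k \<in> K" for k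
    unfolding M_def using K that by (intro Max_ge) auto
  have "(\<Sum>k\<in>K. x k powr e) = (\<Sum>k\<in>K. x k powr (e / 2) * x k powr (e / 2))"
    by (simp add: powr_add[symmetric])
  also have "\<dots> \<le> (\<Sum>k\<in>K. x k powr (e / 2) * M)"
    by (intro sum_mono mult_left_mono le) auto
  also have "\<dots> \<le> S * M"
    using S k0 by (simp add: sum_distrib_right[symmetric] mult_right_mono)
  finally have "(\<Sum>k\<in>K. x k powr e) powr b \<le> (S * M) powr b"
    using b by (intro powr_mono2) (auto intro: sum_nonneg)
  also have "\<dots> = S powr b * x k0 powr (e * b / 2)"
  proof -
    have "0 \<le> S" using S by (meson order_trans sum_nonneg powr_ge_zero)
    then show ?thesis by (simp add: k0 powr_mult powr_powr)
  qed
  also have "\<dots> \<le> S powr b * (\<Sum>k\<in>K. x k powr (e * b / 2))"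
    using k0 K by (intro mult_left_mono member_le_sum) auto
  finally show ?thesis .
qed simp

text \<open>Here \<open>u\<close> is the height relative to its typical value and \<open>l\<close>
  the share of the threshold. For u <= 1 exponent 2 leaves u^(p-2-2s), for u > 1 exponent 2p leaves
  u^(-p+2ps). The two bounds in \<open>s\<close> ensure that the shared threshold costs little
  enough for the decay \<open>psi u powr ((p - 2) / 2)\<close> to remain on both sides.\<close>

lemma powr_mult_tail_le_psi:
  fixes u k s :: real
  assumes u: "0 < u" and p: "2 < p" and k: "0 < k" "k \<le> 1"
    and s: "s = min ((p - 2) / 4) (1 / 4)"
  defines "l \<equiv> k * u * psi u powr s"
  shows "u powr p * min (l powr - 2) (l powr - (2 * p)) \<le> k powr - (2 * p) * psi u powr ((p - 2) / 2)"
proof (cases "u \<le> 1")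
  case True
  then have psi: "psi u = u" using u by (auto simp: psi_def min_def field_simps mult_le_one)
  have "l = k * u powr (1 + s)" using u by (simp add: l_def psi powr_add)
  then have "l powr - 2 = k powr - 2 * u powr (- 2 * (1 + s))"
    using k u by (simp add: powr_mult powr_powr mult.commute)
  then have "u powr p * l powr - 2 = k powr - 2 * u powr (p - 2 - 2 * s)"
    using u by (simp add: powr_add[symmetric] algebra_simps)
  also have "\<dots> \<le> k powr - (2 * p) * u powr ((p - 2) / 2)"
  proof -
    have "s \<le> (p - 2) / 4" unfolding s by (rule min.cobounded1)
    then have "(p - 2) / 2 \<le> p - 2 - 2 * s" by (simp add: field_simps)
    then show ?thesis using u True k p by (intro mult_mono powr_mono') auto
  qed
  finally have "u powr p * l powr - 2 \<le> k powr - (2 * p) * psi u powr ((p - 2) / 2)" by (simp add: psi)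
  moreover have "u powr p * min (l powr - 2) (l powr - (2 * p)) \<le> u powr p * l powr - 2"
    by (intro mult_left_mono) auto
  ultimately show ?thesis by linarith
next
  case False
  then have psi: "psi u = u powr - 1"
    using u less_1_mult[of u u] by (auto simp: psi_def min_def field_simps powr_minus)
  have "l = k * u powr (1 - s)" using u powr_add[of u 1 "- s"] by (simp only: l_def psi powr_powr) simp
  then have "l powr - (2 * p) = k powr - (2 * p) * u powr (- (2 * p) * (1 - s))"
    using k u by (simp add: powr_mult powr_powr mult.commute)
  then have "u powr p * l powr - (2 * p) = k powr - (2 * p) * u powr (- p + 2 * p * s)"
    using u by (simp add: powr_add[symmetric] algebra_simps)
  also have "\<dots> \<le> k powr - (2 * p) * u powr (- ((p - 2) / 2))"
  proof -
    have "2 * p * s \<le> 2 * p * (1 / 4)" using p s by (intro mult_left_mono) auto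
    then have "- p + 2 * p * s \<le> - ((p - 2) / 2)" by (simp add: field_simps)
    then show ?thesis using False by (intro mult_left_mono powr_mono) auto
  qed
  also have "u powr - ((p - 2) / 2) = psi u powr ((p - 2) / 2)"
    by (simp only: psi powr_powr mult_minus_left mult_1_left)
  finally have "u powr p * l powr - (2 * p) \<le> k powr - (2 * p) * psi u powr ((p - 2) / 2)" .
  moreover have "u powr p * min (l powr - 2) (l powr - (2 * p)) \<le> u powr p * l powr - (2 * p)"
    by (intro mult_left_mono) auto
  ultimately show ?thesis by linarith
qed

text \<open>The threshold \<open>t\<close> is shared among the scales in proportion to a small power of \<open>psi (t / T k)\<close>, where
  \<open>T k\<close> is the typical height at scale \<open>k\<close>; Chebyshev's inequality with exponent \<open>2\<close> for \<open>t \<le> T k\<close> and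
  \<open>2 * p\<close> for \<open>t > T k\<close> then makes the contributions decay geometrically away from the scale with
  \<open>T k\<close> close to \<open>t\<close>.\<close>
lemma lorentz_norm_pow_multiscale:
  fixes p q C0 :: real
  assumes p: "2 < p" and q: "0 < q" and C0: "0 < C0"
  shows "\<exists>C>0. \<forall>(c::real) (K::nat set) (h :: nat \<Rightarrow> 'a::euclidean_space \<Rightarrow> real) (f :: 'a \<Rightarrow> complex).
      0 < c \<longrightarrow> finite K \<longrightarrow> K \<noteq> {} \<longrightarrow> (\<forall>k\<in>K. h k \<in> borel_measurable lebesgue) \<longrightarrow>
      (\<forall>k\<in>K. \<forall>l>0. \<forall>r\<in>{2, 2 * p}.
          emeasure lebesgue {x. l \<le> h k x} \<le> ennreal (C0 * 2 ^ (k * DIM('a)) * l powr - r)) \<longrightarrow>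
      (\<forall>x. cmod (f x) \<le> (\<Sum>k\<in>K. c * (2 powr - (DIM('a) / p)) ^ k * h k x)) \<longrightarrow>
      lorentz_norm_pow p q f \<le> ennreal (C * real (card K) * c powr q)"
proof -
  define d where "d = DIM('a)"
  define a where "a = 2 powr - (d / p)"
  have d: "0 < d" by (simp add: d_def)
  have a: "0 < a" "a < 1"
    using p d powr_less_one[of 2 "- (d / p)"] by (auto simp: a_def)
  define s where "s = min ((p - 2) / 4) (1 / 4)"
  have s: "0 < s" using p by (simp add: s_def)
  \<comment> \<open>Normalises the shares: summed over all scales,
    \<open>kp * psi (t / T k) powr s\<close> is at most 1.\<close>
  define kp where "kp = (1 - a powr s) / 2"
  have "a powr s < 1" using a s powr_less_mono2[of s a 1] by auto
  then have kp: "0 < kp" "kp \<le> 1" using powr_ge_zero[of a s] by (auto simp: kp_def simp del: powr_ge_zero)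
  define e where "e = (p - 2) / 2"
  have e: "0 < e" using p by (simp add: e_def)
  define b where "b = q / p"
  have b: "0 < b" using p q by (simp add: b_def)
  define S where "S = 2 / (1 - a powr (e / 2))"
  have "a powr (e / 2) < 1" using a e powr_less_mono2[of "e / 2" a 1] by auto
  then have S: "0 < S" by (auto simp: S_def)
  define C1 where "C1 = C0 * kp powr - (2 * p)"
  have C1: "0 < C1" using C0 kp by (simp add: C1_def)
  define C where "C = q * (C1 powr b * S powr b * (2 / (e * b / 2)))"
  have C: "0 < C" using q C1 S e b by (auto simp: C_def)
  have main: "lorentz_norm_pow p q f \<le> ennreal (C * real (card K) * c powr q)"
    if c: "0 < c" and K: "finite K" "K \<noteq> {}" and hm: "\<And>k. k \<in> K \<Longrightarrow> h k \<in> borel_measurable lebesgue"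
      and he: "\<And>k l r. k \<in> K \<Longrightarrow> 0 < l \<Longrightarrow> r = 2 \<or> r = 2 * p \<Longrightarrow>
          emeasure lebesgue {x. l \<le> h k x} \<le> ennreal (C0 * 2 ^ (k * DIM('a)) * l powr - r)"
      and f: "\<And>x. cmod (f x) \<le> (\<Sum>k\<in>K. c * (2 powr - (DIM('a) / p)) ^ k * h k x)"
    for c and K :: "nat set" and h :: "nat \<Rightarrow> 'a \<Rightarrow> real" and f :: "'a \<Rightarrow> complex"
  proof -
    define T where "T k = c * a ^ k" for k
    have T: "0 < T k" for k using c a by (simp add: T_def)
    define u where "u t k = t / T k" for t k
    have u: "0 < u t k" if "0 < t" for t k using that T by (simp add: u_def)
    define l where "l t k = kp * u t k * psi (u t k) powr s" for t k
    have l: "0 < l t k" if "0 < t" for t k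
      using kp u[OF that, of k] psi_pos[OF u[OF that], of k] by (simp add: l_def)
    have set: "{x. t \<le> h k x} \<in> sets lebesgue" if "k \<in> K" for t k
      using measurable_sets[OF hm[OF that], of "{t..}"] by (auto simp: vimage_def)
    \<comment> \<open>Pigeonhole: if every scale stayed strictly below its share, the weighted sum
      would stay strictly below \<open>t\<close>.\<close>
    have sub: "{x. t \<le> cmod (f x)} \<subseteq> (\<Union>k\<in>K. {x. l t k \<le> h k x})" if t: "0 < t" for t
    proof (rule ccontr)
      assume "\<not> ?thesis"
      then obtain x where x: "t \<le> cmod (f x)" and "x \<notin> (\<Union>k\<in>K. {x. l t k \<le> h k x})" by blast
      then have x2: "h k x < l t k" if "k \<in> K" for k using that by (auto simp: not_le)
      have "t \<le> (\<Sum>k\<in>K. T k * h k x)"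
        using x f[of x] by (simp add: T_def a_def d_def)
      also have "\<dots> < (\<Sum>k\<in>K. T k * l t k)"
        using K x2 T by (intro sum_strict_mono) auto
      also have "\<dots> = kp * t * (\<Sum>k\<in>K. psi ((t / c) / a ^ k) powr s)"
        using T less_imp_neq[OF T] by (simp add: l_def u_def sum_distrib_left T_def)
      also have "\<dots> \<le> kp * t * (2 / (1 - a powr s))"
        using kp t c a s K by (intro mult_left_mono sum_psi_geometric_le) auto
      also have "\<dots> = t" using \<open>a powr s < 1\<close> by (simp add: kp_def)
      finally show False by simp
    qed
    have m1: "emeasure lebesgue {x. l t k \<le> h k x} * ennreal (t powr p)
        \<le> ennreal (C1 * c powr p * psi (u t k) powr e)" if t: "0 < t" and k: "k \<in> K" for t k
    proof -
      have "emeasure lebesgue {x. l t k \<le> h k x}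
          \<le> ennreal (C0 * 2 ^ (k * d) * min (l t k powr - 2) (l t k powr - (2 * p)))"
        using he[OF k l[OF t], of 2] he[OF k l[OF t], of "2 * p"] by (auto simp: min_def d_def)
      then have "emeasure lebesgue {x. l t k \<le> h k x} * ennreal (t powr p)
          \<le> ennreal (C0 * 2 ^ (k * d) * min (l t k powr - 2) (l t k powr - (2 * p))) * ennreal (t powr p)"
        by (rule mult_right_mono) simp
      also have "\<dots> = ennreal (C0 * 2 ^ (k * d) * min (l t k powr - 2) (l t k powr - (2 * p)) * t powr p)"
        by (rule ennreal_mult''[symmetric]) simp
      \<comment> \<open>The volume 2^(k*d) and the p-th power of the height c * 2^(-k*d/p) cancel
        exactly, so no scale is favoured.\<close>
      also have "C0 * 2 ^ (k * d) * min (l t k powr - 2) (l t k powr - (2 * p)) * t powr p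
          = C0 * c powr p * (u t k powr p * min (l t k powr - 2) (l t k powr - (2 * p)))"
      proof -
        have "a ^ k = 2 powr (- (d / p) * k)" using a by (simp add: a_def powr_powr powr_realpow[symmetric])
        then have "(a ^ k) powr p = 2 powr (- real (k * d))"
          using p by (simp add: powr_powr mult.commute)
        also have "\<dots> = inverse (2 ^ (k * d))" by (simp only: powr_minus powr_realpow zero_less_numeral)
        finally have "2 ^ (k * d) * (T k powr p) = c powr p"
          using c a by (simp add: T_def powr_mult)
        moreover have "t powr p = u t k powr p * T k powr p"
          using t T[of k] by (simp add: u_def powr_divide)
        ultimately show ?thesis by simp
      qed
      also have "ennreal \<dots> \<le> ennreal (C1 * c powr p * psi (u t k) powr e)"
        using powr_mult_tail_le_psi[OF u[OF t] p kp s_def, of k] C0 c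
        by (intro ennreal_leI) (auto simp: C1_def e_def l_def mult_ac intro!: mult_left_mono)
      finally show ?thesis .
    qed
    have pt: "indicator {0<..} t * enn_powr (distrib_fun f t * ennreal (t powr p)) (q / p) / ennreal t
      \<le> ennreal (C1 powr b * c powr q * S powr b) * (\<Sum>k\<in>K. indicator {0<..} t *
          ennreal (psi (t / T k) powr (e * b / 2)) / ennreal t)" for t :: real
    proof (cases "0 < t")
      case t: True
      have "distrib_fun f t \<le> emeasure lebesgue (\<Union>k\<in>K. {x. l t k \<le> h k x})"
        unfolding distrib_fun_def using sub[OF t] set K by (intro emeasure_mono) auto
      also have "\<dots> \<le> (\<Sum>k\<in>K. emeasure lebesgue {x. l t k \<le> h k x})"
        using K set by (intro emeasure_subadditive_finite) auto
      finally have "distrib_fun f t * ennreal (t powr p)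
          \<le> (\<Sum>k\<in>K. emeasure lebesgue {x. l t k \<le> h k x}) * ennreal (t powr p)"
        by (rule mult_right_mono) simp
      also have "\<dots> = (\<Sum>k\<in>K. emeasure lebesgue {x. l t k \<le> h k x} * ennreal (t powr p))"
        by (rule sum_distrib_right)
      also have "\<dots> \<le> (\<Sum>k\<in>K. ennreal (C1 * c powr p * psi (u t k) powr e))"
        by (intro sum_mono m1 t)
      also have "\<dots> = ennreal (C1 * c powr p * (\<Sum>k\<in>K. psi (u t k) powr e))"
        using C1 by (subst sum_ennreal) (auto simp: sum_distrib_left)
      finally have "enn_powr (distrib_fun f t * ennreal (t powr p)) b
          \<le> enn_powr (ennreal (C1 * c powr p * (\<Sum>k\<in>K. psi (u t k) powr e))) b"
        using b by (intro enn_powr_mono) auto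
      also have "\<dots> = ennreal (C1 powr b * c powr q * (\<Sum>k\<in>K. psi (u t k) powr e) powr b)"
        using C1 c p by (subst enn_powr_ennreal)
          (auto simp: sum_nonneg powr_mult powr_powr b_def)
      \<comment> \<open>Half of the decay exponent pays for moving the power \<open>b\<close> inside
        the sum. The other half still makes each term integrable against dt/t.\<close>
      also have "\<dots> \<le> ennreal (C1 powr b * c powr q * (S powr b * (\<Sum>k\<in>K. psi (u t k) powr (e * b / 2))))"
      proof (intro ennreal_leI mult_left_mono sum_powr_le_sum K b)
        show "0 < psi (u t k)" for k using psi_pos[OF u[OF t]] .
        show "(\<Sum>k\<in>K. psi (u t k) powr (e / 2)) \<le> S"
          using sum_psi_geometric_le[of a "e / 2" "t / c" K] a e t c K by (simp add: u_def T_def S_def)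
      qed auto
      finally have "enn_powr (distrib_fun f t * ennreal (t powr p)) b / ennreal t
          \<le> ennreal (C1 powr b * c powr q * (S powr b * (\<Sum>k\<in>K. psi (u t k) powr (e * b / 2)))) / ennreal t"
        by (rule divide_right_mono_ennreal)
      also have "\<dots> = ennreal (C1 powr b * c powr q * S powr b) * (\<Sum>k\<in>K. ennreal (psi (u t k) powr (e * b / 2)) / ennreal t)"
        using t by (subst (1 2) divide_ennreal)
          (auto simp: sum_nonneg ennreal_mult[symmetric] sum_divide_distrib mult_ac
             sum_distrib_left divide_ennreal)
      finally show ?thesis using t by (simp add: u_def b_def)
    qed simp
    have "lorentz_norm_pow p q f \<le> ennreal q * (\<integral>\<^sup>+ t. ennreal (C1 powr b * c powr q * S powr b) *
        (\<Sum>k\<in>K. indicator {0<..} t * ennreal (psi (t / T k) powr (e * b / 2)) / ennreal t) \<partial>lborel)"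
      unfolding lorentz_norm_pow_def by (intro mult_left_mono nn_integral_mono pt) simp
    also have "\<dots> = ennreal q * (ennreal (C1 powr b * c powr q * S powr b) *
        (\<Sum>k\<in>K. \<integral>\<^sup>+ t. indicator {0<..} t * ennreal (psi (t / T k) powr (e * b / 2)) / ennreal t \<partial>lborel))"
      by (subst nn_integral_cmult) (auto simp: nn_integral_sum)
    also have "\<dots> \<le> ennreal q * (ennreal (C1 powr b * c powr q * S powr b) * (\<Sum>k\<in>K. ennreal (2 / (e * b / 2))))"
      using e b T by (intro mult_left_mono sum_mono nn_integral_psi_le) auto
    also have "\<dots> = ennreal (C * real (card K) * c powr q)"
      using q e b C1 S by (simp add: sum_ennreal ennreal_of_nat_eq_real_of_nat ennreal_mult[symmetric] C_def mult_ac)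
    finally show ?thesis .
  qed
  show ?thesis by (intro exI[of _ C] conjI C allI impI main) auto
qed

section \<open>Derandomised sampling\<close>

lemma measurable_cis [measurable]: "cis \<in> borel_measurable borel"
  by (intro borel_measurable_continuous_onI continuous_intros)

lemma measurable_fourier_measure [measurable]:
  fixes M :: "'a::euclidean_space measure"
  assumes M: "sets M = sets borel" and "prob_space M"
  shows "fourier_measure M \<in> borel_measurable borel"
proof -
  interpret prob_space M by fact
  note M [measurable_cong]
  show ?thesis
    unfolding fourier_measure_def[abs_def] by measurable
qed

lemma integrable_cis_inner:
  fixes M :: "'a::euclidean_space measure"
  assumes M: "sets M = sets borel" and "prob_space M"
  shows "integrable M (\<lambda>x. cis (- 2 * pi * (x \<bullet> y)))"
proof -
  interpret prob_space M by fact
  note M [measurable_cong]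
  show ?thesis by (rule integrable_const_bound[where B=1]) auto
qed

lemma norm_fourier_measure_le:
  fixes M :: "'a::euclidean_space measure"
  assumes "sets M = sets borel" and "prob_space M"
  shows "cmod (fourier_measure M y) \<le> 1"
proof -
  interpret prob_space M by fact
  have "cmod (fourier_measure M y) \<le> (\<integral>x. cmod (cis (- 2 * pi * (x \<bullet> y))) \<partial>M)"
    unfolding fourier_measure_def by (rule integral_norm_bound)
  then show ?thesis by (simp add: prob_space)
qed

section \<open>Exponential moments of one sampling step\<close>

lemma exp_le_quadratic:
  fixes y :: real
  assumes "\<bar>y\<bar> \<le> 1"
  shows "exp y \<le> 1 + y + y\<^sup>2"
proof (cases "0 \<le> y")
  case True
  then show ?thesis using assms exp_bound[of y] by simp
next
  case False
  define a where "a = - y"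
  have a: "0 < a" using False by (simp add: a_def)
  have "exp y = 1 / exp a" by (simp add: a_def exp_minus field_simps)
  also have "\<dots> \<le> 1 / (1 + a)"
    using a exp_ge_add_one_self[of a] by (intro divide_left_mono) auto
  also have "\<dots> \<le> 1 - a + a\<^sup>2"
  proof -
    have "1 \<le> (1 - a + a\<^sup>2) * (1 + a)"
      using a by (simp add: algebra_simps power2_eq_square)
    then show ?thesis using a by (simp add: field_simps)
  qed
  finally show ?thesis by (simp add: a_def)
qed

text \<open>The linear term of the expansion has mean zero, so only the quadratic term, at most B^2,
  survives.\<close>

lemma (in prob_space) nn_integral_exp_centered_le:
  assumes [measurable]: "X \<in> borel_measurable M"
    and X: "\<And>x. \<bar>X x\<bar> \<le> B" "B \<le> 1" and mean: "expectation X = 0"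
  shows "(\<integral>\<^sup>+ x. ennreal (exp (X x)) \<partial>M) \<le> ennreal (1 + B\<^sup>2)"
proof -
  have iX: "integrable M X" using X by (intro integrable_const_bound[where B=B]) auto
  have "(\<integral>\<^sup>+ x. ennreal (exp (X x)) \<partial>M) \<le> (\<integral>\<^sup>+ x. ennreal (1 + X x + B\<^sup>2) \<partial>M)"
  proof (intro nn_integral_mono ennreal_leI)
    fix x
    have "exp (X x) \<le> 1 + X x + (X x)\<^sup>2"
      using X(1)[of x] X(2) by (intro exp_le_quadratic) simp
    also have "(X x)\<^sup>2 \<le> B\<^sup>2" using X(1)[of x] by (simp add: abs_le_square_iff[symmetric])
    finally show "exp (X x) \<le> 1 + X x + B\<^sup>2" by simp
  qed
  also have "\<dots> = ennreal (\<integral>x. 1 + X x + B\<^sup>2 \<partial>M)"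
  proof (intro nn_integral_eq_integral AE_I2)
    fix x have "- 1 \<le> X x" using X(1)[of x] X(2) by linarith
    then show "0 \<le> 1 + X x + B\<^sup>2" by (simp add: add_nonneg_nonneg)
  qed (use iX in auto)
  also have "(\<integral>x. 1 + X x + B\<^sup>2 \<partial>M) = 1 + B\<^sup>2"
    using iX mean by (simp add: prob_space)
  finally show ?thesis .
qed

text \<open>A potential for the method of conditional expectations: averaging one sampling step of size \<open>l\<close>
  multiplies it by at most \<open>1 + 4 * l^2\<close>, so the sample points can be chosen one at a time.\<close>
definition cexp_pot :: "complex \<Rightarrow> real" where
  "cexp_pot z = (\<Sum>u\<in>{1, -1, \<i>, -\<i>}. exp (Re (u * z)))"

lemma measurable_cexp_pot [measurable]: "cexp_pot \<in> borel_measurable borel"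
  unfolding cexp_pot_def by measurable

lemma cexp_pot_nonneg: "0 \<le> cexp_pot z"
  unfolding cexp_pot_def by (intro sum_nonneg) auto

text \<open>One of the four exponentials is exp(m), where m is the larger of the absolute values of
  the real and imaginary parts. It dominates (m/r)^r, and the modulus is at most 2 * m. A single
  bound on the potential thus controls all moments, and one sample serves both Chebyshev exponents 2
  and 2 * p.\<close>

lemma norm_powr_le_cexp_pot:
  assumes r: "0 < r"
  shows "cmod z powr r \<le> (2 * r) powr r * cexp_pot z"
proof -
  define m where "m = max \<bar>Re z\<bar> \<bar>Im z\<bar>"
  have m: "0 \<le> m" by (simp add: m_def)
  have eq: "cexp_pot z = exp (Re z) + exp (- Re z) + exp (Im z) + exp (- Im z)"
    by (simp add: cexp_pot_def complex_eq_iff)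
  have "exp m \<le> cexp_pot z"
    unfolding eq m_def max_def abs_if by (auto intro: add_increasing add_increasing2)
  moreover have "(m / r) powr r \<le> exp (m / r) powr r"
    using m r exp_ge_add_one_self[of "m / r"]
    by (intro powr_mono2) (auto simp del: exp_ge_add_one_self)
  then have "(m / r) powr r \<le> exp m"
    using r by (simp add: powr_def)
  ultimately have "(m / r) powr r \<le> cexp_pot z" by simp
  then have "(2 * r) powr r * (m / r) powr r \<le> (2 * r) powr r * cexp_pot z"
    by (rule mult_left_mono) simp
  moreover have "cmod z powr r \<le> (2 * r * (m / r)) powr r"
    using r cmod_le[of z] by (intro powr_mono2) (auto simp: m_def)
  ultimately show ?thesis
    by (simp only: powr_mult[of "2 * r" "m / r"])
qed

text \<open>In each of the four directions the increment is centred and at most 2 * l in absolute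
  value, because a character and its mean have modulus at most 1. This is where 4 * l^2 comes from,
  and l <= 1/2 keeps the bound 2 * l within the range of the quadratic estimate.\<close>

lemma nn_integral_cexp_pot_step_le:
  fixes M :: "'a::euclidean_space measure"
  assumes M: "sets M = sets borel" and P: "prob_space M" and l: "0 \<le> l" "l \<le> 1 / 2"
  shows "(\<integral>\<^sup>+ x. ennreal (cexp_pot (z + of_real l * (cis (- 2 * pi * (x \<bullet> y)) - fourier_measure M y))) \<partial>M)
    \<le> ennreal ((1 + 4 * l\<^sup>2) * cexp_pot z)"
proof -
  interpret prob_space M by fact
  note M [measurable_cong]
  let ?Y = "\<lambda>x. cis (- 2 * pi * (x \<bullet> y)) - fourier_measure M y"
  have intY: "integrable M ?Y" using integrable_cis_inner[OF M P] by simp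
  have Y0: "(\<integral>x. ?Y x \<partial>M) = 0"
    using integrable_cis_inner[OF M P, of y] by (simp add: fourier_measure_def prob_space)
  have nY: "cmod (?Y x) \<le> 2" for x
    using norm_triangle_ineq4[of "cis (- 2 * pi * (x \<bullet> y))" "fourier_measure M y"]
      norm_fourier_measure_le[OF M P, of y] by simp
  have 1: "(\<integral>\<^sup>+ x. ennreal (exp (Re (u * (z + of_real l * ?Y x)))) \<partial>M) \<le> ennreal ((1 + 4 * l\<^sup>2) * exp (Re (u * z)))"
    if u: "cmod u = 1" for u
  proof -
    let ?X = "\<lambda>x. Re (u * of_real l * ?Y x)"
    have X: "\<bar>?X x\<bar> \<le> 2 * l" for x
    proof -
      have "\<bar>?X x\<bar> \<le> cmod (u * of_real l * ?Y x)" by (rule abs_Re_le_cmod)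
      also have "\<dots> = l * cmod (?Y x)" using u l by (simp add: norm_mult)
      also have "\<dots> \<le> l * 2" using l nY by (intro mult_left_mono) auto
      finally show ?thesis by simp
    qed
    have mean: "expectation ?X = 0"
    proof -
      have "(\<integral>x. u * of_real l * ?Y x \<partial>M) = 0" using intY Y0 by simp
      then show ?thesis using intY by (subst integral_Re) auto
    qed
    have "(\<integral>\<^sup>+ x. ennreal (exp (Re (u * (z + of_real l * ?Y x)))) \<partial>M)
        = (\<integral>\<^sup>+ x. ennreal (exp (Re (u * z))) * ennreal (exp (?X x)) \<partial>M)"
      by (intro nn_integral_cong) (simp add: ennreal_mult[symmetric] exp_add[symmetric] distrib_left mult.assoc)
    also have "\<dots> = ennreal (exp (Re (u * z))) * (\<integral>\<^sup>+ x. ennreal (exp (?X x)) \<partial>M)"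
      by (rule nn_integral_cmult) simp
    also have "\<dots> \<le> ennreal (exp (Re (u * z))) * ennreal (1 + (2 * l)\<^sup>2)"
      using X l mean by (intro mult_left_mono nn_integral_exp_centered_le) auto
    also have "\<dots> = ennreal ((1 + 4 * l\<^sup>2) * exp (Re (u * z)))"
      by (simp add: ennreal_mult[symmetric] power_mult_distrib mult.commute del: ennreal_plus)
    finally show ?thesis .
  qed
  have "(\<integral>\<^sup>+ x. ennreal (cexp_pot (z + of_real l * ?Y x)) \<partial>M)
      = (\<Sum>u\<in>{1, -1, \<i>, -\<i>}. \<integral>\<^sup>+ x. ennreal (exp (Re (u * (z + of_real l * ?Y x)))) \<partial>M)"
    unfolding cexp_pot_def by (subst nn_integral_sum[symmetric]) (auto simp: sum_ennreal)
  also have "\<dots> \<le> (\<Sum>u\<in>{1, -1, \<i>, -\<i>}. ennreal ((1 + 4 * l\<^sup>2) * exp (Re (u * z))))"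
    by (intro sum_mono 1) auto
  also have "\<dots> = ennreal ((1 + 4 * l\<^sup>2) * cexp_pot z)"
    unfolding cexp_pot_def sum_distrib_left by (rule sum_ennreal) auto
  finally show ?thesis .
qed

lemma (in prob_space) exists_le_nn_integral:
  assumes [measurable]: "f \<in> borel_measurable M" and K: "AE x in M. x \<in> K"
    and le: "(\<integral>\<^sup>+ x. f x \<partial>M) \<le> c"
  obtains x where "x \<in> K" "f x \<le> c"
proof (rule ccontr)
  assume "\<not> thesis"
  with that have *: "x \<in> K \<Longrightarrow> c < f x" for x by (metis not_le)
  have gt: "AE x in M. c < f x" using K * by auto
  have "c \<noteq> top"
  proof
    assume "c = top"
    then have "AE x in M. False" using gt by simp
    then show False by simp
  qed
  have "(\<integral>\<^sup>+ x. c \<partial>M) < (\<integral>\<^sup>+ x. f x \<partial>M)"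
  proof (rule nn_integral_less)
    show "(\<integral>\<^sup>+ x. c \<partial>M) \<noteq> \<infinity>" using \<open>c \<noteq> top\<close> by (simp add: emeasure_space_1)
    show "AE x in M. c \<le> f x" using gt by eventually_elim simp
    show "\<not> (AE x in M. f x \<le> c)"
    proof
      assume "AE x in M. f x \<le> c"
      with gt have "AE x in M. False" by eventually_elim simp
      then show False by simp
    qed
  qed auto
  then show False using le by (simp add: emeasure_space_1)
qed

text \<open>By Fubini, averaging the integrated potential over the next point multiplies it by at
  most 1 + 4 * l^2, so some admissible point does no worse than this average. The initial factor 4
  is the potential at 0.\<close>

lemma exists_sample_cexp_pot:
  fixes M :: "'a::euclidean_space measure" and w :: "'a \<Rightarrow> real"
  assumes M: "sets M = sets borel" and P: "prob_space M" and l: "0 \<le> l" "l \<le> 1 / 2"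
    and K: "AE x in M. x \<in> K" and w [measurable]: "w \<in> borel_measurable borel" "\<And>y. 0 \<le> w y"
  shows "\<exists>x::nat \<Rightarrow> 'a. (\<forall>i<m. x i \<in> K) \<and>
    (\<integral>\<^sup>+ y. ennreal (w y * cexp_pot (of_real l * (\<Sum>i<m. cis (- 2 * pi * (x i \<bullet> y)) - fourier_measure M y))) \<partial>lborel)
    \<le> ennreal (4 * (1 + 4 * l\<^sup>2) ^ m) * (\<integral>\<^sup>+ y. ennreal (w y) \<partial>lborel)"
proof (induction m)
  case 0
  have "cexp_pot 0 = 4" by (simp add: cexp_pot_def complex_eq_iff)
  then show ?case using w by (auto simp: nn_integral_cmult[symmetric] ennreal_mult' mult.commute)
next
  case (Suc m)
  interpret prob_space M by fact
  note M [measurable_cong]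
  note measurable_fourier_measure[OF M P, measurable]
  from Suc obtain x :: "nat \<Rightarrow> 'a" where x: "\<And>i. i < m \<Longrightarrow> x i \<in> K"
    and le: "(\<integral>\<^sup>+ y. ennreal (w y * cexp_pot (of_real l * (\<Sum>i<m. cis (- 2 * pi * (x i \<bullet> y)) - fourier_measure M y))) \<partial>lborel)
    \<le> ennreal (4 * (1 + 4 * l\<^sup>2) ^ m) * (\<integral>\<^sup>+ y. ennreal (w y) \<partial>lborel)" by blast
  define S where "S y = of_real l * (\<Sum>i<m. cis (- 2 * pi * (x i \<bullet> y)) - fourier_measure M y)" for y
  have [measurable]: "S \<in> borel_measurable borel" unfolding S_def by measurable
  define F where "F z y = ennreal (w y * cexp_pot (S y + of_real l * (cis (- 2 * pi * (z \<bullet> y)) - fourier_measure M y)))" for z y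
  have F [measurable]: "case_prod F \<in> borel_measurable (M \<Otimes>\<^sub>M lborel)" unfolding F_def by measurable
  interpret pair_sigma_finite M lborel by unfold_locales
  have "(\<integral>\<^sup>+ z. (\<integral>\<^sup>+ y. F z y \<partial>lborel) \<partial>M) = (\<integral>\<^sup>+ y. (\<integral>\<^sup>+ z. F z y \<partial>M) \<partial>lborel)"
    by (rule Fubini'[symmetric]) (rule F)
  also have "\<dots> \<le> (\<integral>\<^sup>+ y. ennreal (1 + 4 * l\<^sup>2) * ennreal (w y * cexp_pot (S y)) \<partial>lborel)"
  proof (rule nn_integral_mono)
    fix y
    have "(\<integral>\<^sup>+ z. F z y \<partial>M) = ennreal (w y) * (\<integral>\<^sup>+ z. ennreal (cexp_pot (S y + of_real l * (cis (- 2 * pi * (z \<bullet> y)) - fourier_measure M y))) \<partial>M)"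
      unfolding F_def using w(2) cexp_pot_nonneg by (simp add: ennreal_mult nn_integral_cmult)
    also have "\<dots> \<le> ennreal (w y) * ennreal ((1 + 4 * l\<^sup>2) * cexp_pot (S y))"
      by (intro mult_left_mono nn_integral_cexp_pot_step_le M P l) auto
    also have "\<dots> = ennreal (1 + 4 * l\<^sup>2) * ennreal (w y * cexp_pot (S y))"
      using w(2)[of y] cexp_pot_nonneg[of "S y"]
      by (simp add: ennreal_mult[symmetric] mult_ac del: ennreal_plus)
    finally show "(\<integral>\<^sup>+ z. F z y \<partial>M) \<le> \<dots>" .
  qed
  also have "\<dots> = ennreal (1 + 4 * l\<^sup>2) * (\<integral>\<^sup>+ y. ennreal (w y * cexp_pot (S y)) \<partial>lborel)"
    by (rule nn_integral_cmult) simp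
  also have "\<dots> \<le> ennreal (1 + 4 * l\<^sup>2) * (ennreal (4 * (1 + 4 * l\<^sup>2) ^ m) * (\<integral>\<^sup>+ y. ennreal (w y) \<partial>lborel))"
    using le by (intro mult_left_mono) (auto simp: S_def)
  also have "\<dots> = ennreal (4 * (1 + 4 * l\<^sup>2) ^ Suc m) * (\<integral>\<^sup>+ y. ennreal (w y) \<partial>lborel)"
    by (subst mult.assoc[symmetric], subst ennreal_mult[symmetric]) (auto simp: mult_ac)
  finally have "(\<integral>\<^sup>+ z. (\<integral>\<^sup>+ y. F z y \<partial>lborel) \<partial>M) \<le> \<dots>" .
  then obtain z where z: "z \<in> K"
    "(\<integral>\<^sup>+ y. F z y \<partial>lborel) \<le> ennreal (4 * (1 + 4 * l\<^sup>2) ^ Suc m) * (\<integral>\<^sup>+ y. ennreal (w y) \<partial>lborel)"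
    by (rule exists_le_nn_integral[OF _ K, rotated]) measurable
  have "of_real l * (\<Sum>i<Suc m. cis (- 2 * pi * ((x(m := z)) i \<bullet> y)) - fourier_measure M y)
      = S y + of_real l * (cis (- 2 * pi * (z \<bullet> y)) - fourier_measure M y)" for y
    by (simp add: S_def distrib_left)
  then show ?case using z x
    by (intro exI[of _ "x(m := z)"]) (auto simp: F_def less_Suc_eq)
qed


text \<open>The step size is N^(-1/2), which N >= 4 keeps at most 1/2. The N growth factors then
  multiply to at most exp 4, independently of N. The weight \<open>(cmod (g y))\<^sup>2\<close>
  confines the integral to the frequencies where the cutoff \<open>g\<close> is not negligible, and
  the same points work for all exponents and heights.\<close>

lemma exists_sample_tail:
  fixes M :: "'a::euclidean_space measure" and g :: "'a \<Rightarrow> complex"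
  assumes M: "sets M = sets borel" and P: "prob_space M" and K: "AE x in M. x \<in> K"
    and g [measurable]: "g \<in> borel_measurable borel" and g1: "\<And>y. cmod (g y) \<le> 1"
    and G: "0 \<le> G" "(\<integral>\<^sup>+ y. ennreal ((cmod (g y))\<^sup>2) \<partial>lborel) \<le> ennreal G" and N: "4 \<le> N"
  obtains x :: "nat \<Rightarrow> 'a" where "\<And>i. i < N \<Longrightarrow> x i \<in> K"
    "\<And>r l. 2 \<le> r \<Longrightarrow> 0 < l \<Longrightarrow> emeasure lebesgue {y. l \<le> cmod (g y) *
        (cmod (\<Sum>i<N. cis (- 2 * pi * (x i \<bullet> y)) - fourier_measure M y) / sqrt (real N))}
      \<le> ennreal ((2 * r) powr r * (4 * exp 4 * G) * l powr - r)"
proof -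
  define lam where "lam = 1 / sqrt (real N)"
  have lam: "0 < lam" "lam \<le> 1 / 2" "lam\<^sup>2 = 1 / real N"
    using N real_le_rsqrt[of 2 "real N"] by (auto simp: lam_def power_divide field_simps)
  have "\<exists>x::nat \<Rightarrow> 'a. (\<forall>i<N. x i \<in> K) \<and>
    (\<integral>\<^sup>+ y. ennreal ((cmod (g y))\<^sup>2 * cexp_pot (of_real lam * (\<Sum>i<N. cis (- 2 * pi * (x i \<bullet> y)) - fourier_measure M y))) \<partial>lborel)
    \<le> ennreal (4 * (1 + 4 * lam\<^sup>2) ^ N) * (\<integral>\<^sup>+ y. ennreal ((cmod (g y))\<^sup>2) \<partial>lborel)"
    using lam by (intro exists_sample_cexp_pot M P K) auto
  then obtain x :: "nat \<Rightarrow> 'a" where x: "\<And>i. i < N \<Longrightarrow> x i \<in> K"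
    and le: "(\<integral>\<^sup>+ y. ennreal ((cmod (g y))\<^sup>2 * cexp_pot (of_real lam * (\<Sum>i<N. cis (- 2 * pi * (x i \<bullet> y)) - fourier_measure M y))) \<partial>lborel)
    \<le> ennreal (4 * (1 + 4 * lam\<^sup>2) ^ N) * (\<integral>\<^sup>+ y. ennreal ((cmod (g y))\<^sup>2) \<partial>lborel)" by blast
  note measurable_fourier_measure[OF M P, measurable]
  define z where "z y = of_real lam * (\<Sum>i<N. cis (- 2 * pi * (x i \<bullet> y)) - fourier_measure M y)" for y
  have [measurable]: "z \<in> borel_measurable borel" unfolding z_def by measurable
  have "(1 + 4 * lam\<^sup>2) ^ N \<le> exp (4 * lam\<^sup>2) ^ N"
    by (intro power_mono exp_ge_add_one_self) auto
  also have "\<dots> = exp 4" using N lam by (simp add: exp_of_nat_mult[symmetric])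
  finally have e: "(1 + 4 * lam\<^sup>2) ^ N \<le> exp 4" .
  have "(\<integral>\<^sup>+ y. ennreal ((cmod (g y))\<^sup>2 * cexp_pot (z y)) \<partial>lborel) \<le> ennreal (4 * (1 + 4 * lam\<^sup>2) ^ N) * ennreal G"
    using le G(2) unfolding z_def by (meson mult_left_mono order_trans zero_le)
  also have "\<dots> \<le> ennreal (4 * exp 4 * G)"
    using e G by (subst ennreal_mult[symmetric]) (auto intro!: ennreal_leI mult_right_mono)
  finally have V: "(\<integral>\<^sup>+ y. ennreal ((cmod (g y))\<^sup>2 * cexp_pot (z y)) \<partial>lborel) \<le> ennreal (4 * exp 4 * G)" .
  have tail: "emeasure lebesgue {y. l \<le> cmod (g y) *
        (cmod (\<Sum>i<N. cis (- 2 * pi * (x i \<bullet> y)) - fourier_measure M y) / sqrt (real N))}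
      \<le> ennreal ((2 * r) powr r * (4 * exp 4 * G) * l powr - r)" if r: "2 \<le> r" and l: "0 < l" for r l
  proof -
    let ?A = "{y. l \<le> cmod (g y) * cmod (z y)}"
    have A [measurable]: "?A \<in> sets borel" by measurable
    have "ennreal (l powr r) * emeasure lborel ?A = (\<integral>\<^sup>+ y. ennreal (l powr r) * indicator ?A y \<partial>lborel)"
      by (simp add: nn_integral_cmult_indicator)
    also have "\<dots> \<le> (\<integral>\<^sup>+ y. ennreal ((2 * r) powr r) * ennreal ((cmod (g y))\<^sup>2 * cexp_pot (z y)) \<partial>lborel)"
    proof (rule nn_integral_mono)
      fix y
      show "ennreal (l powr r) * indicator ?A y \<le> ennreal ((2 * r) powr r) * ennreal ((cmod (g y))\<^sup>2 * cexp_pot (z y))"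
      proof (cases "y \<in> ?A")
        case True
        then have "l powr r \<le> (cmod (g y) * cmod (z y)) powr r"
          using l r by (intro powr_mono2) auto
        also have "\<dots> = cmod (g y) powr r * cmod (z y) powr r" by (simp add: powr_mult)
        also have "\<dots> \<le> (cmod (g y))\<^sup>2 * ((2 * r) powr r * cexp_pot (z y))"
        proof (intro mult_mono norm_powr_le_cexp_pot)
          \<comment> \<open>Since |g| <= 1, every moment of order at least 2 may use the one weight
            for which the potential was bounded.\<close>
          have "cmod (g y) powr r \<le> cmod (g y) powr 2"
            using g1[of y] r by (intro powr_mono') auto
          then show "cmod (g y) powr r \<le> (cmod (g y))\<^sup>2" by simp
        qed (use r in auto)
        finally show ?thesis using True cexp_pot_nonneg[of "z y"]
          by (simp add: ennreal_mult[symmetric] mult_ac ennreal_leI)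
      qed simp
    qed
    also have "\<dots> = ennreal ((2 * r) powr r) * (\<integral>\<^sup>+ y. ennreal ((cmod (g y))\<^sup>2 * cexp_pot (z y)) \<partial>lborel)"
      by (rule nn_integral_cmult) simp
    also have "\<dots> \<le> ennreal ((2 * r) powr r) * ennreal (4 * exp 4 * G)"
      by (intro mult_left_mono V) simp
    also have "\<dots> = ennreal ((2 * r) powr r * (4 * exp 4 * G))"
      using G by (simp add: ennreal_mult)
    finally have "ennreal (l powr - r) * (ennreal (l powr r) * emeasure lborel ?A)
        \<le> ennreal (l powr - r) * ennreal ((2 * r) powr r * (4 * exp 4 * G))"
      by (rule mult_left_mono) simp
    also have "ennreal (l powr - r) * (ennreal (l powr r) * emeasure lborel ?A) = emeasure lborel ?A"
      using l by (simp add: mult.assoc[symmetric] ennreal_mult[symmetric] powr_minus)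
    also have "ennreal (l powr - r) * ennreal ((2 * r) powr r * (4 * exp 4 * G)) = ennreal ((2 * r) powr r * (4 * exp 4 * G) * l powr - r)"
      using G by (simp add: ennreal_mult[symmetric] mult_ac)
    finally have "emeasure lborel ?A \<le> \<dots>" .
    moreover have "?A = {y. l \<le> cmod (g y) *
        (cmod (\<Sum>i<N. cis (- 2 * pi * (x i \<bullet> y)) - fourier_measure M y) / sqrt (real N))}"
      by (simp add: z_def lam_def norm_mult norm_divide)
    moreover have "emeasure lebesgue ?A = emeasure lborel ?A"
      using A by simp
    ultimately show ?thesis by simp
  qed
  show thesis by (rule that[OF x tail])
qed

section \<open>The uniform measure on a cube\<close>

text \<open>The interval stays away from 0 and 1, so that the first carrier has a compact
  neighbourhood inside the half-open unit cube.\<close>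

definition slab_measure :: "real measure" where
  "slab_measure = uniform_measure lborel {1 / 4 .. 3 / 4}"

lemma prob_space_slab: "prob_space slab_measure"
  unfolding slab_measure_def by (rule prob_space_uniform_measure) auto

lemma sets_slab [simp, measurable_cong]: "sets slab_measure = sets borel"
  by (simp add: slab_measure_def)

lemma space_slab [simp]: "space slab_measure = UNIV"
  by (simp add: slab_measure_def)

definition slab_hat :: "real \<Rightarrow> complex" where
  "slab_hat y = (\<integral>s. cis (- 2 * pi * (s * y)) \<partial>slab_measure)"

lemma norm_slab_hat_le_1: "cmod (slab_hat y) \<le> 1"
  using norm_fourier_measure_le[of slab_measure y] prob_space_slab
  by (simp add: fourier_measure_def slab_hat_def)

text \<open>The explicit antiderivative has modulus 1/(2*pi*|y|) at both endpoints, the density is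
  2, and 2/pi <= 1.\<close>

lemma norm_slab_hat_le:
  assumes y: "y \<noteq> 0"
  shows "cmod (slab_hat y) \<le> 1 / \<bar>y\<bar>"
proof -
  define A where "A = \<i> * of_real (- 2 * pi * y)"
  have A: "A \<noteq> 0" "cmod A = 2 * pi * \<bar>y\<bar>" using y by (simp_all add: A_def norm_mult)
  have cis_eq: "cis (- 2 * pi * (s * y)) = exp (s *\<^sub>R A)" for s
    by (simp add: cis_conv_exp A_def scaleR_conv_of_real mult_ac)
  define F where "F s = cis (- 2 * pi * (s * y)) * (1 / A)" for s
  have F: "(F has_vector_derivative cis (- 2 * pi * (s * y))) (at s within B)" for s B
  proof -
    have "((\<lambda>s. exp (s *\<^sub>R A)) has_vector_derivative exp (s *\<^sub>R A) * A) (at s within B)"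
      by (rule exp_scaleR_has_vector_derivative_right)
    from has_vector_derivative_mult_left[OF this, of "1 / A"] show ?thesis
      unfolding F_def[abs_def] cis_eq using A by simp
  qed
  have dens: "slab_measure = density lborel (\<lambda>s. ennreal (2 * indicator {1/4..3/4} s))"
    unfolding slab_measure_def uniform_measure_def
    using divide_ennreal[of 1 "1 / 2"] by (intro density_cong) (auto simp: indicator_def)
  have "slab_hat y = (\<integral>s. (2 * indicator {1/4..3/4} s) *\<^sub>R cis (- 2 * pi * (s * y)) \<partial>lborel)"
    unfolding slab_hat_def dens by (subst integral_density) (auto simp: indicator_def)
  also have "\<dots> = 2 *\<^sub>R (\<integral>s. indicator {1/4..3/4} s *\<^sub>R cis (- 2 * pi * (s * y)) \<partial>lborel)"
    by (subst integral_scaleR_right[symmetric]) simp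
  also have "(\<integral>s. indicator {1/4..3/4} s *\<^sub>R cis (- 2 * pi * (s * y)) \<partial>lborel) = F (3/4) - F (1/4)"
    by (rule integral_FTC_Icc[OF _ F]) (auto intro!: continuous_intros)
  finally have "cmod (slab_hat y) \<le> 2 * (cmod (F (3/4)) + cmod (F (1/4)))"
    using norm_triangle_ineq4[of "F (3/4)" "F (1/4)"] by simp
  moreover have "cmod (F s) = 1 / (2 * pi * \<bar>y\<bar>)" for s
    by (simp add: F_def A norm_mult norm_divide)
  ultimately have "cmod (slab_hat y) \<le> 2 * (1 / (2 * pi * \<bar>y\<bar>) + 1 / (2 * pi * \<bar>y\<bar>))"
    by metis
  also have "2 * (1 / (2 * pi * \<bar>y\<bar>) + 1 / (2 * pi * \<bar>y\<bar>)) = 1 / \<bar>y\<bar> * (2 / pi)"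
    using y by (simp add: field_simps)
  also have "\<dots> \<le> 1 / \<bar>y\<bar> * 1"
    using pi_ge_two by (intro mult_left_mono) auto
  finally show ?thesis by simp
qed

lemma norm_slab_hat_square_le: "(cmod (slab_hat y))\<^sup>2 \<le> 2 * inverse (1 + y\<^sup>2)"
proof (cases "\<bar>y\<bar> \<le> 1")
  case True
  then have "y\<^sup>2 \<le> 1" by (simp add: abs_square_le_1)
  then have "1 \<le> 2 * inverse (1 + y\<^sup>2)" by (simp add: inverse_eq_divide le_divide_eq add_pos_nonneg)
  moreover have "(cmod (slab_hat y))\<^sup>2 \<le> 1" using norm_slab_hat_le_1[of y] by (simp add: power_le_one)
  ultimately show ?thesis by linarith
next
  case False
  then have y: "y \<noteq> 0" "1 \<le> y\<^sup>2" by (auto simp: abs_square_le_1[symmetric] not_le intro: less_imp_le)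
  have "(cmod (slab_hat y))\<^sup>2 \<le> (1 / \<bar>y\<bar>)\<^sup>2"
    using norm_slab_hat_le[OF y(1)] by (intro power_mono) auto
  also have "\<dots> = 1 / y\<^sup>2" by (simp add: power_divide)
  also have "\<dots> \<le> 2 * inverse (1 + y\<^sup>2)"
    using y by (simp add: field_simps add_pos_nonneg)
  finally show ?thesis .
qed

lemma measurable_slab_hat [measurable]: "slab_hat \<in> borel_measurable borel"
  using measurable_fourier_measure[of slab_measure] prob_space_slab
  by (simp add: fourier_measure_def[abs_def] slab_hat_def[abs_def])

lemma nn_integral_slab_hat_square:
  "(\<integral>\<^sup>+ y. ennreal ((cmod (slab_hat y))\<^sup>2) \<partial>lborel) < \<infinity>"
proof -
  have "set_integrable lborel (einterval (-\<infinity>) \<infinity>) (\<lambda>x. inverse (1 + x^2))"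
    by (rule integrable_inverse_1_plus_square)
  then have i: "integrable lborel (\<lambda>y::real. 2 * inverse (1 + y\<^sup>2))"
    by (simp add: set_integrable_def)
  have "(\<integral>\<^sup>+ y. ennreal ((cmod (slab_hat y))\<^sup>2) \<partial>lborel) \<le> (\<integral>\<^sup>+ y. ennreal (2 * inverse (1 + y\<^sup>2)) \<partial>lborel)"
    by (intro nn_integral_mono ennreal_leI norm_slab_hat_square_le)
  also have "\<dots> < \<infinity>" using i by (subst nn_integral_eq_integral) auto
  finally show ?thesis .
qed

text \<open>A product measure, so that its transform is a product of one-dimensional ones. Decay of
  order 1/|y| in each coordinate is then enough for square-integrability in every dimension.\<close>

definition cube_measure :: "'a::euclidean_space measure" where
  "cube_measure = distr (\<Pi>\<^sub>M b\<in>Basis. slab_measure) borel (\<lambda>f. \<Sum>b\<in>Basis. f b *\<^sub>R b)"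

lemma sets_cube [simp, measurable_cong]: "sets cube_measure = sets borel"
  by (simp add: cube_measure_def)

lemma prob_space_cube: "prob_space (cube_measure :: 'a::euclidean_space measure)"
proof -
  interpret S: prob_space slab_measure by (rule prob_space_slab)
  interpret P: product_prob_space "\<lambda>_::'a. slab_measure" Basis by unfold_locales
  show ?thesis unfolding cube_measure_def by (rule P.prob_space_distr) measurable
qed

lemma AE_cube: "AE x in cube_measure. \<forall>b\<in>Basis. x \<bullet> b \<in> {1 / 4 .. 3 / 4}"
proof -
  interpret S: prob_space slab_measure by (rule prob_space_slab)
  interpret P: product_prob_space "\<lambda>_::'a. slab_measure" Basis by unfold_locales
  have 1: "AE s in slab_measure. s \<in> {1 / 4 .. 3 / 4}"
    unfolding slab_measure_def by (rule AE_uniform_measureI) auto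
  have "AE f in (\<Pi>\<^sub>M b\<in>(Basis::'a set). slab_measure). f b \<in> {1 / 4 .. 3 / 4}" if "b \<in> Basis" for b
    using that by (intro AE_PiM_component 1) (auto simp: prob_space_slab)
  then have "AE f in (\<Pi>\<^sub>M b\<in>(Basis::'a set). slab_measure). \<forall>b\<in>Basis. f b \<in> {1 / 4 .. 3 / 4}"
    by (simp add: AE_finite_all)
  then have "AE f in (\<Pi>\<^sub>M b\<in>(Basis::'a set). slab_measure). \<forall>b\<in>Basis. (\<Sum>c\<in>Basis. f c *\<^sub>R c) \<bullet> b \<in> {1 / 4 .. 3 / 4}"
    by eventually_elim simp
  then show ?thesis unfolding cube_measure_def
    by (subst AE_distr_iff) (measurable, auto simp: space_PiM intro: countable_finite)
qed

lemma cis_sum: "finite A \<Longrightarrow> cis (\<Sum>x\<in>A. f x) = (\<Prod>x\<in>A. cis (f x))"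
  by (induction A rule: finite_induct) (auto simp: cis_mult[symmetric])

lemma fourier_cube:
  "fourier_measure (cube_measure :: 'a::euclidean_space measure) y = (\<Prod>b\<in>Basis. slab_hat (y \<bullet> b))"
proof -
  interpret S: prob_space slab_measure by (rule prob_space_slab)
  interpret P: product_sigma_finite "\<lambda>_::'a. slab_measure" by unfold_locales
  have "fourier_measure (cube_measure :: 'a measure) y
      = (\<integral>f. cis (- 2 * pi * ((\<Sum>b\<in>Basis. f b *\<^sub>R b) \<bullet> y)) \<partial>(\<Pi>\<^sub>M b\<in>(Basis::'a set). slab_measure))"
    unfolding fourier_measure_def cube_measure_def by (subst integral_distr) auto
  also have "\<dots> = (\<integral>f. (\<Prod>b\<in>Basis. cis (- 2 * pi * (f b * (y \<bullet> b)))) \<partial>(\<Pi>\<^sub>M b\<in>(Basis::'a set). slab_measure))"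
    by (simp add: inner_sum_left sum_distrib_left cis_sum[symmetric] inner_commute[of y] sum_negf)
  also have "\<dots> = (\<Prod>b\<in>Basis. slab_hat (y \<bullet> b))"
    unfolding slab_hat_def
    by (rule P.product_integral_prod) (auto intro!: S.integrable_const_bound[where B=1])
  finally show ?thesis .
qed

definition cube_hat :: "'a::euclidean_space \<Rightarrow> complex" where
  "cube_hat = fourier_measure cube_measure"

lemma measurable_cube_hat [measurable]: "cube_hat \<in> borel_measurable borel"
  unfolding cube_hat_def by (rule measurable_fourier_measure[OF sets_cube prob_space_cube])

lemma norm_cube_hat_le: "cmod (cube_hat y) \<le> 1"
  unfolding cube_hat_def by (rule norm_fourier_measure_le[OF sets_cube prob_space_cube])

lemma nn_integral_cube_hat_square:
  "(\<integral>\<^sup>+ y. ennreal ((cmod (cube_hat (y::'a::euclidean_space)))\<^sup>2) \<partial>lborel) < \<infinity>"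
proof -
  have "(\<integral>\<^sup>+ y. ennreal ((cmod (cube_hat (y::'a)))\<^sup>2) \<partial>lborel)
      = (\<integral>\<^sup>+ y. (\<Prod>b\<in>Basis. ennreal ((cmod (slab_hat (y \<bullet> b)))\<^sup>2)) \<partial>(lborel::'a measure))"
    by (simp add: cube_hat_def fourier_cube prod_norm[symmetric] prod_power_distrib prod_ennreal)
  also have "\<dots> = (\<Prod>b\<in>(Basis::'a set). (\<integral>\<^sup>+ y. ennreal ((cmod (slab_hat y))\<^sup>2) \<partial>lborel))"
    by (rule nn_integral_lborel_prod) auto
  also have "\<dots> < \<infinity>"
    using nn_integral_slab_hat_square by (simp add: power_less_top_ennreal)
  finally show ?thesis .
qed

section \<open>Dilated cubes\<close>

lemma nn_integral_lborel_scaleR: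
  fixes f :: "'a::euclidean_space \<Rightarrow> ennreal"
  assumes [measurable]: "f \<in> borel_measurable borel" and c: "0 < c"
  shows "(\<integral>\<^sup>+ y. f (c *\<^sub>R y) \<partial>lborel) = ennreal (1 / c ^ DIM('a)) * (\<integral>\<^sup>+ y. f y \<partial>lborel)"
proof -
  have "(\<integral>\<^sup>+ y. f y \<partial>lborel) = (\<integral>\<^sup>+ y. f y \<partial>density (distr lborel borel (\<lambda>x. 0 + c *\<^sub>R x)) (\<lambda>_. \<bar>c\<bar>^DIM('a)))"
    using c by (subst lborel_affine[of c 0]) auto
  also have "\<dots> = ennreal (c ^ DIM('a)) * (\<integral>\<^sup>+ y. f (c *\<^sub>R y) \<partial>lborel)"
    using c by (simp add: nn_integral_density nn_integral_distr nn_integral_cmult)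
  finally show ?thesis
    using c by (simp add: mult.assoc[symmetric] ennreal_mult[symmetric])
qed

text \<open>In L2 the transform of a cube of side 2^(-k) counts as a cutoff to frequencies up to
  about 2^k: its squared norm is of the order of the volume 2^(k*d).\<close>

lemma nn_integral_cube_hat_scaled:
  "\<exists>G>0. \<forall>k. (\<integral>\<^sup>+ y. ennreal ((cmod (cube_hat ((1 / 2 ^ k) *\<^sub>R (y::'a::euclidean_space))))\<^sup>2) \<partial>lborel)
    \<le> ennreal (G * 2 ^ (k * DIM('a)))"
proof -
  obtain G where G: "0 \<le> G" "(\<integral>\<^sup>+ y. ennreal ((cmod (cube_hat (y::'a)))\<^sup>2) \<partial>lborel) = ennreal G"
    using nn_integral_cube_hat_square[where 'a='a]
    by (cases "(\<integral>\<^sup>+ y. ennreal ((cmod (cube_hat (y::'a)))\<^sup>2) \<partial>lborel)") auto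
  have "(\<integral>\<^sup>+ y. ennreal ((cmod (cube_hat ((1 / 2 ^ k) *\<^sub>R (y::'a))))\<^sup>2) \<partial>lborel)
    \<le> ennreal ((G + 1) * 2 ^ (k * DIM('a)))" for k
    using G by (subst nn_integral_lborel_scaleR)
      (auto simp: ennreal_mult[symmetric] power_divide power_mult[symmetric] algebra_simps intro!: ennreal_leI)
  then show ?thesis using G(1) by (intro exI[of _ "G + 1"]) auto
qed

section \<open>Covers and mixtures of cubes\<close>

text \<open>The dyadic ranges contain their left endpoint 2^(-m-1), hence the shift by one: a
  diameter 2^(s-k) belongs to the range with index k - s - 1 only.\<close>

lemma power_quotient_in_dyadic_iff:
  "(2::real) ^ s / 2 ^ k \<in> dyadic m \<longleftrightarrow> m = int k - int s - 1"
proof -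
  have eq: "(2::real) ^ s / 2 ^ k = 2 powr (real s - real k)"
    by (simp add: powr_diff powr_realpow)
  have "(2::real) ^ s / 2 ^ k \<in> dyadic m \<longleftrightarrow>
      - real_of_int m - 1 \<le> real s - real k \<and> real s - real k < - real_of_int m"
    unfolding eq dyadic_def by simp
  also have "\<dots> \<longleftrightarrow> real_of_int (- m - 1) \<le> real_of_int (int s - int k) \<and> real_of_int (int s - int k) < real_of_int (- m)"
    by simp
  also have "\<dots> \<longleftrightarrow> - m - 1 \<le> int s - int k \<and> int s - int k < - m"
    by (simp only: of_int_le_iff of_int_less_iff)
  also have "\<dots> \<longleftrightarrow> m = int k - int s - 1" by auto
  finally show ?thesis .
qed

text \<open>Balls of one scale all have the same diameter and different scales occupy different
  dyadic ranges. The inner sums therefore do not mix, and the cost is an exact sum over the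
  scales.\<close>

lemma ball_cover_dyadic_family:
  fixes x :: "nat \<Rightarrow> nat \<Rightarrow> 'a::euclidean_space" and N :: "nat \<Rightarrow> nat"
  assumes J: "finite J" and \<beta>: "0 < \<beta>" and \<delta>: "\<And>k. k \<in> J \<Longrightarrow> 2 ^ Suc s / 2 ^ k < \<delta>" "0 < \<delta>"
    and F: "F \<subseteq> (\<Union>k\<in>J. \<Union>i<N k. ball (x k i) (2 ^ s / 2 ^ k))"
  shows "\<exists>B. ball_cover F \<delta> B \<and>
    cover_cost \<alpha> \<beta> B = (\<Sum>k\<in>J. ennreal ((real (N k) * (2 ^ Suc s / 2 ^ k) powr \<alpha>) powr \<beta>))"
proof -
  define I where "I = (SIGMA k:J. {..<N k})"
  have I: "finite I" using J by (simp add: I_def)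
  obtain e where e: "bij_betw e {0..<card I} I" using ex_bij_betw_nat_finite[OF I] by blast
  define Bf where "Bf = (\<lambda>(k, i). ball (x k i) (2 ^ s / 2 ^ k))"
  \<comment> \<open>The padding balls of radius 0 are empty. Their diameter 0 lies in no dyadic
    range, so they cost nothing.\<close>
  define B where "B j = (if j < card I then Bf (e j) else ball 0 0)" for j
  define Dm :: "nat \<Rightarrow> real" where "Dm k = 2 ^ Suc s / 2 ^ k" for k
  have dB: "diameter (Bf (k, i)) = Dm k" for k i
    by (simp add: Bf_def Dm_def diameter_ball not_less)
  have cover: "ball_cover F \<delta> B"
    unfolding ball_cover_def
  proof (intro conjI allI)
    fix j
    show "\<exists>c r. B j = ball c r"
    proof -
      obtain k i where "e j = (k, i)" by fastforce
      then have "B j = ball (x k i) (2 ^ s / 2 ^ k) \<or> B j = ball 0 0" by (auto simp: B_def Bf_def)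
      then show ?thesis by blast
    qed
    show "diameter (B j) < \<delta>"
    proof (cases "j < card I")
      case True
      then have "e j \<in> I" using e by (auto simp: bij_betw_def)
      then obtain k i where "e j = (k, i)" "k \<in> J" by (auto simp: I_def)
      then show ?thesis using True dB \<delta> by (simp add: B_def Dm_def)
    qed (use \<delta> in \<open>simp add: B_def\<close>)
  next
    show "F \<subseteq> (\<Union>j. B j)"
    proof
      fix y assume "y \<in> F"
      then obtain k i where ki: "(k, i) \<in> I" "y \<in> Bf (k, i)" using F by (auto simp: I_def Bf_def)
      then obtain j where "j < card I" "e j = (k, i)" using e by (force simp: bij_betw_def)
      then show "y \<in> (\<Union>j. B j)" using ki by (auto simp: B_def)
    qed
  qed
  define h where "h D m = (if D \<in> dyadic m then ennreal (D powr \<alpha>) else 0)" for D m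
  have dyadic_pos: "0 \<notin> dyadic m" for m by (auto simp: dyadic_def)
  have inner: "(\<Sum>\<^sub>\<infinity> j. h (diameter (B j)) m) = (\<Sum>k\<in>J. of_nat (N k) * h (Dm k) m)" for m
  proof -
    have "(\<Sum>\<^sub>\<infinity> j. h (diameter (B j)) m) = (\<Sum>\<^sub>\<infinity> j\<in>{0..<card I}. h (diameter (Bf (e j))) m)"
      by (rule infsum_cong_neutral) (auto simp: B_def h_def dyadic_pos)
    also have "\<dots> = (\<Sum>j\<in>{0..<card I}. h (diameter (Bf (e j))) m)" by (rule infsum_finite) simp
    also have "\<dots> = (\<Sum>ki\<in>I. h (diameter (Bf ki)) m)" by (rule sum.reindex_bij_betw[OF e])
    also have "\<dots> = (\<Sum>(k, i)\<in>I. h (Dm k) m)" by (intro sum.cong) (auto simp: dB)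
    also have "\<dots> = (\<Sum>k\<in>J. \<Sum>i<N k. h (Dm k) m)"
      unfolding I_def using J by (subst sum.Sigma) auto
    finally show ?thesis by simp
  qed
  \<comment> \<open>\<open>Suc s\<close> rather than \<open>s\<close>, since the diameter is twice
    the radius.\<close>
  define idx where "idx k = int k - int (Suc s) - 1" for k :: nat
  have hD: "h (Dm k) m = (if m = idx k then ennreal (Dm k powr \<alpha>) else 0)" for k m
    unfolding h_def Dm_def power_quotient_in_dyadic_iff idx_def by simp
  have val: "(\<Sum>k\<in>J. of_nat (N k) * h (Dm k) (idx l)) = ennreal (real (N l) * Dm l powr \<alpha>)" if l: "l \<in> J" for l
  proof -
    have "(\<Sum>k\<in>J. of_nat (N k) * h (Dm k) (idx l)) = (\<Sum>k\<in>J. if k = l then of_nat (N k) * ennreal (Dm k powr \<alpha>) else 0)"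
      by (intro sum.cong) (auto simp: hD idx_def)
    then show ?thesis using J l by (simp add: ennreal_mult ennreal_of_nat_eq_real_of_nat)
  qed
  have zero: "(\<Sum>k\<in>J. of_nat (N k) * h (Dm k) m) = 0" if "m \<notin> idx ` J" for m
    using that by (intro sum.neutral) (auto simp: hD)
  have "cover_cost \<alpha> \<beta> B = (\<Sum>\<^sub>\<infinity> m. enn_powr (\<Sum>k\<in>J. of_nat (N k) * h (Dm k) m) \<beta>)"
    unfolding cover_cost_def by (simp only: inner[unfolded h_def]) (simp only: h_def)
  also have "\<dots> = (\<Sum>\<^sub>\<infinity> m\<in>idx ` J. enn_powr (\<Sum>k\<in>J. of_nat (N k) * h (Dm k) m) \<beta>)"
    by (rule infsum_cong_neutral) (auto simp: zero)
  also have "\<dots> = (\<Sum>m\<in>idx ` J. enn_powr (\<Sum>k\<in>J. of_nat (N k) * h (Dm k) m) \<beta>)"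
    using J by (intro infsum_finite) simp
  also have "\<dots> = (\<Sum>l\<in>J. enn_powr (\<Sum>k\<in>J. of_nat (N k) * h (Dm k) (idx l)) \<beta>)"
    by (subst sum.reindex) (auto simp: inj_on_def idx_def)
  also have "\<dots> = (\<Sum>l\<in>J. ennreal ((real (N l) * Dm l powr \<alpha>) powr \<beta>))"
    by (intro sum.cong) (auto simp: val enn_powr_ennreal)
  finally have "cover_cost \<alpha> \<beta> B = (\<Sum>k\<in>J. ennreal ((real (N k) * (2 ^ Suc s / 2 ^ k) powr \<alpha>) powr \<beta>))"
    by (simp add: Dm_def)
  with cover show ?thesis by blast
qed

text \<open>The law of a random point: a uniform scale k, a uniform centre among the
  \<open>N k\<close>, and an independent cube vector shrunk by 2^k. Independence turns the
  convolution into a product of \<open>cube_hat\<close> with an average of characters.\<close>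

lemma exists_cube_mixture:
  fixes x :: "nat \<Rightarrow> nat \<Rightarrow> 'a::euclidean_space" and N :: "nat \<Rightarrow> nat"
  assumes J: "finite J" "J \<noteq> {}" and N: "\<And>k. k \<in> J \<Longrightarrow> 0 < N k"
  obtains M :: "'a measure" where "sets M = sets borel" "prob_space M"
    "\<And>y. fourier_measure M y = (\<Sum>k\<in>J. cube_hat ((1 / 2 ^ k) *\<^sub>R y) *
        ((\<Sum>i<N k. cis (- 2 * pi * (x k i \<bullet> y))) / of_nat (N k))) / of_nat (card J)"
    "\<And>L. L \<in> sets borel \<Longrightarrow>
      (\<And>k i u. k \<in> J \<Longrightarrow> i < N k \<Longrightarrow> (\<forall>b\<in>Basis. u \<bullet> b \<in> {1 / 4 .. 3 / 4}) \<Longrightarrow> x k i + (1 / 2 ^ k) *\<^sub>R u \<in> L)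
      \<Longrightarrow> AE z in M. z \<in> L"
proof -
  define p where "p = bind_pmf (pmf_of_set J) (\<lambda>k. map_pmf (Pair k) (pmf_of_set {..<N k}))"
  have ne: "{..<N k} \<noteq> {}" if "k \<in> J" for k using N[OF that] by auto
  define \<phi> where "\<phi> = (\<lambda>(ki, u). x (fst ki) (snd ki) + (1 / 2 ^ fst ki) *\<^sub>R (u :: 'a))"
  interpret U: prob_space "cube_measure :: 'a measure" by (rule prob_space_cube)
  interpret pr: prob_space "measure_pmf p" by (rule prob_space_measure_pmf)
  interpret pp: pair_prob_space "measure_pmf p" "cube_measure :: 'a measure" by unfold_locales
  have [measurable]: "\<phi> \<in> measure_pmf p \<Otimes>\<^sub>M cube_measure \<rightarrow>\<^sub>M borel"
    unfolding \<phi>_def by measurable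
  define M where "M = distr (measure_pmf p \<Otimes>\<^sub>M cube_measure) borel \<phi>"
  have sM: "sets M = sets borel" by (simp add: M_def)
  have pM: "prob_space M" unfolding M_def by (rule pp.prob_space_distr) simp
  have sum_p: "(\<integral>ki. g ki \<partial>measure_pmf p) = (\<Sum>k\<in>J. (\<Sum>i<N k. g (k, i)) / of_nat (N k)) / of_nat (card J)"
    for g :: "nat \<times> nat \<Rightarrow> complex"
  proof -
    have "(\<integral>ki. g ki \<partial>measure_pmf p)
        = (\<Sum>k\<in>J. pmf (pmf_of_set J) k *\<^sub>R (\<integral>ki. g ki \<partial>measure_pmf (map_pmf (Pair k) (pmf_of_set {..<N k}))))"
      unfolding p_def using J ne by (intro pmf_expectation_bind) auto
    also have "\<dots> = (\<Sum>k\<in>J. (\<Sum>i<N k. g (k, i)) / of_nat (N k) / of_nat (card J))"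
    proof (intro sum.cong refl)
      fix k assume k: "k \<in> J"
      have "(\<integral>ki. g ki \<partial>measure_pmf (map_pmf (Pair k) (pmf_of_set {..<N k}))) = (\<Sum>i<N k. g (k, i)) / of_nat (N k)"
        using ne[OF k] by (simp, subst integral_measure_pmf[of "{..<N k}"])
          (auto simp: scaleR_conv_of_real divide_inverse sum_distrib_left mult.commute)
      then show "pmf (pmf_of_set J) k *\<^sub>R (\<integral>ki. g ki \<partial>measure_pmf (map_pmf (Pair k) (pmf_of_set {..<N k})))
          = (\<Sum>i<N k. g (k, i)) / of_nat (N k) / of_nat (card J)"
        using J k by (simp add: scaleR_conv_of_real divide_inverse mult.commute)
    qed
    finally show ?thesis by (simp add: sum_divide_distrib)
  qed
  have fM: "fourier_measure M y = (\<Sum>k\<in>J. cube_hat ((1 / 2 ^ k) *\<^sub>R y) *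
        ((\<Sum>i<N k. cis (- 2 * pi * (x k i \<bullet> y))) / of_nat (N k))) / of_nat (card J)" for y
  proof -
    let ?e = "\<lambda>z. cis (- 2 * pi * (z \<bullet> y))"
    have "fourier_measure M y = (\<integral>w. ?e (\<phi> w) \<partial>(measure_pmf p \<Otimes>\<^sub>M cube_measure))"
      unfolding fourier_measure_def M_def by (subst integral_distr) auto
    also have "\<dots> = (\<integral>ki. (\<integral>u. ?e (\<phi> (ki, u)) \<partial>cube_measure) \<partial>measure_pmf p)"
      by (rule pp.integral_fst'[symmetric]) (auto intro!: pp.integrable_const_bound[where B=1])
    also have "\<dots> = (\<integral>ki. ?e (x (fst ki) (snd ki)) * cube_hat ((1 / 2 ^ fst ki) *\<^sub>R y) \<partial>measure_pmf p)"
    proof (rule Bochner_Integration.integral_cong[OF refl])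
      fix ki
      have "?e (\<phi> (ki, u)) = ?e (x (fst ki) (snd ki)) * cis (- 2 * pi * (u \<bullet> ((1 / 2 ^ fst ki) *\<^sub>R y)))" for u
        by (simp add: \<phi>_def inner_add_left cis_mult algebra_simps)
      then show "(\<integral>u. ?e (\<phi> (ki, u)) \<partial>cube_measure) = ?e (x (fst ki) (snd ki)) * cube_hat ((1 / 2 ^ fst ki) *\<^sub>R y)"
        by (simp only: cube_hat_def fourier_measure_def) (rule integral_mult_right_zero)
    qed
    also have "\<dots> = (\<Sum>k\<in>J. (\<Sum>i<N k. ?e (x k i) * cube_hat ((1 / 2 ^ k) *\<^sub>R y)) / of_nat (N k)) / of_nat (card J)"
      by (simp add: sum_p)
    finally show ?thesis by (simp add: sum_distrib_left mult.commute)
  qed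
  have aM: "AE z in M. z \<in> L" if L [measurable]: "L \<in> sets borel"
    and *: "\<And>k i u. k \<in> J \<Longrightarrow> i < N k \<Longrightarrow> (\<forall>b\<in>Basis. u \<bullet> b \<in> {1 / 4 .. 3 / 4}) \<Longrightarrow> x k i + (1 / 2 ^ k) *\<^sub>R u \<in> L" for L
  proof -
    have sp: "set_pmf p \<subseteq> (SIGMA k:J. {..<N k})"
      unfolding p_def using J ne by (auto simp: set_bind_pmf)
    have "AE ki in measure_pmf p. AE u in cube_measure. \<phi> (ki, u) \<in> L"
    proof (rule AE_pmfI)
      fix ki assume "ki \<in> set_pmf p"
      then obtain k i where ki: "ki = (k, i)" "k \<in> J" "i < N k" using sp by auto
      from AE_cube show "AE u in cube_measure. \<phi> (ki, u) \<in> L"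
        by eventually_elim (use * ki in \<open>auto simp: \<phi>_def\<close>)
    qed
    then have "AE w in measure_pmf p \<Otimes>\<^sub>M cube_measure. \<phi> w \<in> L"
      by (intro pp.AE_pair_measure) auto
    then show ?thesis unfolding M_def by (subst AE_distr_iff) auto
  qed
  show thesis by (rule that[OF sM pM fM aM])
qed

section \<open>One stage of the construction\<close>

text \<open>If |f + g| reaches t, then |2f| or |2g| does. The countable estimate applies to the
  sequence 2f, 2g, 0, 0, ...\<close>

lemma lorentz_norm_pow_add_le:
  fixes f g :: "'a::euclidean_space \<Rightarrow> complex"
  assumes p: "0 < p" and q: "0 < q"
    and [measurable]: "f \<in> borel_measurable lebesgue" "g \<in> borel_measurable lebesgue"
  shows "lorentz_norm_pow p q (\<lambda>x. f x + g x)
    \<le> ennreal (4 powr (q / p) * 2 powr q) * (lorentz_norm_pow p q f + lorentz_norm_pow p q g)"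
proof -
  define F where "F s = (if s = 0 then (\<lambda>x. of_real 2 * f x) else if s = 1 then (\<lambda>x. of_real 2 * g x) else (\<lambda>x. 0))" for s :: nat
  have zero: "lorentz_norm_pow p q (\<lambda>x::'a. 0) = 0"
  proof -
    have z: "indicator {0<..} t * enn_powr (distrib_fun (\<lambda>x::'a. 0) t * ennreal (t powr p)) (q / p) / ennreal t = 0" for t :: real
      by (cases "0 < t") (auto simp: distrib_fun_def)
    show ?thesis by (simp only: lorentz_norm_pow_def z) simp
  qed
  have "lorentz_norm_pow p q (\<lambda>x. f x + g x)
      \<le> (\<Sum>s. ennreal ((2 ^ Suc s) powr (q / p)) * lorentz_norm_pow p q (F s))"
  proof (rule lorentz_norm_pow_countable[OF p q])
    show "F s \<in> borel_measurable lebesgue" for s by (simp add: F_def)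
    fix t :: real and x assume "0 < t" "t \<le> cmod (f x + g x)"
    then have "t \<le> 2 * cmod (f x) \<or> t \<le> 2 * cmod (g x)"
      using norm_triangle_ineq[of "f x" "g x"] by linarith
    then have "t \<le> cmod (F 0 x) \<or> t \<le> cmod (F 1 x)" by (simp add: F_def norm_mult)
    then show "\<exists>s. t \<le> cmod (F s x)" by blast
  qed
  also have "\<dots> = (\<Sum>s\<in>{0, 1}. ennreal ((2 ^ Suc s) powr (q / p)) * lorentz_norm_pow p q (F s))"
    by (rule suminf_finite) (auto simp: F_def zero)
  also have "\<dots> = ennreal (2 powr (q / p)) * (ennreal (2 powr q) * lorentz_norm_pow p q f)
      + ennreal (4 powr (q / p)) * (ennreal (2 powr q) * lorentz_norm_pow p q g)"
    using p q lorentz_norm_pow_cmult[of 2 p q f] lorentz_norm_pow_cmult[of 2 p q g] by (simp add: F_def)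
  also have "\<dots> \<le> ennreal (4 powr (q / p)) * (ennreal (2 powr q) * lorentz_norm_pow p q f)
      + ennreal (4 powr (q / p)) * (ennreal (2 powr q) * lorentz_norm_pow p q g)"
    using p q by (intro add_right_mono mult_right_mono ennreal_leI powr_mono2) auto
  also have "\<dots> = ennreal (4 powr (q / p) * 2 powr q) * (lorentz_norm_pow p q f + lorentz_norm_pow p q g)"
    by (simp add: ennreal_mult distrib_left mult.assoc)
  finally show ?thesis .
qed

section \<open>Low frequencies under smoothing by small cubes\<close>

lemma norm_le_DIM:
  fixes u :: "'a::euclidean_space"
  assumes "\<forall>b\<in>Basis. u \<bullet> b \<in> {1 / 4 .. 3 / 4}"
  shows "norm u \<le> real DIM('a)"
proof -
  have "norm u \<le> (\<Sum>b\<in>Basis. \<bar>u \<bullet> b\<bar>)" by (rule norm_le_l1)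
  also have "\<dots> \<le> (\<Sum>b\<in>(Basis::'a set). 1)"
    using assms by (intro sum_mono) (auto simp: abs_le_iff intro: order_trans)
  finally show ?thesis by simp
qed

lemma norm_cis_minus_1_le: "cmod (cis t - 1) \<le> \<bar>t\<bar>"
  using iexp_approx1[of t 0] by (simp add: cis_conv_exp)

lemma cube_hat_near_1:
  fixes z :: "'a::euclidean_space"
  shows "cmod (cube_hat z - 1) \<le> min 2 (2 * pi * real DIM('a) * norm z)"
proof -
  interpret U: prob_space "cube_measure :: 'a measure" by (rule prob_space_cube)
  have i: "integrable cube_measure (\<lambda>u. cis (- 2 * pi * (u \<bullet> z)))"
    by (rule integrable_cis_inner[OF sets_cube prob_space_cube])
  have "cube_hat z - 1 = (\<integral>u. cis (- 2 * pi * (u \<bullet> z)) - 1 \<partial>cube_measure)"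
    using i by (simp add: cube_hat_def fourier_measure_def U.prob_space)
  also have "cmod \<dots> \<le> (\<integral>u. cmod (cis (- 2 * pi * (u \<bullet> z)) - 1) \<partial>cube_measure)"
    by (rule integral_norm_bound)
  also have "\<dots> \<le> (\<integral>u. 2 * pi * real DIM('a) * norm z \<partial>(cube_measure :: 'a measure))"
  proof (rule integral_mono_AE)
    show "AE u in cube_measure. cmod (cis (- 2 * pi * (u \<bullet> z)) - 1) \<le> 2 * pi * real DIM('a) * norm z"
      using AE_cube
    proof eventually_elim
      case (elim u)
      have "cmod (cis (- 2 * pi * (u \<bullet> z)) - 1) \<le> 2 * pi * \<bar>u \<bullet> z\<bar>"
        using norm_cis_minus_1_le[of "- 2 * pi * (u \<bullet> z)"] by (simp add: abs_mult)
      also have "\<dots> \<le> 2 * pi * (norm u * norm z)"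
        by (intro mult_left_mono Cauchy_Schwarz_ineq2) auto
      also have "\<dots> \<le> 2 * pi * (real DIM('a) * norm z)"
        using norm_le_DIM[OF elim] by (intro mult_left_mono mult_right_mono) auto
      finally show ?case by (simp add: mult.assoc)
    qed
  qed (use i in auto)
  finally have "cmod (cube_hat z - 1) \<le> 2 * pi * real DIM('a) * norm z"
    by (simp add: U.prob_space)
  moreover have "cmod (cube_hat z - 1) \<le> 2"
    using norm_triangle_ineq4[of "cube_hat z" 1] norm_cube_hat_le[of z] by simp
  ultimately show ?thesis by simp
qed

text \<open>Dominated convergence with majorant \<open>4 * (cmod (f y))\<^sup>2\<close>: the factor
  tends to 0 at each frequency but not uniformly, so square-integrability of \<open>f\<close> has to
  handle the high frequencies.\<close>

lemma eventually_low_freq_L2_small: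
  fixes f :: "'a::euclidean_space \<Rightarrow> complex"
  assumes [measurable]: "f \<in> borel_measurable borel"
    and fin: "(\<integral>\<^sup>+ y. ennreal ((cmod (f y))\<^sup>2) \<partial>lborel) < \<infinity>" and E: "0 < E" and C: "0 \<le> C"
  shows "\<forall>\<^sub>F k in sequentially.
    (\<integral>\<^sup>+ y. ennreal ((min 2 (C * norm y / 2 ^ k) * cmod (f y))\<^sup>2) \<partial>lborel) \<le> ennreal E"
proof -
  have "(\<lambda>k. \<integral>\<^sup>+ y. ennreal ((min 2 (C * norm y / 2 ^ k) * cmod (f y))\<^sup>2) \<partial>lborel)
      \<longlonglongrightarrow> (\<integral>\<^sup>+ y. 0 \<partial>(lborel :: 'a measure))"
  proof (rule nn_integral_dominated_convergence[where w="\<lambda>y. ennreal 4 * ennreal ((cmod (f y))\<^sup>2)"])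
    show "(\<integral>\<^sup>+ y. ennreal 4 * ennreal ((cmod (f y))\<^sup>2) \<partial>lborel) < \<infinity>"
      using fin by (simp add: nn_integral_cmult ennreal_mult_less_top)
    fix k
    show "AE y in lborel. ennreal ((min 2 (C * norm y / 2 ^ k) * cmod (f y))\<^sup>2) \<le> ennreal 4 * ennreal ((cmod (f y))\<^sup>2)"
    proof (rule AE_I2)
      fix y
      have "(min 2 (C * norm y / 2 ^ k) * cmod (f y))\<^sup>2 \<le> (2 * cmod (f y))\<^sup>2"
        using C by (intro power_mono mult_right_mono) auto
      then show "ennreal ((min 2 (C * norm y / 2 ^ k) * cmod (f y))\<^sup>2) \<le> ennreal 4 * ennreal ((cmod (f y))\<^sup>2)"
        by (subst ennreal_mult[symmetric]) (auto simp: power_mult_distrib intro!: ennreal_leI)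
    qed
  next
    show "AE y in lborel. (\<lambda>k. ennreal ((min 2 (C * norm y / 2 ^ k) * cmod (f y))\<^sup>2)) \<longlonglongrightarrow> 0"
    proof (rule AE_I2)
      fix y :: 'a
      have "(\<lambda>k. C * norm y * (1 / 2) ^ k) \<longlonglongrightarrow> C * norm y * 0"
        by (intro tendsto_intros LIMSEQ_power_zero) auto
      then have 1: "(\<lambda>k. C * norm y / 2 ^ k) \<longlonglongrightarrow> 0" by (simp add: power_divide)
      have "(\<lambda>k. (min 2 (C * norm y / 2 ^ k) * cmod (f y))\<^sup>2) \<longlonglongrightarrow> (min 2 0 * cmod (f y))\<^sup>2"
        by (intro tendsto_intros 1)
      then have "(\<lambda>k. (min 2 (C * norm y / 2 ^ k) * cmod (f y))\<^sup>2) \<longlonglongrightarrow> 0" by simp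
      from tendsto_ennrealI[OF this] show "(\<lambda>k. ennreal ((min 2 (C * norm y / 2 ^ k) * cmod (f y))\<^sup>2)) \<longlonglongrightarrow> 0"
        by simp
    qed
  qed auto
  then have "(\<lambda>k. \<integral>\<^sup>+ y. ennreal ((min 2 (C * norm y / 2 ^ k) * cmod (f y))\<^sup>2) \<partial>lborel) \<longlonglongrightarrow> 0" by simp
  from order_tendstoD(2)[OF this, of "ennreal E"] E
  have "\<forall>\<^sub>F k in sequentially. (\<integral>\<^sup>+ y. ennreal ((min 2 (C * norm y / 2 ^ k) * cmod (f y))\<^sup>2) \<partial>lborel) < ennreal E"
    by simp
  then show ?thesis by eventually_elim simp
qed

text \<open>With c = \<theta> * n^(-1/q) the cost equals a constant times n^(1 - \<beta>*(2 - 2/q)).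
  As 2 - 2/q = 2/q', the exponent is negative exactly when \<beta> > q'/2.\<close>

lemma exists_scale_count:
  fixes q \<beta> D \<theta> \<epsilon> :: real
  assumes q: "1 < q" and \<beta>: "\<beta> > (q / (q - 1)) / 2" and D: "0 < D" and \<theta>: "0 < \<theta>" and \<epsilon>: "0 < \<epsilon>"
  obtains n :: nat where "0 < n"
    "real n * (D / (real n * (\<theta> * real n powr (- 1 / q)))\<^sup>2) powr \<beta> \<le> \<epsilon>"
proof -
  define e where "e = 1 - \<beta> * (2 - 2 / q)"
  define r where "r = q / (q - 1)"
  have "r / 2 < \<beta>" using \<beta> by (simp only: r_def)
  then have "q / (q - 1) < 2 * \<beta>" unfolding r_def[symmetric] by linarith
  then have "q < 2 * \<beta> * (q - 1)" using q by (simp add: divide_less_eq)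
  then have e: "e < 0" using q by (simp add: e_def field_simps)
  have eq: "real n * (D / (real n * (\<theta> * real n powr (- 1 / q)))\<^sup>2) powr \<beta> = (D / \<theta>\<^sup>2) powr \<beta> * real n powr e"
    if n: "0 < n" for n
  proof -
    define y where "y = real n powr (1 - 1 / q)"
    have y: "0 < y" using n by (simp add: y_def)
    have "real n * (\<theta> * real n powr (- 1 / q)) = \<theta> * y"
      using n powr_add[of "real n" 1 "- 1 / q"] by (simp add: y_def)
    then have "D / (real n * (\<theta> * real n powr (- 1 / q)))\<^sup>2 = (D / \<theta>\<^sup>2) * y powr - 2"
      using y by (simp only: power_mult_distrib) (simp add: powr_minus divide_inverse mult.assoc)
    also have "\<dots> = (D / \<theta>\<^sup>2) * real n powr (- (2 - 2 / q))"
      unfolding y_def by (simp only: powr_powr) (simp add: algebra_simps)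
    finally have *: "D / (real n * (\<theta> * real n powr (- 1 / q)))\<^sup>2 = (D / \<theta>\<^sup>2) * real n powr (- (2 - 2 / q))" .
    have "(D / (real n * (\<theta> * real n powr (- 1 / q)))\<^sup>2) powr \<beta> = (D / \<theta>\<^sup>2) powr \<beta> * real n powr (- (2 - 2 / q) * \<beta>)"
      unfolding * by (subst powr_mult) (simp only: powr_powr)+
    then show ?thesis
      using n powr_add[of "real n" 1 "- (2 - 2 / q) * \<beta>"] by (simp add: e_def algebra_simps)
  qed
  have "(\<lambda>n. (D / \<theta>\<^sup>2) powr \<beta> * real n powr e) \<longlonglongrightarrow> (D / \<theta>\<^sup>2) powr \<beta> * 0"
    using e by (intro tendsto_intros tendsto_neg_powr filterlim_real_sequentially)
  then have "\<forall>\<^sub>F n in sequentially. (D / \<theta>\<^sup>2) powr \<beta> * real n powr e < \<epsilon>"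
    using \<epsilon> by (intro order_tendstoD(2)) auto
  then have "\<forall>\<^sub>F n in sequentially. (D / \<theta>\<^sup>2) powr \<beta> * real n powr e < \<epsilon> \<and> 0 < n"
    using eventually_gt_at_top[of "0::nat"] by eventually_elim simp
  then obtain n where "0 < n" "(D / \<theta>\<^sup>2) powr \<beta> * real n powr e < \<epsilon>"
    unfolding eventually_sequentially by blast
  then show thesis using that[of n] eq[of n] by simp
qed

text \<open>Square-integrability is the invariant that lets the next stage smooth at a fine scale
  with little change. It is regained at each stage from the cubes of the mixture.\<close>

definition stage :: "'a::euclidean_space measure \<Rightarrow> 'a set \<Rightarrow> bool" where
  "stage M K \<longleftrightarrow> sets M = sets borel \<and> prob_space M \<and> compact K \<and> (AE x in M. x \<in> K) \<and>
     (\<integral>\<^sup>+ y. ennreal ((cmod (fourier_measure M y))\<^sup>2) \<partial>lborel) < \<infinity>"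

text \<open>An average is at most one of its terms, so its square is at most the sum of the
  squares.\<close>

lemma nn_integral_square_average_less_top:
  fixes g :: "'i \<Rightarrow> 'a::euclidean_space \<Rightarrow> complex"
  assumes J: "finite J" "J \<noteq> {}" and [measurable]: "\<And>k. k \<in> J \<Longrightarrow> g k \<in> borel_measurable borel"
    and fin: "\<And>k. k \<in> J \<Longrightarrow> (\<integral>\<^sup>+ y. ennreal ((cmod (g k y))\<^sup>2) \<partial>lborel) < \<infinity>"
    and f: "\<And>y. cmod (f y) \<le> (\<Sum>k\<in>J. cmod (g k y)) / real (card J)"
  shows "(\<integral>\<^sup>+ y. ennreal ((cmod (f y))\<^sup>2) \<partial>lborel) < \<infinity>"
proof -
  have c: "0 < card J" using J by (simp add: card_gt_0_iff)
  have "(\<integral>\<^sup>+ y. ennreal ((cmod (f y))\<^sup>2) \<partial>lborel) \<le> (\<integral>\<^sup>+ y. (\<Sum>k\<in>J. ennreal ((cmod (g k y))\<^sup>2)) \<partial>lborel)"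
  proof (rule nn_integral_mono)
    fix y
    have "cmod (f y) \<le> Max ((\<lambda>k. cmod (g k y)) ` J)"
    proof -
      have "(\<Sum>k\<in>J. cmod (g k y)) \<le> (\<Sum>k\<in>J. Max ((\<lambda>k. cmod (g k y)) ` J))"
        using J by (intro sum_mono Max_ge) auto
      then have "(\<Sum>k\<in>J. cmod (g k y)) / real (card J) \<le> Max ((\<lambda>k. cmod (g k y)) ` J)"
        using c by (simp add: divide_le_eq mult.commute)
      then show ?thesis using f[of y] by linarith
    qed
    moreover have "Max ((\<lambda>k. cmod (g k y)) ` J) \<in> (\<lambda>k. cmod (g k y)) ` J" using J by (intro Max_in) auto
    ultimately obtain k where k: "k \<in> J" "cmod (f y) \<le> cmod (g k y)" by auto
    have "(cmod (f y))\<^sup>2 \<le> (cmod (g k y))\<^sup>2" using k by (intro power_mono) auto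
    also have "\<dots> \<le> (\<Sum>k\<in>J. (cmod (g k y))\<^sup>2)" using k J by (intro member_le_sum) auto
    finally show "ennreal ((cmod (f y))\<^sup>2) \<le> (\<Sum>k\<in>J. ennreal ((cmod (g k y))\<^sup>2))"
      by (subst sum_ennreal) (auto intro: ennreal_leI)
  qed
  also have "\<dots> = (\<Sum>k\<in>J. \<integral>\<^sup>+ y. ennreal ((cmod (g k y))\<^sup>2) \<partial>lborel)"
    by (rule nn_integral_sum) simp
  also have "\<dots> < \<infinity>" using fin J by (simp add: less_top[symmetric])
  finally show ?thesis .
qed

text \<open>The number \<open>n\<close> of scales is fixed first, by the cost; the starting scale
  \<open>k0\<close> is chosen afterwards, large enough for every limit condition. The inclusions K'
  in the interior of L' and L' in L leave room for the next step to remain inside the set covered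
  here.\<close>

lemma stage_step:
  fixes M :: "'a::euclidean_space measure" and p q \<beta> \<epsilon> \<delta> :: real
  assumes p: "2 < p" and q: "1 < q" and \<beta>: "\<beta> > (q / (q - 1)) / 2"
    and st: "stage M K" and L: "compact L" "K \<subseteq> interior L" and \<epsilon>: "0 < \<epsilon>" and \<delta>: "0 < \<delta>"
  shows "\<exists>M' K' L'. stage M' K' \<and> compact L' \<and> K' \<subseteq> interior L' \<and> L' \<subseteq> L \<and>
    lorentz_norm_pow p q (\<lambda>y. fourier_measure M' y - fourier_measure M y) \<le> ennreal \<epsilon> \<and>
    (\<exists>B. ball_cover L' \<delta> B \<and> cover_cost (2 * real DIM('a) / p) \<beta> B \<le> ennreal \<epsilon>)"
proof -
  define d where "d = DIM('a)"
  have d: "0 < d" by (simp add: d_def)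
  have M: "sets M = sets borel" and P: "prob_space M" and K: "compact K" and AEK: "AE x in M. x \<in> K"
    and L2: "(\<integral>\<^sup>+ y. ennreal ((cmod (fourier_measure M y))\<^sup>2) \<partial>lborel) < \<infinity>"
    using st by (auto simp: stage_def)
  note measurable_fourier_measure[OF M P, measurable]
  define \<nu> where "\<nu> = fourier_measure M"
  have [measurable]: "\<nu> \<in> borel_measurable borel" by (simp add: \<nu>_def)
  have \<nu>1: "cmod (\<nu> y) \<le> 1" for y unfolding \<nu>_def by (rule norm_fourier_measure_le[OF M P])
  have q0: "0 < q" using q by simp
  have "0 < q / (q - 1) / 2" using q by simp
  then have \<beta>0: "0 < \<beta>" using \<beta> by linarith
  define \<alpha> where "\<alpha> = 2 * real d / p"
  define a where "a = 2 powr - (real d / p)"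
  have a: "0 < a" "a < 1" using p d powr_less_one[of 2 "- (d / p)"] by (auto simp: a_def)
  obtain G where G: "0 < G" "\<And>k. (\<integral>\<^sup>+ y. ennreal ((cmod (cube_hat ((1 / 2 ^ k) *\<^sub>R (y::'a))))\<^sup>2) \<partial>lborel)
      \<le> ennreal (G * 2 ^ (k * d))"
    using nn_integral_cube_hat_scaled[where 'a='a] unfolding d_def by blast
  \<comment> \<open>Dominates the constant \<open>(2 * r) powr r\<close> of the tail bound for both
    exponents r = 2 and r = 2 * p.\<close>
  define C0 where "C0 = (4 powr 2 + (4 * p) powr (2 * p)) * (4 * exp 4 * G)"
  have C0: "0 < C0" using G by (auto simp: C0_def intro!: mult_pos_pos add_pos_nonneg)
  obtain C where C: "0 < C" and multi: "\<forall>(c::real) (J::nat set) (h :: nat \<Rightarrow> 'a \<Rightarrow> real) (f :: 'a \<Rightarrow> complex).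
      0 < c \<longrightarrow> finite J \<longrightarrow> J \<noteq> {} \<longrightarrow> (\<forall>k\<in>J. h k \<in> borel_measurable lebesgue) \<longrightarrow>
      (\<forall>k\<in>J. \<forall>l>0. \<forall>r\<in>{2, 2 * p}.
          emeasure lebesgue {x. l \<le> h k x} \<le> ennreal (C0 * 2 ^ (k * DIM('a)) * l powr - r)) \<longrightarrow>
      (\<forall>x. cmod (f x) \<le> (\<Sum>k\<in>J. c * (2 powr - (DIM('a) / p)) ^ k * h k x)) \<longrightarrow>
      lorentz_norm_pow p q f \<le> ennreal (C * real (card J) * c powr q)"
    using lorentz_norm_pow_multiscale[where 'a='a, OF p q0 C0] by blast
  define Cq where "Cq = 4 powr (q / p) * 2 powr q"
  have Cq: "0 < Cq" by (simp add: Cq_def)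
  define CB where "CB = q * (2 powr ((p - 2) * q / p) / ((p - 2) * q / p))"
  have CB: "0 < CB" using p q by (simp add: CB_def)
  \<comment> \<open>\<theta> and \<open>E\<close> are solved for so that sampling and smoothing each
    use half of \<epsilon>, after the constant \<open>Cq\<close> lost in adding the two
    errors.\<close>
  define \<theta> where "\<theta> = (\<epsilon> / (2 * Cq * C)) powr (1 / q)"
  have \<theta>: "0 < \<theta>" "Cq * (C * \<theta> powr q) = \<epsilon> / 2"
    using \<epsilon> Cq C q by (auto simp: \<theta>_def powr_powr)
  define E where "E = (\<epsilon> / (2 * Cq * CB)) powr (p / q)"
  have E: "0 < E" "Cq * (CB * E powr (q / p)) = \<epsilon> / 2"
    using \<epsilon> Cq CB q p by (auto simp: E_def powr_powr)
  \<comment> \<open>The factor 2 pays for rounding the number of cubes up to an integer; 2^(d+2) is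
    the diameter of a covering ball in units of 2^(-k).\<close>
  define D where "D = 2 * (2 ^ (d + 2)) powr \<alpha>"
  have D: "0 < D" by (simp add: D_def)
  obtain n :: nat where n: "0 < n" and cost: "real n * (D / (real n * (\<theta> * real n powr (- 1 / q)))\<^sup>2) powr \<beta> \<le> \<epsilon>"
    using exists_scale_count[OF q \<beta> D \<theta>(1) \<epsilon>] by blast
  define c where "c = \<theta> * real n powr (- 1 / q)"
  have c: "0 < c" using \<theta> n by (simp add: c_def)
  have ncq: "real n * c powr q = \<theta> powr q"
  proof -
    have 1: "(real n powr (- 1 / q)) powr q = 1 / real n"
      using n q by (simp only: powr_powr) (simp add: powr_minus divide_inverse)
    show ?thesis unfolding c_def using n by (simp only: powr_mult 1) simp
  qed
  obtain e where e: "0 < e" "(\<Union>x\<in>K. cball x e) \<subseteq> interior L"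
    using compact_subset_open_imp_cball_epsilon_subset[OF K open_interior L(2)] by blast
  have ev_half: "(\<lambda>k. R * (1 / 2) ^ k) \<longlonglongrightarrow> R * 0" for R :: real
    by (intro tendsto_intros LIMSEQ_power_zero) auto
  have ev: "\<forall>\<^sub>F k in sequentially. R / 2 ^ k < t" if "0 < t" for R t :: real
    using order_tendstoD(2)[OF ev_half[of R], of t] that by (simp add: power_divide)
  have "(\<lambda>k. real n * c * a ^ k) \<longlonglongrightarrow> real n * c * 0"
    using a by (intro tendsto_intros LIMSEQ_power_zero) auto
  then have "\<forall>\<^sub>F k in sequentially. real n * c * a ^ k < 1 / 2"
    by (rule order_tendstoD(2)) simp
  moreover have "\<forall>\<^sub>F k in sequentially. (\<integral>\<^sup>+ y. ennreal ((min 2 (2 * pi * real d * norm y / 2 ^ k) * cmod (\<nu> y))\<^sup>2) \<partial>lborel) \<le> ennreal E"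
    using L2 E by (intro eventually_low_freq_L2_small) (auto simp: \<nu>_def)
  ultimately have "\<forall>\<^sub>F k in sequentially. real n * c * a ^ k < 1 / 2 \<and> 2 ^ (d + 2) / 2 ^ k < \<delta> \<and> 2 ^ d / 2 ^ k < e \<and>
      (\<integral>\<^sup>+ y. ennreal ((min 2 (2 * pi * real d * norm y / 2 ^ k) * cmod (\<nu> y))\<^sup>2) \<partial>lborel) \<le> ennreal E"
    using ev[OF \<delta>, of "2 ^ (d + 2)"] ev[OF e(1), of "2 ^ d"] by eventually_elim auto
  \<comment> \<open>The four conditions give in turn: at least four samples per scale, covering
    balls of diameter below \<delta>, new sets inside \<open>L\<close>, and a small smoothing
    error.\<close>
  then obtain k0 where k0: "\<And>k. k0 \<le> k \<Longrightarrow> real n * c * a ^ k < 1 / 2 \<and> 2 ^ (d + 2) / 2 ^ k < \<delta> \<and> 2 ^ d / 2 ^ k < e \<and>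
      (\<integral>\<^sup>+ y. ennreal ((min 2 (2 * pi * real d * norm y / 2 ^ k) * cmod (\<nu> y))\<^sup>2) \<partial>lborel) \<le> ennreal E"
    unfolding eventually_sequentially by blast
  define J where "J = {k0..<k0 + n}"
  have J: "finite J" "J \<noteq> {}" "card J = n" "\<And>k. k \<in> J \<Longrightarrow> k0 \<le> k" using n by (auto simp: J_def)
  \<comment> \<open>The solution of 1 / (n * sqrt X) = c * a^k, the balance at which the sampling
    error has the prescribed height.\<close>
  define X where "X k = (1 / (real n * c * a ^ k))\<^sup>2" for k
  define N where "N k = nat \<lceil>X k\<rceil>" for k
  have nca: "0 < real n * c * a ^ k" for k using n c a by simp
  have N: "X k \<le> real (N k)" "real (N k) \<le> 2 * X k" "4 \<le> N k" if "k \<in> J" for k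
  proof -
    have "2 \<le> 1 / (real n * c * a ^ k)"
      using k0[OF J(4)[OF that]] nca[of k] by (simp add: field_simps)
    then have "2\<^sup>2 \<le> X k" unfolding X_def by (intro power_mono) auto
    then have X4: "4 \<le> X k" by simp
    show "X k \<le> real (N k)" unfolding N_def by linarith
    then show "4 \<le> N k" using X4 by linarith
    show "real (N k) \<le> 2 * X k" unfolding N_def using X4 by linarith
  qed
  define ch where "ch k y = cube_hat ((1 / 2 ^ k) *\<^sub>R (y::'a))" for k y
  have [measurable]: "ch k \<in> borel_measurable borel" for k unfolding ch_def by measurable
  have ch1: "cmod (ch k y) \<le> 1" for k y unfolding ch_def by (rule norm_cube_hat_le)
  define Q where "Q k x \<longleftrightarrow> (\<forall>i<N k. x i \<in> K) \<and> (\<forall>r l. 2 \<le> r \<longrightarrow> 0 < l \<longrightarrow> emeasure lebesgue {y. l \<le> cmod (ch k y) *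
        (cmod (\<Sum>i<N k. cis (- 2 * pi * (x i \<bullet> y)) - \<nu> y) / sqrt (real (N k)))}
      \<le> ennreal ((2 * r) powr r * (4 * exp 4 * (G * 2 ^ (k * d))) * l powr - r))" for k and x :: "nat \<Rightarrow> 'a"
  have "\<forall>k\<in>J. \<exists>x. Q k x"
  proof
    fix k assume k: "k \<in> J"
    have G0: "0 \<le> G * 2 ^ (k * d)" using G(1) by simp
    have Gk: "(\<integral>\<^sup>+ y. ennreal ((cmod (ch k y))\<^sup>2) \<partial>lborel) \<le> ennreal (G * 2 ^ (k * d))"
      unfolding ch_def by (rule G(2))
    show "\<exists>x. Q k x"
      by (rule exists_sample_tail[OF M P AEK \<open>ch k \<in> borel_measurable borel\<close> ch1 G0 Gk N(3)[OF k]])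
         (auto simp: Q_def \<nu>_def)
  qed
  then obtain x where "\<forall>k\<in>J. Q k (x k)" using bchoice[of J Q] by blast
  then have xK: "\<And>k i. k \<in> J \<Longrightarrow> i < N k \<Longrightarrow> x k i \<in> K"
    and tail: "\<And>k r l. k \<in> J \<Longrightarrow> 2 \<le> r \<Longrightarrow> 0 < l \<Longrightarrow> emeasure lebesgue {y. l \<le> cmod (ch k y) *
        (cmod (\<Sum>i<N k. cis (- 2 * pi * (x k i \<bullet> y)) - \<nu> y) / sqrt (real (N k)))}
      \<le> ennreal ((2 * r) powr r * (4 * exp 4 * (G * 2 ^ (k * d))) * l powr - r)"
    by (auto simp: Q_def)
  have N0: "0 < N k" if "k \<in> J" for k using N(3)[OF that] by simp
  obtain M' :: "'a measure" where M': "sets M' = sets borel" "prob_space M'"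
    and fM': "\<And>y. fourier_measure M' y = (\<Sum>k\<in>J. ch k y *
        ((\<Sum>i<N k. cis (- 2 * pi * (x k i \<bullet> y))) / of_nat (N k))) / of_nat (card J)"
    and AEM': "\<And>L. L \<in> sets borel \<Longrightarrow>
      (\<And>k i u. k \<in> J \<Longrightarrow> i < N k \<Longrightarrow> (\<forall>b\<in>Basis. u \<bullet> b \<in> {1 / 4 .. 3 / 4}) \<Longrightarrow> x k i + (1 / 2 ^ k) *\<^sub>R u \<in> L)
      \<Longrightarrow> AE z in M'. z \<in> L"
    using exists_cube_mixture[of J N x] J N0 unfolding ch_def by blast
  \<comment> \<open>Three nested radii, in units of 2^(-k): d contains the cubes, 2^d > d puts them
    in the interior of \<open>L'\<close>, and 2^(d+1) will give open covering balls.\<close>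
  define K' where "K' = (\<Union>k\<in>J. \<Union>i<N k. cball (x k i) (real d / 2 ^ k))"
  define L' where "L' = (\<Union>k\<in>J. \<Union>i<N k. cball (x k i) (2 ^ d / 2 ^ k))"
  have cK': "compact K'" and cL': "compact L'" unfolding K'_def L'_def using J by (auto intro!: compact_UN)
  have "K' \<subseteq> (\<Union>k\<in>J. \<Union>i<N k. ball (x k i) (2 ^ d / 2 ^ k))"
  proof -
    have "real d / 2 ^ k < 2 ^ d / 2 ^ k" for k
      using of_nat_less_two_power[of d, where 'a=real] by (simp add: divide_strict_right_mono)
    then have "cball z (real d / 2 ^ k) \<subseteq> ball z (2 ^ d / 2 ^ k)" for z :: 'a and k
      unfolding cball_subset_ball_iff by simp
    then show ?thesis unfolding K'_def by (intro UN_mono subset_refl)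
  qed
  also have "\<dots> \<subseteq> interior L'"
    unfolding L'_def
    by (rule interior_maximal) (intro UN_mono subset_refl ball_subset_cball, intro open_UN ballI open_ball)
  finally have KL': "K' \<subseteq> interior L'" .
  have LL': "L' \<subseteq> L"
  proof
    fix z assume "z \<in> L'"
    then obtain k i where ki: "k \<in> J" "i < N k" "z \<in> cball (x k i) (2 ^ d / 2 ^ k)" by (auto simp: L'_def)
    then have "z \<in> cball (x k i) e" using k0[OF J(4)[OF ki(1)]] by auto
    then show "z \<in> L" using e(2) xK[OF ki(1,2)] interior_subset[of L] by blast
  qed
  have AEK': "AE z in M'. z \<in> K'"
  proof (rule AEM')
    show "K' \<in> sets borel" using cK' by (intro borel_closed compact_imp_closed)
    fix k i and u :: 'a assume ki: "k \<in> J" "i < N k" and u: "\<forall>b\<in>Basis. u \<bullet> b \<in> {1 / 4 .. 3 / 4}"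
    have "norm u / 2 ^ k \<le> real d / 2 ^ k"
      using norm_le_DIM[OF u] by (simp add: d_def divide_right_mono)
    then have "x k i + (1 / 2 ^ k) *\<^sub>R u \<in> cball (x k i) (real d / 2 ^ k)"
      by (simp add: dist_norm)
    then show "x k i + (1 / 2 ^ k) *\<^sub>R u \<in> K'" using ki by (auto simp: K'_def)
  qed
  \<comment> \<open>Every summand is a square-integrable cutoff \<open>ch k\<close> times an average
    of numbers of modulus 1.\<close>
  have L2': "(\<integral>\<^sup>+ y. ennreal ((cmod (fourier_measure M' y))\<^sup>2) \<partial>lborel) < \<infinity>"
  proof (rule nn_integral_square_average_less_top[of J ch])
    show "(\<integral>\<^sup>+ y. ennreal ((cmod (ch k y))\<^sup>2) \<partial>lborel) < \<infinity>" for k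
      using G(2)[of k] by (auto simp: ch_def intro: order.strict_trans1)
    fix y
    have "cmod (\<Sum>k\<in>J. ch k y * ((\<Sum>i<N k. cis (- 2 * pi * (x k i \<bullet> y))) / of_nat (N k))) \<le> (\<Sum>k\<in>J. cmod (ch k y))"
    proof (rule sum_norm_le)
      fix k assume k: "k \<in> J"
      have "cmod (\<Sum>i<N k. cis (- 2 * pi * (x k i \<bullet> y))) \<le> (\<Sum>i<N k. 1)" by (rule sum_norm_le) simp
      then have "cmod ((\<Sum>i<N k. cis (- 2 * pi * (x k i \<bullet> y))) / of_nat (N k)) \<le> 1"
        using N0[OF k] by (simp add: norm_divide)
      then show "cmod (ch k y * ((\<Sum>i<N k. cis (- 2 * pi * (x k i \<bullet> y))) / of_nat (N k))) \<le> cmod (ch k y)"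
        by (simp only: norm_mult mult_left_le norm_ge_zero)
    qed
    then show "cmod (fourier_measure M' y) \<le> (\<Sum>k\<in>J. cmod (ch k y)) / real (card J)"
      unfolding fM' by (simp add: norm_divide divide_right_mono)
  qed (use J in auto)
  have st': "stage M' K'" using M' cK' AEK' L2' by (simp add: stage_def)

  \<comment> \<open>\<open>A\<close> is the sampling error, seen through the cutoffs;
    \<open>B\<close> is the effect of the cutoffs on the old transform.\<close>
  define A where "A y = (\<Sum>k\<in>J. ch k y * ((\<Sum>i<N k. cis (- 2 * pi * (x k i \<bullet> y)) - \<nu> y) / of_nat (N k))) / of_nat n" for y
  define B where "B y = ((\<Sum>k\<in>J. ch k y - 1) / of_nat n) * \<nu> y" for y
  have [measurable]: "A \<in> borel_measurable borel" "B \<in> borel_measurable borel"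
    unfolding A_def B_def by measurable
  have AB: "fourier_measure M' y - \<nu> y = A y + B y" for y
  proof -
    have "ch k y * ((\<Sum>i<N k. cis (- 2 * pi * (x k i \<bullet> y)) - \<nu> y) / of_nat (N k))
        = ch k y * ((\<Sum>i<N k. cis (- 2 * pi * (x k i \<bullet> y))) / of_nat (N k)) - ch k y * \<nu> y" if "k \<in> J" for k
      using N0[OF that] by (simp add: sum_subtractf diff_divide_distrib right_diff_distrib)
    then have "A y = fourier_measure M' y - (\<Sum>k\<in>J. ch k y) / of_nat n * \<nu> y"
      by (simp add: A_def fM' J(3) sum_subtractf diff_divide_distrib sum_distrib_right cong: sum.cong)
    moreover have "B y = (\<Sum>k\<in>J. ch k y) / of_nat n * \<nu> y - \<nu> y"
      using n by (simp add: B_def sum_subtractf J(3) diff_divide_distrib left_diff_distrib)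
    ultimately show ?thesis by simp
  qed
  define h where "h k y = cmod (ch k y) * (cmod (\<Sum>i<N k. cis (- 2 * pi * (x k i \<bullet> y)) - \<nu> y) / sqrt (real (N k)))" for k y
  have "lorentz_norm_pow p q A \<le> ennreal (C * real (card J) * c powr q)"
  proof (intro multi[rule_format, OF c J(1,2), of h])
    have "h k \<in> borel_measurable borel" for k unfolding h_def by measurable
    then show "h k \<in> borel_measurable lebesgue" for k by (intro measurable_completion) simp
    show "emeasure lebesgue {x. l \<le> h k x} \<le> ennreal (C0 * 2 ^ (k * DIM('a)) * l powr - r)"
      if k: "k \<in> J" and l: "0 < l" and r: "r \<in> {2, 2 * p}" for k l r
    proof -
      have "emeasure lebesgue {x. l \<le> h k x} \<le> ennreal ((2 * r) powr r * (4 * exp 4 * (G * 2 ^ (k * d))) * l powr - r)"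
        unfolding h_def using r p by (intro tail[OF k _ l]) auto
      also have "\<dots> \<le> ennreal (C0 * 2 ^ (k * DIM('a)) * l powr - r)"
      proof (intro ennreal_leI mult_right_mono)
        have "(2 * r) powr r \<le> 4 powr 2 + (4 * p) powr (2 * p)" using r by auto
        then have "(2 * r) powr r * (4 * exp 4 * G) \<le> C0"
          unfolding C0_def using G by (intro mult_right_mono) auto
        then have "(2 * r) powr r * (4 * exp 4 * G) * 2 ^ (k * d) \<le> C0 * 2 ^ (k * d)"
          by (rule mult_right_mono) simp
        then show "(2 * r) powr r * (4 * exp 4 * (G * 2 ^ (k * d))) \<le> C0 * 2 ^ (k * DIM('a))"
          by (simp add: d_def mult.assoc)
      qed simp
      finally show ?thesis .
    qed
    fix y
    have "cmod (A y) \<le> (\<Sum>k\<in>J. cmod (ch k y) * (cmod (\<Sum>i<N k. cis (- 2 * pi * (x k i \<bullet> y)) - \<nu> y) / real (N k))) / real n"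
      unfolding A_def norm_divide
      by (simp, intro divide_right_mono order_trans[OF norm_sum] sum_mono) (auto simp: norm_mult norm_divide)
    also have "\<dots> \<le> (\<Sum>k\<in>J. c * a ^ k * h k y)"
      unfolding sum_divide_distrib
    proof (rule sum_mono)
      fix k assume k: "k \<in> J"
      have "1 / (real n * c * a ^ k) \<le> sqrt (real (N k))"
        using N(1)[OF k] by (intro real_le_rsqrt) (simp add: X_def)
      then have s: "1 \<le> sqrt (real (N k)) * (real n * c * a ^ k)"
        using nca[of k] by (simp add: divide_le_eq)
      define S where "S = cmod (\<Sum>i<N k. cis (- 2 * pi * (x k i \<bullet> y)) - \<nu> y)"
      have sq: "0 < sqrt (real (N k))" "real (N k) = sqrt (real (N k)) * sqrt (real (N k))"
        using N0[OF k] by auto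
      have "cmod (ch k y) * (S / real (N k)) / real n = h k y * (1 / (sqrt (real (N k)) * real n))"
        unfolding h_def S_def[symmetric] by (subst sq(2)) (simp add: field_simps)
      also have "\<dots> \<le> h k y * (c * a ^ k)"
        using s sq n by (intro mult_left_mono) (auto simp: h_def divide_le_eq mult_ac)
      finally show "cmod (ch k y) * (cmod (\<Sum>i<N k. cis (- 2 * pi * (x k i \<bullet> y)) - \<nu> y) / real (N k)) / real n
          \<le> c * a ^ k * h k y" by (simp add: S_def mult_ac)
    qed
    finally show "cmod (A y) \<le> (\<Sum>k\<in>J. c * (2 powr - (DIM('a) / p)) ^ k * h k y)"
      by (simp add: a_def d_def)
  qed
  then have lA: "lorentz_norm_pow p q A \<le> ennreal (C * \<theta> powr q)"
    using ncq by (simp add: J(3) mult.assoc)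
  have avg: "S / real n \<le> m" if "S \<le> (\<Sum>k\<in>J. m)" for S m :: real
    using that n by (simp add: J(3) divide_le_eq mult.commute)
  \<comment> \<open>All scales are at least \<open>k0\<close>, so the coarsest one bounds the
    average of the deviations from 1.\<close>
  have Bm: "cmod (B y) \<le> min 2 (2 * pi * real d * norm y / 2 ^ k0) * cmod (\<nu> y)" for y
  proof -
    have "cmod (\<Sum>k\<in>J. ch k y - 1) \<le> (\<Sum>k\<in>J. min 2 (2 * pi * real d * norm y / 2 ^ k0))"
    proof (rule sum_norm_le)
      fix k assume "k \<in> J"
      then have "k0 \<le> k" by (rule J(4))
      then have "(2::real) ^ k0 \<le> 2 ^ k" by simp
      have "cmod (ch k y - 1) \<le> min 2 (2 * pi * real d * norm ((1 / 2 ^ k) *\<^sub>R y))"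
        unfolding ch_def d_def by (rule cube_hat_near_1)
      also have "\<dots> \<le> min 2 (2 * pi * real d * norm y / 2 ^ k0)"
        using \<open>(2::real) ^ k0 \<le> 2 ^ k\<close> by (intro min.mono order_refl) (auto intro!: divide_left_mono)
      finally show "cmod (ch k y - 1) \<le> min 2 (2 * pi * real d * norm y / 2 ^ k0)" .
    qed
    then have "cmod (\<Sum>k\<in>J. ch k y - 1) / real n \<le> min 2 (2 * pi * real d * norm y / 2 ^ k0)"
      by (rule avg)
    then show ?thesis unfolding B_def norm_mult norm_divide norm_of_nat
      by (rule mult_right_mono) simp
  qed
  have lB: "lorentz_norm_pow p q B \<le> ennreal (CB * E powr (q / p))"
    unfolding CB_def
  proof (rule lorentz_norm_pow_bounded_L2[OF p])
    show "cmod (B y) \<le> 2" for y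
    proof -
      have "min 2 (2 * pi * real d * norm y / 2 ^ k0) * cmod (\<nu> y) \<le> 2 * 1"
        using \<nu>1 by (intro mult_mono) auto
      then show ?thesis using Bm[of y] by simp
    qed
    have "(\<integral>\<^sup>+ y. ennreal ((cmod (B y))\<^sup>2) \<partial>lborel)
        \<le> (\<integral>\<^sup>+ y. ennreal ((min 2 (2 * pi * real d * norm y / 2 ^ k0) * cmod (\<nu> y))\<^sup>2) \<partial>lborel)"
      by (intro nn_integral_mono ennreal_leI power_mono Bm) auto
    also have "\<dots> \<le> ennreal E" using k0[of k0] by simp
    finally show "(\<integral>\<^sup>+ y. ennreal ((cmod (B y))\<^sup>2) \<partial>lebesgue) \<le> ennreal E"
      by (simp add: nn_integral_completion)
    show "B \<in> borel_measurable lebesgue" by (rule measurable_completion) simp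
  qed (use q E in auto)
  have "lorentz_norm_pow p q (\<lambda>y. fourier_measure M' y - fourier_measure M y) = lorentz_norm_pow p q (\<lambda>y. A y + B y)"
    using AB by (simp add: \<nu>_def)
  also have "\<dots> \<le> ennreal Cq * (lorentz_norm_pow p q A + lorentz_norm_pow p q B)"
    unfolding Cq_def using p q by (intro lorentz_norm_pow_add_le) (auto intro: measurable_completion)
  also have "\<dots> \<le> ennreal Cq * (ennreal (C * \<theta> powr q) + ennreal (CB * E powr (q / p)))"
    by (intro mult_left_mono add_mono lA lB) auto
  also have "\<dots> = ennreal (Cq * (C * \<theta> powr q) + Cq * (CB * E powr (q / p)))"
    using Cq C CB by (simp add: ennreal_plus[symmetric] ennreal_mult[symmetric] distrib_left del: ennreal_plus)
  also have "\<dots> = ennreal \<epsilon>" unfolding \<theta>(2) E(2) by simp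
  finally have lor: "lorentz_norm_pow p q (\<lambda>y. fourier_measure M' y - fourier_measure M y) \<le> ennreal \<epsilon>" .

  \<comment> \<open>\<open>L'\<close> consists of closed balls while covers use open ones. Doubling
    the radius bridges this and keeps the diameters powers of two.\<close>
  have "L' \<subseteq> (\<Union>k\<in>J. \<Union>i<N k. ball (x k i) (2 ^ (d + 1) / 2 ^ k))"
  proof -
    have "(2::real) ^ d / 2 ^ k < 2 ^ (d + 1) / 2 ^ k" for k by (simp add: divide_strict_right_mono)
    then have "cball z (2 ^ d / 2 ^ k) \<subseteq> ball z (2 ^ (d + 1) / 2 ^ k)" for z :: 'a and k
      unfolding cball_subset_ball_iff by simp
    then show ?thesis unfolding L'_def by (intro UN_mono subset_refl)
  qed
  then obtain Bc where Bc: "ball_cover L' \<delta> Bc"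
    "cover_cost \<alpha> \<beta> Bc = (\<Sum>k\<in>J. ennreal ((real (N k) * (2 ^ Suc (d + 1) / 2 ^ k) powr \<alpha>) powr \<beta>))"
    using ball_cover_dyadic_family[OF J(1) \<beta>0, where s="d + 1" and \<delta>=\<delta> and F=L' and N=N and x=x and \<alpha>=\<alpha>] k0 J(4) \<delta> by auto
  \<comment> \<open>2^(-k*\<alpha>) equals (a^k)^2 and cancels the factor in \<open>X k\<close>, so
    the bound is the same at every scale.\<close>
  have summand_le: "(real (N k) * (2 ^ Suc (d + 1) / 2 ^ k) powr \<alpha>) powr \<beta> \<le> (D / (real n * c)\<^sup>2) powr \<beta>" if k: "k \<in> J" for k
  proof (intro powr_mono2)
    have "((2::real) ^ k) powr \<alpha> = 2 powr (real k * \<alpha>)" by (simp add: powr_powr powr_realpow[symmetric])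
    also have "\<dots> = (2 powr (real d / p * real k)) powr 2" by (simp only: powr_powr) (simp add: \<alpha>_def mult_ac)
    also have "2 powr (real d / p * real k) = 1 / a ^ k"
      by (simp add: a_def powr_minus powr_powr powr_realpow[symmetric] field_simps)
    finally have ak: "((2::real) ^ k) powr \<alpha> = (1 / a ^ k)\<^sup>2" using a by simp
    have "real (N k) * (2 ^ Suc (d + 1) / 2 ^ k) powr \<alpha> \<le> (2 * X k) * (2 ^ Suc (d + 1) / 2 ^ k) powr \<alpha>"
      using N(2)[OF k] by (intro mult_right_mono) auto
    also have "\<dots> = D / (real n * c)\<^sup>2"
      using a by (simp add: powr_divide ak X_def D_def field_simps power_mult_distrib)
    finally show "real (N k) * (2 ^ Suc (d + 1) / 2 ^ k) powr \<alpha> \<le> D / (real n * c)\<^sup>2" .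
  qed (use \<beta>0 in auto)
  have "cover_cost \<alpha> \<beta> Bc \<le> (\<Sum>k\<in>J. ennreal ((D / (real n * c)\<^sup>2) powr \<beta>))"
    unfolding Bc(2) by (intro sum_mono ennreal_leI summand_le)
  also have "\<dots> = ennreal (real n * (D / (real n * c)\<^sup>2) powr \<beta>)"
    by (simp add: J(3) ennreal_mult ennreal_of_nat_eq_real_of_nat)
  also have "\<dots> \<le> ennreal \<epsilon>" using cost by (intro ennreal_leI) (simp add: c_def)
  finally have "cover_cost \<alpha> \<beta> Bc \<le> ennreal \<epsilon>" .
  with st' cL' KL' LL' lor Bc(1) show ?thesis unfolding \<alpha>_def d_def by blast
qed

section \<open>Weak limits of measures on the cube\<close>

text \<open>A cosine cut off so that it is 0 within distance 1/3 of the even integers and 1 within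
  distance 1/3 of the odd ones: a variant of the function in Schoenberg's space-filling
  curve.\<close>

definition schoenberg :: "real \<Rightarrow> real" where
  "schoenberg x = max 0 (min 1 (1 / 2 - cos (pi * x)))"

lemma schoenberg_bounds: "0 \<le> schoenberg x" "schoenberg x \<le> 1"
  by (auto simp: schoenberg_def)

lemma continuous_schoenberg: "continuous_on UNIV schoenberg"
  unfolding schoenberg_def by (intro continuous_intros)

text \<open>For digits 0 and 1 this is the point of the Cantor set with ternary digits
  \<open>2 * a l\<close>.\<close>

definition ternary :: "(nat \<Rightarrow> real) \<Rightarrow> real" where
  "ternary a = (\<Sum>l. 2 * a l / 3 ^ Suc l)"

lemma sums_two_thirds: "(\<lambda>l. 2 / 3 ^ Suc l :: real) sums 1"
proof -
  have "(\<lambda>l. (2 / 3) * (1 / 3) ^ l :: real) sums ((2 / 3) * (1 / (1 - 1 / 3)))"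
    by (intro sums_mult geometric_sums) auto
  then show ?thesis by (simp add: power_divide)
qed

lemma
  fixes a :: "nat \<Rightarrow> real"
  assumes a: "\<And>i. 0 \<le> a i \<and> a i \<le> 1"
  shows summable_ternary: "summable (\<lambda>l. 2 * a l / 3 ^ Suc l)"
    and ternary_nonneg: "0 \<le> ternary a"
    and ternary_le_1: "ternary a \<le> 1"
proof -
  have s: "summable (\<lambda>l. 2 / 3 ^ Suc l :: real)" using sums_two_thirds by (rule sums_summable)
  have le: "2 * a l / 3 ^ Suc l \<le> 2 / 3 ^ Suc l" for l
    using a[of l] by (intro divide_right_mono) auto
  show sa: "summable (\<lambda>l. 2 * a l / 3 ^ Suc l)"
    by (rule summable_comparison_test'[OF s, of 0]) (use le a in auto)
  show "0 \<le> ternary a" unfolding ternary_def using a by (intro suminf_nonneg sa) auto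
  have "ternary a \<le> (\<Sum>l. 2 / 3 ^ Suc l :: real)"
    unfolding ternary_def by (intro suminf_le le sa s)
  then show "ternary a \<le> 1" using sums_unique[OF sums_two_thirds] by simp
qed

lemma ternary_shift:
  fixes a :: "nat \<Rightarrow> real"
  assumes a: "\<And>i. 0 \<le> a i \<and> a i \<le> 1"
  shows "3 * ternary a = 2 * a 0 + ternary (\<lambda>i. a (Suc i))"
proof -
  have "ternary a = 2 * a 0 / 3 + (\<Sum>l. 2 * a (Suc l) / 3 ^ Suc (Suc l))"
    unfolding ternary_def using suminf_split_head[OF summable_ternary[of a, OF a]] by simp
  also have "(\<Sum>l. 2 * a (Suc l) / 3 ^ Suc (Suc l)) = (\<Sum>l. (1 / 3) * (2 * a (Suc l) / 3 ^ Suc l))"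
    by (simp add: mult_ac)
  also have "\<dots> = (1 / 3) * ternary (\<lambda>i. a (Suc i))"
    unfolding ternary_def using a by (intro suminf_mult summable_ternary) auto
  finally show ?thesis by simp
qed

text \<open>Multiplying by \<open>3 ^ i\<close> removes the first \<open>i\<close> ternary digits up to an even integer, which the
  2-periodic function \<^const>\<open>schoenberg\<close> does not see.\<close>
lemma schoenberg_ternary:
  fixes a :: "nat \<Rightarrow> real"
  assumes a: "\<And>i. a i = 0 \<or> a i = 1"
  shows "schoenberg (3 ^ i * ternary a) = a i"
proof -
  have a01: "0 \<le> a i \<and> a i \<le> 1" for i using a[of i] by auto
  have "\<exists>n::int. 3 ^ i * ternary a = 2 * real_of_int n + ternary (\<lambda>l. a (l + i))"
  proof (induction i)
    case 0 then show ?case by (intro exI[of _ 0]) simp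
  next
    case (Suc i)
    then obtain n :: int where n: "3 ^ i * ternary a = 2 * real_of_int n + ternary (\<lambda>l. a (l + i))" by blast
    obtain m :: int where m: "a i = real_of_int m" using a[of i] by (metis of_int_0 of_int_1)
    have "3 * ternary (\<lambda>l. a (l + i)) = 2 * a i + ternary (\<lambda>l. a (l + Suc i))"
      using ternary_shift[of "\<lambda>l. a (l + i)"] a01 by simp
    with n m have "3 ^ Suc i * ternary a = 2 * real_of_int (3 * n + m) + ternary (\<lambda>l. a (l + Suc i))"
      by simp
    then show ?case by blast
  qed
  then obtain n :: int where n: "3 ^ i * ternary a = 2 * real_of_int n + ternary (\<lambda>l. a (l + i))" by blast
  define y where "y = ternary (\<lambda>l. a (l + i))"
  define z where "z = ternary (\<lambda>l. a (l + Suc i))"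
  have z: "0 \<le> z" "z \<le> 1" unfolding z_def using a01 by (auto intro: ternary_nonneg ternary_le_1)
  \<comment> \<open>Hence y lies in [0, 1/3] for digit 0 and in [2/3, 1] for digit 1, where the
    cut-off cosine is constant.\<close>
  have yz: "3 * y = 2 * a i + z" unfolding y_def z_def
    using ternary_shift[of "\<lambda>l. a (l + i)"] a01 by simp
  have "cos (pi * (3 ^ i * ternary a)) = cos (pi * y + 2 * pi * real_of_int n)"
    by (simp only: n y_def) (simp add: algebra_simps)
  also have "\<dots> = cos (pi * y)"
    by (simp add: cos_add)
  finally have c: "schoenberg (3 ^ i * ternary a) = max 0 (min 1 (1 / 2 - cos (pi * y)))"
    by (simp add: schoenberg_def)
  from a[of i] show ?thesis
  proof
    assume 0: "a i = 0"
    have "cos (pi / 3) \<le> cos (pi * y)"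
      using yz z 0 by (intro cos_monotone_0_pi_le) (auto simp: field_simps)
    then show ?thesis using 0 by (simp add: c cos_60)
  next
    assume 1: "a i = 1"
    have "cos (pi * y) \<le> cos (2 * pi / 3)"
      using yz z 1 by (intro cos_monotone_0_pi_le) (auto simp: field_simps)
    then show ?thesis using 1 by (simp add: c cos_120)
  qed
qed

section \<open>Binary digits and the space-filling curve\<close>

definition bin_digit :: "nat \<Rightarrow> real \<Rightarrow> real" where
  "bin_digit m x = real_of_int (\<lfloor>2 ^ Suc m * x\<rfloor> - 2 * \<lfloor>2 ^ m * x\<rfloor>)"

lemma bin_digit_01: "bin_digit m x = 0 \<or> bin_digit m x = 1"
proof -
  define y where "y = 2 ^ m * x"
  have "\<lfloor>2 * y\<rfloor> - 2 * \<lfloor>y\<rfloor> = 0 \<or> \<lfloor>2 * y\<rfloor> - 2 * \<lfloor>y\<rfloor> = 1" by linarith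
  then show ?thesis by (auto simp: bin_digit_def y_def mult.assoc)
qed

lemma measurable_bin_digit [measurable]: "bin_digit m \<in> borel_measurable borel"
  unfolding bin_digit_def by measurable

text \<open>The terms are the differences of consecutive binary truncations, so the series
  telescopes; 0 <= x < 1 makes the initial truncation 0.\<close>

lemma bin_digit_sums:
  assumes x: "0 \<le> x" "x < 1"
  shows "(\<lambda>m. bin_digit m x / 2 ^ Suc m) sums x"
proof -
  define f where "f m = real_of_int \<lfloor>2 ^ m * x\<rfloor> / 2 ^ m" for m
  have "(\<lambda>m. f (Suc m) - f m) sums (x - f 0)"
  proof (rule telescope_sums)
    have "(\<lambda>m. x - (1 / 2) ^ m) \<longlonglongrightarrow> x - 0"
      by (intro tendsto_intros LIMSEQ_power_zero) auto
    moreover have "x - (1 / 2) ^ m \<le> f m" "f m \<le> x" for m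
    proof -
      have "2 ^ m * x - 1 \<le> real_of_int \<lfloor>2 ^ m * x\<rfloor>" "real_of_int \<lfloor>2 ^ m * x\<rfloor> \<le> 2 ^ m * x" by linarith+
      from this[THEN divide_right_mono, of "2 ^ m"] show "x - (1 / 2) ^ m \<le> f m" "f m \<le> x"
        by (simp_all add: f_def diff_divide_distrib power_divide)
    qed
    ultimately show "f \<longlonglongrightarrow> x"
      by (intro tendsto_sandwich[of "\<lambda>m. x - (1 / 2) ^ m" f sequentially "\<lambda>_. x"]) auto
  qed
  moreover have "f 0 = 0" using x by (simp add: f_def floor_eq_iff)
  moreover have "f (Suc m) - f m = bin_digit m x / 2 ^ Suc m" for m
    by (simp add: f_def bin_digit_def field_simps)
  ultimately show ?thesis by simp
qed

lemma continuous_suminf_dyadic: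
  fixes f :: "nat \<Rightarrow> real \<Rightarrow> real"
  assumes c: "\<And>m. continuous_on UNIV (f m)" and b: "\<And>m t. \<bar>f m t\<bar> \<le> 1"
  shows "continuous_on UNIV (\<lambda>t. \<Sum>m. f m t / 2 ^ Suc m)"
proof (rule uniform_limit_theorem)
  show "uniform_limit UNIV (\<lambda>n t. \<Sum>m<n. f m t / 2 ^ Suc m) (\<lambda>t. \<Sum>m. f m t / 2 ^ Suc m) sequentially"
  proof (rule Weierstrass_m_test)
    show "norm (f m t / 2 ^ Suc m) \<le> (1 / 2) ^ Suc m" for m t
      using b[of m t] by (simp add: power_divide divide_right_mono del: power_Suc)
    show "summable (\<lambda>m. (1 / 2) ^ Suc m :: real)" using power_half_series by (rule sums_summable)
  qed
  show "\<forall>\<^sub>F n in sequentially. continuous_on UNIV (\<lambda>t. \<Sum>m<n. f m t / 2 ^ Suc m)"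
    using c by (intro always_eventually allI continuous_intros) auto
qed auto

text \<open>Schoenberg's space-filling curve together with a Borel right inverse on the cube: this transports
  Helly's selection theorem from the line to Euclidean space.\<close>
lemma space_filling_curve:
  obtains h :: "real \<Rightarrow> 'a::euclidean_space" and T :: "'a \<Rightarrow> real"
  where "continuous_on UNIV h" "T \<in> borel_measurable borel" "\<And>x. 0 \<le> T x \<and> T x \<le> 1"
    "\<And>x. (\<And>b. b \<in> Basis \<Longrightarrow> 0 \<le> x \<bullet> b \<and> x \<bullet> b < 1) \<Longrightarrow> h (T x) = x"
proof -
  define d where "d = DIM('a)"
  have d: "0 < d" by (simp add: d_def)
  obtain e where e: "bij_betw e {0..<d} (Basis::'a set)"
    using ex_bij_betw_nat_finite[of "Basis::'a set"] by (auto simp: d_def)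
  \<comment> \<open>The digits of all coordinates are interleaved: position m * d + j holds digit m
    of coordinate j.\<close>
  define a where "a x i = bin_digit (i div d) (x \<bullet> e (i mod d))" for x i
  have a: "a x i = 0 \<or> a x i = 1" for x i unfolding a_def by (rule bin_digit_01)
  have a01: "0 \<le> a x i \<and> a x i \<le> 1" for x i using a[of x i] by auto
  define T where "T x = ternary (a x)" for x
  define H where "H j t = (\<Sum>m. schoenberg (3 ^ (m * d + j) * t) / 2 ^ Suc m)" for j t
  define h where "h t = (\<Sum>j<d. H j t *\<^sub>R e j)" for t
  have "continuous_on UNIV (H j)" for j
    unfolding H_def
    by (intro continuous_suminf_dyadic continuous_on_compose2[OF continuous_schoenberg] continuous_intros)
       (use schoenberg_bounds in auto)
  then have hc: "continuous_on UNIV h" unfolding h_def by (intro continuous_intros) auto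
  have am: "(\<lambda>x. a x i) \<in> borel_measurable borel" for i
    unfolding a_def by measurable
  have Tm: "T \<in> borel_measurable borel"
    unfolding T_def ternary_def by (intro borel_measurable_suminf borel_measurable_divide borel_measurable_times am) auto
  have T01: "0 \<le> T x \<and> T x \<le> 1" for x
    unfolding T_def using ternary_nonneg[OF a01] ternary_le_1[OF a01] by auto
  have hT: "h (T x) = x" if x: "\<And>b. b \<in> Basis \<Longrightarrow> 0 \<le> x \<bullet> b \<and> x \<bullet> b < 1" for x
  proof -
    have H: "H j (T x) = x \<bullet> e j" if j: "j < d" for j
    proof -
      have "schoenberg (3 ^ (m * d + j) * T x) = bin_digit m (x \<bullet> e j)" for m
        unfolding T_def by (subst schoenberg_ternary) (use a j in \<open>auto simp: a_def\<close>)
      moreover have "e j \<in> Basis" using e j by (auto simp: bij_betw_def)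
      ultimately show ?thesis
        unfolding H_def using sums_unique[OF bin_digit_sums, of "x \<bullet> e j"] x by simp
    qed
    have "h (T x) = (\<Sum>j\<in>{0..<d}. (x \<bullet> e j) *\<^sub>R e j)"
      by (auto simp: h_def H atLeast0LessThan intro!: sum.cong)
    also have "\<dots> = (\<Sum>b\<in>Basis. (x \<bullet> b) *\<^sub>R b)"
      by (rule sum.reindex_bij_betw[OF e])
    finally show ?thesis by (simp add: euclidean_representation)
  qed
  show thesis by (rule that[OF hc Tm T01 hT])
qed

text \<open>The measures are moved to [0, 1] by \<open>T\<close>, Helly's theorem applies there, and
  the limit is moved back by \<open>h\<close>. Test functions are composed with \<open>h\<close>
  alone, so continuity of \<open>h\<close> suffices although \<open>T\<close> is merely Borel;
  \<open>h (T x) = x\<close> almost everywhere recovers the original integrals.\<close>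

lemma weak_limit_in_cube:
  fixes M :: "nat \<Rightarrow> 'a::euclidean_space measure"
  assumes M: "\<And>n. sets (M n) = sets borel" and P: "\<And>n. prob_space (M n)"
    and cube: "\<And>n. AE x in M n. \<forall>b\<in>Basis. 0 \<le> x \<bullet> b \<and> x \<bullet> b < 1"
  shows "\<exists>(N :: 'a measure) (r :: nat \<Rightarrow> nat). strict_mono r \<and> sets N = sets borel \<and> prob_space N \<and>
    (\<forall>f :: 'a \<Rightarrow> complex. continuous_on UNIV f \<longrightarrow> (\<forall>x. cmod (f x) \<le> 1) \<longrightarrow>
      (\<lambda>n. \<integral>x. f x \<partial>M (r n)) \<longlonglongrightarrow> (\<integral>x. f x \<partial>N))"
proof -
  obtain h :: "real \<Rightarrow> 'a" and T :: "'a \<Rightarrow> real"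
    where hc: "continuous_on UNIV h" and T [measurable]: "T \<in> borel_measurable borel"
      and T01: "\<And>x. 0 \<le> T x \<and> T x \<le> 1"
      and hT: "\<And>x. (\<And>b. b \<in> Basis \<Longrightarrow> 0 \<le> x \<bullet> b \<and> x \<bullet> b < 1) \<Longrightarrow> h (T x) = x"
    by (rule space_filling_curve) blast
  note M [measurable_cong]
  have [measurable]: "h \<in> borel_measurable borel" using hc by (rule borel_measurable_continuous_onI)
  define Q where "Q n = distr (M n) borel T" for n
  have Q: "real_distribution (Q n)" for n
    unfolding Q_def by (rule prob_space.real_distribution_distr[OF P]) measurable
  have "tight Q" unfolding tight_def
  proof (intro conjI allI impI Q)
    fix e :: real assume e: "0 < e"
    \<comment> \<open>The interval is open on the left, so it starts at -1 in order to include the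
      value 0.\<close>
    have "measure (Q n) {- 1<..1} = 1" for n
    proof -
      have "T -` {- 1<..1} \<inter> space (M n) = space (M n)" using T01 by force
      then show ?thesis unfolding Q_def by (subst measure_distr) (auto simp: prob_space.prob_space[OF P])
    qed
    then show "\<exists>a b. a < b \<and> (\<forall>n. 1 - e < measure (Q n) {a<..b})"
      using e by (intro exI[of _ "-1"] exI[of _ 1]) auto
  qed
  from tight_imp_convergent_subsubsequence[OF this strict_mono_id] obtain r R
    where r: "strict_mono (r :: nat \<Rightarrow> nat)" and R: "real_distribution R" "weak_conv_m (Q \<circ> id \<circ> r) R" by blast
  interpret R: real_distribution R by fact
  define N where "N = distr R borel h"
  have N: "sets N = sets borel" "prob_space N"
    unfolding N_def by (auto intro: R.prob_space_distr)
  have lim: "(\<lambda>n. \<integral>x. f x \<partial>M (r n)) \<longlonglongrightarrow> (\<integral>x. f x \<partial>N)"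
    if f: "continuous_on UNIV f" "\<And>x. cmod (f x) \<le> 1" for f :: "'a \<Rightarrow> complex"
  proof -
    have [measurable]: "f \<in> borel_measurable borel" using f(1) by (rule borel_measurable_continuous_onI)
    have "isCont (\<lambda>t. f (h t)) t" for t
      using continuous_on_compose2[OF f(1) hc] by (simp add: continuous_on_eq_continuous_at)
    then have "(\<lambda>n. \<integral>t. f (h t) \<partial>(Q \<circ> id \<circ> r) n) \<longlonglongrightarrow> (\<integral>t. f (h t) \<partial>R)"
      using Q f(2) by (intro weak_conv_imp_integral_bdd_continuous_conv[OF _ R]) auto
    moreover have "(\<integral>t. f (h t) \<partial>(Q \<circ> id \<circ> r) n) = (\<integral>x. f x \<partial>M (r n))" for n
    proof -
      have "(\<integral>t. f (h t) \<partial>(Q \<circ> id \<circ> r) n) = (\<integral>x. f (h (T x)) \<partial>M (r n))"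
        by (simp add: Q_def integral_distr)
      also have "\<dots> = (\<integral>x. f x \<partial>M (r n))"
        by (rule integral_cong_AE) (use cube[of "r n"] hT in auto)
      finally show ?thesis .
    qed
    moreover have "(\<integral>t. f (h t) \<partial>R) = (\<integral>x. f x \<partial>N)" by (simp add: N_def integral_distr)
    ultimately show ?thesis by simp
  qed
  from r N lim show ?thesis by blast
qed

section \<open>The limit measure\<close>

lemma stage_cube: "stage (cube_measure :: 'a::euclidean_space measure) (cbox ((1 / 4) *\<^sub>R One) ((3 / 4) *\<^sub>R One))"
  unfolding stage_def
proof (intro conjI)
  show "AE x in cube_measure. x \<in> cbox ((1 / 4) *\<^sub>R One) ((3 / 4) *\<^sub>R (One::'a))"
    using AE_cube by eventually_elim (simp add: mem_box)
qed (use prob_space_cube nn_integral_cube_hat_square in \<open>auto simp: cube_hat_def\<close>)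

lemma measure_support_subset:
  fixes N :: "'a::euclidean_space measure"
  assumes N: "sets N = sets borel" and S: "closed S" and AE: "AE x in N. x \<in> S"
  shows "measure_support N \<subseteq> S"
proof
  fix x assume x: "x \<in> measure_support N"
  show "x \<in> S"
  proof (rule ccontr)
    assume "x \<notin> S"
    then obtain e where e: "0 < e" "ball x e \<subseteq> - S"
      using S open_contains_ball[of "- S"] by (auto simp: closed_def)
    have sp: "space N = UNIV" using sets_eq_imp_space_eq[OF N] by simp
    have "AE y in N. y \<notin> ball x e" using AE by eventually_elim (use e in auto)
    then have "emeasure N (ball x e) = 0"
      by (subst (asm) AE_iff_measurable[of "ball x e"]) (auto simp: N sp)
    then show False using x e(1) by (auto simp: measure_support_def)
  qed
qed

text \<open>The truncated distance to \<open>S\<close> is a bounded continuous test function whose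
  integrals are eventually 0, so it vanishes almost everywhere for the limit. Nonemptiness enters
  because the distance to the empty set is 0 by convention.\<close>

lemma AE_closed_of_weak_limit:
  fixes N :: "'a::euclidean_space measure"
  assumes N: "sets N = sets borel" "prob_space N" and S: "closed S" "S \<noteq> {}"
    and lim: "\<And>f :: 'a \<Rightarrow> complex. continuous_on UNIV f \<Longrightarrow> (\<And>x. cmod (f x) \<le> 1) \<Longrightarrow>
      (\<lambda>n. \<integral>x. f x \<partial>M n) \<longlonglongrightarrow> (\<integral>x. f x \<partial>N)"
    and AE: "\<forall>\<^sub>F n in sequentially. AE x in M n. x \<in> S"
  shows "AE x in N. x \<in> S"
proof -
  interpret prob_space N by fact
  note N(1) [measurable_cong]
  define g where "g x = min 1 (infdist x S)" for x :: 'a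
  have gc: "continuous_on UNIV g" unfolding g_def by (intro continuous_intros)
  have [measurable]: "g \<in> borel_measurable borel" using gc by (rule borel_measurable_continuous_onI)
  have g01: "0 \<le> g x" "g x \<le> 1" for x by (auto simp: g_def infdist_nonneg)
  have "(\<lambda>n. \<integral>x. of_real (g x) \<partial>M n) \<longlonglongrightarrow> (\<integral>x. complex_of_real (g x) \<partial>N)"
    using gc g01 by (intro lim continuous_intros) auto
  moreover have "(\<lambda>n. \<integral>x. complex_of_real (g x) \<partial>M n) \<longlonglongrightarrow> 0"
    using AE
  proof (rule tendsto_eventually[OF eventually_mono])
    fix n assume n: "AE x in M n. x \<in> S"
    have "AE x in M n. complex_of_real (g x) = 0"
      using n by eventually_elim (simp add: g_def)
    then show "(\<integral>x. complex_of_real (g x) \<partial>M n) = 0" by (rule integral_eq_zero_AE)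
  qed
  ultimately have "(\<integral>x. complex_of_real (g x) \<partial>N) = 0" by (rule LIMSEQ_unique)
  then have "(\<integral>x. g x \<partial>N) = 0" by simp
  moreover have "integrable N g" using g01 by (intro integrable_const_bound[where B=1]) auto
  ultimately have "AE x in N. g x = 0"
    using g01 by (subst (asm) integral_nonneg_eq_0_iff_AE) auto
  then show ?thesis
  proof eventually_elim
    case (elim x)
    then have "infdist x S = 0" by (simp add: g_def min_def split: if_splits)
    then show ?case using S by (simp add: in_closed_iff_infdist_zero)
  qed
qed

lemma NH_cap_eq_0:
  assumes "\<And>\<delta> \<epsilon>. 0 < \<delta> \<Longrightarrow> 0 < \<epsilon> \<Longrightarrow> \<exists>B. ball_cover S \<delta> B \<and> cover_cost \<alpha> \<beta> B \<le> ennreal \<epsilon>"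
  shows "NH_cap \<alpha> \<beta> S = 0"
proof -
  have z: "NH_cap_delta \<alpha> \<beta> S \<delta> = 0" if \<delta>: "0 < \<delta>" for \<delta>
  proof -
    have "NH_cap_delta \<alpha> \<beta> S \<delta> \<le> 0 + ennreal \<epsilon>" if \<epsilon>: "0 < \<epsilon>" for \<epsilon>
    proof -
      obtain B where "ball_cover S \<delta> B" "cover_cost \<alpha> \<beta> B \<le> ennreal \<epsilon>" using assms[OF \<delta> \<epsilon>] by blast
      then show ?thesis unfolding NH_cap_delta_def by (auto intro: INF_lower2)
    qed
    then have "NH_cap_delta \<alpha> \<beta> S \<delta> \<le> 0" by (rule ennreal_le_epsilon)
    then show ?thesis by simp
  qed
  have "((\<lambda>\<delta>. NH_cap_delta \<alpha> \<beta> S \<delta>) \<longlongrightarrow> 0) (at_right 0)"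
    by (rule tendsto_eventually[OF eventually_mono[OF eventually_at_right_less]]) (rule z)
  then show ?thesis unfolding NH_cap_def by (intro tendsto_Lim) auto
qed

lemma ball_cover_mono: "ball_cover F \<delta> B \<Longrightarrow> F' \<subseteq> F \<Longrightarrow> \<delta> \<le> \<delta>' \<Longrightarrow> ball_cover F' \<delta>' B"
  unfolding ball_cover_def by (auto intro: order.strict_trans2)

text \<open>The limit is compared with the telescoping increments through level sets, which needs
  only pointwise convergence along a subsequence. The denominator in the bound on increment n
  cancels the weight 2^(n+2) to the power q/p, and the amplification 2^(n+3) to the power q, of the
  term with index n + 1.\<close>

lemma lorentz_norm_pow_limit_less_top:
  fixes f :: "nat \<Rightarrow> 'a::euclidean_space \<Rightarrow> complex"
  assumes p: "0 < p" and q: "0 < q"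
    and [measurable]: "\<And>n. f n \<in> borel_measurable lebesgue"
    and lim: "\<And>y. (\<lambda>n. f (r n) y) \<longlonglongrightarrow> g y"
    and f0: "lorentz_norm_pow p q (f 0) < top"
    and step: "\<And>n. lorentz_norm_pow p q (\<lambda>y. f (Suc n) y - f n y)
      \<le> ennreal ((1 / 2) ^ Suc n / ((2 ^ (n + 2)) powr (q / p) * (2 ^ (n + 3)) powr q))"
  shows "lorentz_norm_pow p q g < top"
proof -
  define D where "D n = (if n = 0 then f 0 else (\<lambda>y. f n y - f (n - 1) y))" for n
  have [measurable]: "D n \<in> borel_measurable lebesgue" for n unfolding D_def by (cases n) auto
  have tele: "f n y = (\<Sum>i\<le>n. D i y)" for n y
    by (induction n) (auto simp: D_def)
  \<comment> \<open>With 2^(n+2) the sums stay below t/2 if no term reaches t. The gap between t/2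
    and t survives the passage to the limit, where strictness is lost.\<close>
  define F where "F n y = of_real (2 ^ (n + 2)) * D n y" for n y
  have "lorentz_norm_pow p q g \<le> (\<Sum>n. ennreal ((2 ^ Suc n) powr (q / p)) * lorentz_norm_pow p q (F n))"
  proof (rule lorentz_norm_pow_countable[OF p q])
    show "F n \<in> borel_measurable lebesgue" for n unfolding F_def by measurable
    fix t :: real and y assume t: "0 < t" "t \<le> cmod (g y)"
    show "\<exists>n. t \<le> cmod (F n y)"
    proof (rule ccontr)
      assume "\<not> ?thesis"
      then have lt: "cmod (D n y) < t / 2 ^ (n + 2)" for n
        by (auto simp: F_def norm_mult norm_power not_le field_simps)
      have "cmod (f n y) \<le> t / 2" for n
      proof -
        have "cmod (f n y) \<le> (\<Sum>i\<le>n. t / 2 ^ (i + 2))"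
          unfolding tele by (intro sum_norm_le less_imp_le lt)
        also have "\<dots> = t / 2 * (\<Sum>i\<le>n. (1 / 2) ^ Suc i)"
          by (simp add: sum_distrib_left power_divide field_simps)
        also have "(\<Sum>i\<le>n. (1 / 2) ^ Suc i) \<le> (1::real)"
          using sum_le_suminf[OF sums_summable[OF power_half_series], of "{..n}"] sums_unique[OF power_half_series] by simp
        then have "t / 2 * (\<Sum>i\<le>n. (1 / 2) ^ Suc i) \<le> t / 2 * 1" using t by (intro mult_left_mono) auto
        finally show ?thesis by simp
      qed
      moreover have "(\<lambda>n. cmod (f (r n) y)) \<longlonglongrightarrow> cmod (g y)" by (intro tendsto_norm lim)
      ultimately have "cmod (g y) \<le> t / 2"
        by (intro LIMSEQ_le_const2[of "\<lambda>n. cmod (f (r n) y)"]) auto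
      then show False using t by simp
    qed
  qed
  also have "\<dots> = ennreal ((2 ^ Suc 0) powr (q / p)) * lorentz_norm_pow p q (F 0)
      + (\<Sum>n. ennreal ((2 ^ Suc (Suc n)) powr (q / p)) * lorentz_norm_pow p q (F (Suc n)))"
    by (subst sums_unique[OF sums_Suc[OF summable_sums[OF summableI]], symmetric]) (simp add: add.commute)
  also have "\<dots> < top"
  proof -
    have F: "lorentz_norm_pow p q (F n) = ennreal ((2 ^ (n + 2)) powr q) * lorentz_norm_pow p q (D n)" for n
      unfolding F_def using p q by (intro lorentz_norm_pow_cmult) auto
    have "ennreal ((2 ^ Suc 0) powr (q / p)) * lorentz_norm_pow p q (F 0) < top"
      unfolding F using f0 by (auto simp: D_def ennreal_mult_less_top)
    moreover have "(\<Sum>n. ennreal ((2 ^ Suc (Suc n)) powr (q / p)) * lorentz_norm_pow p q (F (Suc n))) \<le> (\<Sum>n. ennreal ((1 / 2) ^ Suc n))"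
    proof (intro suminf_le)
      fix n
      let ?a = "(2 ^ (n + 2)) powr (q / p)" and ?b = "(2 ^ (n + 3)) powr q :: real"
      have "ennreal ((2 ^ Suc (Suc n)) powr (q / p)) * lorentz_norm_pow p q (F (Suc n))
          \<le> ennreal ?a * (ennreal ?b * ennreal ((1 / 2) ^ Suc n / (?a * ?b)))"
        unfolding F using step[of n] by (intro mult_mono) (auto simp: D_def eval_nat_numeral)
      also have "\<dots> = ennreal (?a * (?b * ((1 / 2) ^ Suc n / (?a * ?b))))"
        by (subst ennreal_mult[symmetric]; (subst ennreal_mult[symmetric])?; simp)
      also have "?a * (?b * ((1 / 2) ^ Suc n / (?a * ?b))) = (1 / 2) ^ Suc n"
        by (simp add: field_simps)
      finally show "ennreal ((2 ^ Suc (Suc n)) powr (q / p)) * lorentz_norm_pow p q (F (Suc n)) \<le> ennreal ((1 / 2) ^ Suc n)" .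
    qed auto
    moreover have "(\<Sum>n. ennreal ((1 / 2) ^ Suc n)) = ennreal 1"
      by (rule suminf_ennreal_eq[OF _ power_half_series]) simp
    ultimately show ?thesis by (auto intro: le_less_trans)
  qed
  finally show ?thesis .
qed

theorem theorem1p9:
  fixes p q \<beta> :: real
  assumes "2 < p" and "1 < q" and "\<beta> > (q / (q - 1)) / 2"
  shows "\<exists>(S::'a::euclidean_space set) (M::'a measure).
           compact S \<and> sets M = sets borel \<and> prob_space M \<and> measure_support M \<subseteq> S \<and>
           in_lorentz p q (fourier_measure M) \<and>
           NH_cap (2 * real DIM('a) / p) \<beta> S = 0"
proof -
  define \<alpha> where "\<alpha> = 2 * real DIM('a) / p"
  define good where "good = (\<lambda>(M :: 'a measure, K, L). stage M K \<and> compact L \<and> K \<subseteq> interior L)"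
  \<comment> \<open>The tolerance for the increments is the one for which the amplified series
    converges to a finite Lorentz expression of the limit.\<close>
  define next_ok where "next_ok n = (\<lambda>(M :: 'a measure, K :: 'a set, L :: 'a set) (M' :: 'a measure, K' :: 'a set, L' :: 'a set). L' \<subseteq> L \<and>
    lorentz_norm_pow p q (\<lambda>y. fourier_measure M' y - fourier_measure M y)
      \<le> ennreal ((1 / 2) ^ Suc n / ((2 ^ (n + 2)) powr (q / p) * (2 ^ (n + 3)) powr q)) \<and>
    (\<exists>B. ball_cover L' ((1 / 2) ^ n) B \<and> cover_cost \<alpha> \<beta> B \<le> ennreal ((1 / 2) ^ n)))" for n :: nat
  define K0 where "K0 = cbox ((1 / 4) *\<^sub>R One) ((3 / 4) *\<^sub>R (One::'a))"
  define L0 where "L0 = cbox ((1 / 8) *\<^sub>R One) ((7 / 8) *\<^sub>R (One::'a))"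
  have "x \<in> interior L0" if "x \<in> K0" for x
  proof -
    have "1 / 4 \<le> x \<bullet> b \<and> x \<bullet> b \<le> 3 / 4" if "b \<in> Basis" for b
      using that \<open>x \<in> K0\<close> by (auto simp: K0_def mem_box)
    then have "1 / 8 < x \<bullet> b \<and> x \<bullet> b < 7 / 8" if "b \<in> Basis" for b
      using that by force
    then show ?thesis by (auto simp: L0_def interior_cbox mem_box)
  qed
  then have g0: "good (cube_measure, K0, L0)"
    unfolding good_def using stage_cube by (auto simp: K0_def L0_def)
  have "\<exists>s'. good s' \<and> next_ok n s s'" if gd: "good s" for n s
  proof -
    obtain M K L where s: "s = (M, K, L)" by (metis prod_cases3)
    \<comment> \<open>One tolerance for both demands on the step, the cover cost and the Lorentz
      increment.\<close>
    define \<epsilon> where "\<epsilon> = min ((1 / 2) ^ n) ((1 / 2) ^ Suc n / ((2 ^ (n + 2)) powr (q / p) * (2 ^ (n + 3)) powr q))"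
    have \<epsilon>: "0 < \<epsilon>" by (simp add: \<epsilon>_def)
    obtain M' K' L' where st': "stage M' K'" "compact L'" "K' \<subseteq> interior L'" "L' \<subseteq> L"
      and le: "lorentz_norm_pow p q (\<lambda>y. fourier_measure M' y - fourier_measure M y) \<le> ennreal \<epsilon>"
        "\<exists>B. ball_cover L' ((1 / 2) ^ n) B \<and> cover_cost (2 * real DIM('a) / p) \<beta> B \<le> ennreal \<epsilon>"
      using stage_step[OF assms, of M K L \<epsilon> "(1 / 2) ^ n"] gd \<epsilon> by (auto simp: s good_def)
    have e1: "ennreal \<epsilon> \<le> ennreal ((1 / 2) ^ n)"
      unfolding \<epsilon>_def by (intro ennreal_leI min.cobounded1)
    have e2: "ennreal \<epsilon> \<le> ennreal ((1 / 2) ^ Suc n / ((2 ^ (n + 2)) powr (q / p) * (2 ^ (n + 3)) powr q))"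
      unfolding \<epsilon>_def by (intro ennreal_leI min.cobounded2)
    have "\<exists>B. ball_cover L' ((1 / 2) ^ n) B \<and> cover_cost \<alpha> \<beta> B \<le> ennreal ((1 / 2) ^ n)"
      using le(2) order_trans[OF _ e1] unfolding \<alpha>_def by blast
    then have "good (M', K', L') \<and> next_ok n s (M', K', L')"
      unfolding good_def next_ok_def s prod.case using st' order_trans[OF le(1) e2] by blast
    then show ?thesis by blast
  qed
  then have "\<exists>s. \<forall>n. (good (s n) \<and> (n = 0 \<longrightarrow> s n = (cube_measure, K0, L0))) \<and> next_ok n (s n) (s (Suc n))"
    using g0 by (intro dependent_nat_choice) auto
  then obtain s where gs: "\<And>n. good (s n)" and s0: "s 0 = (cube_measure, K0, L0)"
    and ns: "\<And>n. next_ok n (s n) (s (Suc n))" by blast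
  define M where "M n = fst (s n)" for n
  define K where "K n = fst (snd (s n))" for n
  define L where "L n = snd (snd (s n))" for n
  have s: "s n = (M n, K n, L n)" for n by (simp add: M_def K_def L_def)
  have st: "stage (M n) (K n)" and cL: "compact (L n)" and KL: "K n \<subseteq> L n" for n
    using gs[of n] interior_subset[of "L n"] by (auto simp: s good_def)
  have M: "sets (M n) = sets borel" and P: "prob_space (M n)" and AEK: "AE x in M n. x \<in> K n" for n
    using st[of n] by (auto simp: stage_def)
  have M0: "M 0 = cube_measure" and L0: "L 0 = L0" using s0 by (auto simp: M_def L_def)
  have dec: "L n \<subseteq> L m" if "m \<le> n" for m n
    using that by (rule lift_Suc_antimono_le[rotated]) (use ns in \<open>auto simp: s next_ok_def\<close>)
  have AEL: "AE x in M n. x \<in> L m" if "m \<le> n" for m n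
    using AEK[of n] by eventually_elim (use dec[OF that] KL[of n] in auto)
  have cube: "AE x in M n. \<forall>b\<in>Basis. 0 \<le> x \<bullet> b \<and> x \<bullet> b < 1" for n
    using AEL[of 0 n, OF le0]
  proof eventually_elim
    case (elim x)
    then have "1 / 8 \<le> x \<bullet> b \<and> x \<bullet> b \<le> 7 / 8" if "b \<in> Basis" for b
      using that by (auto simp: L0 L0_def mem_box)
    then show ?case by force
  qed
  obtain N :: "'a measure" and r :: "nat \<Rightarrow> nat" where r: "strict_mono r" and N: "sets N = sets borel" "prob_space N"
    and lim: "\<forall>f :: 'a \<Rightarrow> complex. continuous_on UNIV f \<longrightarrow> (\<forall>x. cmod (f x) \<le> 1) \<longrightarrow>
      (\<lambda>n. \<integral>x. f x \<partial>M (r n)) \<longlonglongrightarrow> (\<integral>x. f x \<partial>N)"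
    using weak_limit_in_cube[of M, OF M P cube] by blast
  define S where "S = (\<Inter>n. L n)"
  have clL: "closed (L n)" for n using cL by (rule compact_imp_closed)
  have "compact S"
  proof -
    have "S = L 0 \<inter> S" by (auto simp: S_def)
    moreover have "closed S" unfolding S_def using clL by blast
    ultimately show ?thesis using cL[of 0] by (metis compact_Int_closed)
  qed
  have "AE x in N. x \<in> L n" for n
  proof (rule AE_closed_of_weak_limit[OF N clL _ lim[rule_format]])
    \<comment> \<open>An empty set could not carry the probability measure
      \<open>M n\<close>.\<close>
    show "L n \<noteq> {}"
    proof
      assume "L n = {}"
      with AEL[of n n] have "AE x in M n. False" by simp
      then show False using prob_space.AE_False[OF P] by simp
    qed
    show "\<forall>\<^sub>F m in sequentially. AE x in M (r m). x \<in> L n"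
      using eventually_ge_at_top[of n]
    proof eventually_elim
      case (elim m)
      then show ?case using seq_suble[OF r, of m] by (intro AEL) simp
    qed
  qed
  then have "AE x in N. x \<in> S" unfolding S_def by (simp add: AE_all_countable)
  then have "measure_support N \<subseteq> S"
    using \<open>compact S\<close> by (intro measure_support_subset N compact_imp_closed)
  have fm: "fourier_measure (M n) \<in> borel_measurable lebesgue" for n
    by (intro measurable_completion) (simp add: measurable_fourier_measure[OF M P])
  have "lorentz_norm_pow p q (fourier_measure N) < top"
  proof (rule lorentz_norm_pow_limit_less_top[of p q "\<lambda>n. fourier_measure (M n)" r])
    show "(\<lambda>n. fourier_measure (M (r n)) y) \<longlonglongrightarrow> fourier_measure N y" for y
      unfolding fourier_measure_def by (intro lim[rule_format] continuous_intros) auto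
    obtain G where G: "0 \<le> G" "(\<integral>\<^sup>+ y. ennreal ((cmod (cube_hat (y::'a)))\<^sup>2) \<partial>lborel) = ennreal G"
      using nn_integral_cube_hat_square[where 'a='a]
      by (cases "(\<integral>\<^sup>+ y. ennreal ((cmod (cube_hat (y::'a)))\<^sup>2) \<partial>lborel)") auto
    have "lorentz_norm_pow p q (cube_hat :: 'a \<Rightarrow> complex)
        \<le> ennreal (q * (2 powr ((p - 2) * q / p) / ((p - 2) * q / p)) * G powr (q / p))"
    proof (rule lorentz_norm_pow_bounded_L2)
      show "cmod (cube_hat y) \<le> 2" for y :: 'a using norm_cube_hat_le[of y] by linarith
    qed (use assms G in \<open>auto simp: nn_integral_completion intro: measurable_completion\<close>)
    then show "lorentz_norm_pow p q (fourier_measure (M 0)) < top"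
      by (simp add: M0 cube_hat_def le_less_trans)
    show "lorentz_norm_pow p q (\<lambda>y. fourier_measure (M (Suc n)) y - fourier_measure (M n) y)
      \<le> ennreal ((1 / 2) ^ Suc n / ((2 ^ (n + 2)) powr (q / p) * (2 ^ (n + 3)) powr q))" for n
      using ns[of n] by (simp add: s next_ok_def)
  qed (use assms fm in auto)
  then have "in_lorentz p q (fourier_measure N)"
    unfolding in_lorentz_def by (auto intro!: measurable_completion simp: measurable_fourier_measure[OF N])
  moreover have "NH_cap \<alpha> \<beta> S = 0"
  proof (rule NH_cap_eq_0)
    fix \<delta> \<epsilon> :: real assume "0 < \<delta>" "0 < \<epsilon>"
    then obtain n where n: "(1 / 2) ^ n < min \<delta> \<epsilon>"
      using real_arch_pow_inv[of "min \<delta> \<epsilon>" "1 / 2"] by auto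
    \<comment> \<open>The cover produced in step \<open>n\<close> is one of
      \<open>L (Suc n)\<close>, which still contains \<open>S\<close>.\<close>
    obtain B where B: "ball_cover (L (Suc n)) ((1 / 2) ^ n) B" "cover_cost \<alpha> \<beta> B \<le> ennreal ((1 / 2) ^ n)"
      using ns[of n] by (auto simp: s next_ok_def)
    have "ball_cover S \<delta> B" using B(1) n by (rule_tac ball_cover_mono) (auto simp: S_def)
    moreover have "cover_cost \<alpha> \<beta> B \<le> ennreal \<epsilon>"
      using n by (intro order_trans[OF B(2)] ennreal_leI) simp
    ultimately show "\<exists>B. ball_cover S \<delta> B \<and> cover_cost \<alpha> \<beta> B \<le> ennreal \<epsilon>" by blast
  qed
  ultimately show ?thesis
    using \<open>compact S\<close> N \<open>measure_support N \<subseteq> S\<close> unfolding \<alpha>_def by blast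
qed

end
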